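(* Let $\phi$ be a $k$-CNF formula on $n$ variables with $m$ clauses in which every variable appears in at most $d$ clauses. (a) Suppose $[d(k+1)]^{1+\eta}\le 2^{k+1}/\mathrm{e}$ for some $\eta>0$. Then for every $\alpha,\beta,\gamma\in(0,1]$ with $(\alpha+\gamma)/\beta<\eta$, there exists an $(n^{\beta},O(m),n^{-\gamma})$-local computation algorithm for $\phi$ that answers up to $n^{\alpha}$ queries. (b) Suppose $d(k+1)\le(1-\epsilon)2^{k+1}/\mathrm{e}$ for some $\epsilon>0$. Then for every $\beta\in(0,1]$ and $c>0$ there exists an $(n^{\beta},O(m),\log^{-c}(n))$-local computation algorithm for $\phi$ that answers up to $\log^{c}(n)$ queries.
   Context: A $(t,s,\delta)$-local computation algorithm answering up to $q$ queries is a randomized algorithm that receives, one by one, a sequence of up to $q$ queries (each a variable of $\phi$) and for each outputs a truth value for it, such that with probability at least $1-\delta$ there exists a satisfying assignment of $\phi$ agreeing with all outputs; it has RAM access to the input (the variable–clause incidence structure, stored as linked lists), a random tape and persistent local memory, runs in time at most $t$ per query and uses local memory at most $s$. "There exists" such an algorithm means there are $n_0$ and an algorithm with these guarantees for all such formulas with $n\ge n_0$ variables. *)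

theory Defs
  imports "HOL-Probability.Probability" "HOL-Library.Log_Nat"
begin

section \<open>CNF formulas\<close>

text \<open>The variables are the numbers below \<open>n\<close>. The literal \<open>(x, b)\<close> is true under an assignment
  \<open>\<sigma>\<close> iff \<open>\<sigma> x = b\<close>. The order of the clauses, and of the literals in a clause, is arbitrary, and
  a clause may occur repeatedly; \<open>length \<phi>\<close> is the number of clauses.\<close>

type_synonym literal = "nat \<times> bool"
type_synonym clause = "literal list"
type_synonym cnf = "clause list"

definition clause_vars :: "clause \<Rightarrow> nat set" where
  "clause_vars C = fst ` set C"

definition occurrences :: "cnf \<Rightarrow> nat \<Rightarrow> nat set" where
  "occurrences \<phi> x = {c. c < length \<phi> \<and> x \<in> clause_vars (\<phi> ! c)}"

definition satisfies :: "(nat \<Rightarrow> bool) \<Rightarrow> cnf \<Rightarrow> bool" where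
  "satisfies \<sigma> \<phi> \<longleftrightarrow> (\<forall>C\<in>set \<phi>. \<exists>(x, b)\<in>set C. \<sigma> x = b)"

text \<open>Every clause consists of exactly \<open>k\<close> literals on pairwise distinct variables.\<close>

definition kcnf :: "nat \<Rightarrow> nat \<Rightarrow> cnf \<Rightarrow> bool" where
  "kcnf k n \<phi> \<longleftrightarrow>
    (\<forall>C\<in>set \<phi>. length C = k \<and> distinct (map fst C) \<and> clause_vars C \<subseteq> {..<n})"

definition max_occurrences :: "nat \<Rightarrow> nat \<Rightarrow> cnf \<Rightarrow> bool" where
  "max_occurrences d n \<phi> \<longleftrightarrow> (\<forall>x<n. card (occurrences \<phi> x) \<le> d)"


section \<open>The input: incidence structure as linked lists\<close>

text \<open>A list node occupies two consecutive words, the item and the address of the next node;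
  address 0 is the null pointer.\<close>

fun linked_list :: "nat list \<Rightarrow> nat \<Rightarrow> nat list \<Rightarrow> bool" where
  "linked_list inp p [] \<longleftrightarrow> p = 0"
| "linked_list inp p (v # vs) \<longleftrightarrow>
    p \<noteq> 0 \<and> p + 1 < length inp \<and> inp ! p = v \<and> linked_list inp (inp ! (p + 1)) vs"

definition literal_code :: "literal \<Rightarrow> nat" where
  "literal_code l = 2 * fst l + of_bool (snd l)"

text \<open>The input starts with \<open>n\<close>, \<open>m\<close>, one pointer per variable (to the list of the indices of the
  clauses containing it) and one pointer per clause (to the list of its literals). The order of
  the variable lists and the placement of the nodes are left open, so algorithms must cope with
  all of them; the length just makes room for the nodes of all lists and keeps addresses
  proportional to the size of \<open>\<phi>\<close>.\<close>

definition input_of :: "nat list \<Rightarrow> nat \<Rightarrow> cnf \<Rightarrow> bool" where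
  "input_of inp n \<phi> \<longleftrightarrow>
    (let m = length \<phi> in
      length inp = 2 + n + m + 4 * sum_list (map length \<phi>) \<and>
      inp ! 0 = n \<and> inp ! 1 = m \<and>
      (\<forall>x<n. \<exists>cs. distinct cs \<and> set cs = occurrences \<phi> x \<and> linked_list inp (inp ! (2 + x)) cs) \<and>
      (\<forall>c<m. linked_list inp (inp ! (2 + n + c)) (map literal_code (\<phi> ! c))))"


section \<open>A word RAM with random tape\<close>

text \<open>Programs are structured; registers are named in the program text, so a program has only
  constantly many of them. Register contents and memory cells are words, i.e. numbers below \<open>W\<close>.
  The local memory, the read-only input and the random tape are accessed indirectly, by computed
  addresses. Subtraction is truncated, and division by zero yields zero.\<close>

type_synonym reg = nat

datatype operand = Reg reg | Const nat

datatype arith = Add | Sub | Mul | Div | Mod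

datatype com =
    Skip
  | Arith reg arith operand operand
  | Load reg operand
  | Store operand operand
  | ReadInput reg operand
  | ReadRandom reg operand
  | Seq com com
  | If operand com com
  | While operand com

type_synonym regs = "reg \<Rightarrow> nat"
type_synonym memory = "nat \<Rightarrow> nat"
type_synonym random_tape = "nat \<Rightarrow> bool"

fun val :: "nat \<Rightarrow> regs \<Rightarrow> operand \<Rightarrow> nat" where
  "val W \<rho> (Reg r) = \<rho> r"
| "val W \<rho> (Const c) = c mod W"

fun arith_op :: "arith \<Rightarrow> nat \<Rightarrow> nat \<Rightarrow> nat" where
  "arith_op Add a b = a + b"
| "arith_op Sub a b = a - b"
| "arith_op Mul a b = a * b"
| "arith_op Div a b = a div b"
| "arith_op Mod a b = a mod b"

text \<open>\<open>exec W S inp \<omega> c (\<rho>, \<mu>) t (\<rho>', \<mu>')\<close>: started with registers \<open>\<rho>\<close> and local memory \<open>\<mu>\<close>, program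
  \<open>c\<close> halts after \<open>t\<close> steps with registers \<open>\<rho>'\<close> and local memory \<open>\<mu>'\<close>, all accesses to the local
  memory having been to the cells \<open>0, \<dots>, S - 1\<close>. An access beyond them has no rule: such an
  execution is stuck.\<close>

inductive exec ::
  "nat \<Rightarrow> nat \<Rightarrow> nat list \<Rightarrow> random_tape \<Rightarrow> com \<Rightarrow> regs \<times> memory \<Rightarrow> nat \<Rightarrow> regs \<times> memory \<Rightarrow> bool"
  for W S :: nat and inp :: "nat list" and \<omega> :: random_tape
where
  Skip: "exec W S inp \<omega> Skip (\<rho>, \<mu>) 1 (\<rho>, \<mu>)"
| Arith: "exec W S inp \<omega> (Arith r f a b) (\<rho>, \<mu>) 1
    (\<rho>(r := arith_op f (val W \<rho> a) (val W \<rho> b) mod W), \<mu>)"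
| Load: "val W \<rho> a < S \<Longrightarrow>
    exec W S inp \<omega> (Load r a) (\<rho>, \<mu>) 1 (\<rho>(r := \<mu> (val W \<rho> a)), \<mu>)"
| Store: "val W \<rho> a < S \<Longrightarrow>
    exec W S inp \<omega> (Store a b) (\<rho>, \<mu>) 1 (\<rho>, \<mu>(val W \<rho> a := val W \<rho> b))"
| ReadInput: "exec W S inp \<omega> (ReadInput r a) (\<rho>, \<mu>) 1
    (\<rho>(r := (if val W \<rho> a < length inp then inp ! val W \<rho> a mod W else 0)), \<mu>)"
| ReadRandom: "exec W S inp \<omega> (ReadRandom r a) (\<rho>, \<mu>) 1
    (\<rho>(r := of_bool (\<omega> (val W \<rho> a)) mod W), \<mu>)"
| Seq: "exec W S inp \<omega> c s t s' \<Longrightarrow> exec W S inp \<omega> c' s' t' s'' \<Longrightarrow>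
    exec W S inp \<omega> (Seq c c') s (t + t') s''"
| IfTrue: "val W (fst s) a \<noteq> 0 \<Longrightarrow> exec W S inp \<omega> c s t s' \<Longrightarrow>
    exec W S inp \<omega> (If a c c') s (1 + t) s'"
| IfFalse: "val W (fst s) a = 0 \<Longrightarrow> exec W S inp \<omega> c' s t s' \<Longrightarrow>
    exec W S inp \<omega> (If a c c') s (1 + t) s'"
| WhileTrue: "val W (fst s) a \<noteq> 0 \<Longrightarrow> exec W S inp \<omega> c s t s' \<Longrightarrow>
    exec W S inp \<omega> (While a c) s' t' s'' \<Longrightarrow>
    exec W S inp \<omega> (While a c) s (1 + t + t') s''"
| WhileFalse: "val W (fst s) a = 0 \<Longrightarrow> exec W S inp \<omega> (While a c) s 1 s"


section \<open>Local computation algorithms\<close>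

text \<open>An algorithm is a program \<open>P\<close> together with a constant \<open>L\<close>: it runs on words of
  \<open>L\<close> times the bit length of \<open>n\<close> many bits.\<close>

definition word_bound :: "nat \<Rightarrow> nat \<Rightarrow> nat" where
  "word_bound L n = 2 ^ (L * floorlog 2 n)"

text \<open>\<open>answers P W S t inp \<omega> \<mu> xs bs\<close>: from local memory \<open>\<mu>\<close>, the queries \<open>xs\<close> are processed one by one
  within time \<open>t\<close> each and are answered by \<open>bs\<close>. A query is passed and answered in register 0.
  Only the local memory persists between queries; the registers do not.\<close>

inductive answers ::
  "com \<Rightarrow> nat \<Rightarrow> nat \<Rightarrow> real \<Rightarrow> nat list \<Rightarrow> random_tape \<Rightarrow> memory \<Rightarrow> nat list \<Rightarrow> bool list \<Rightarrow> bool"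
  for P :: com and W S :: nat and t :: real and inp :: "nat list" and \<omega> :: random_tape
where
  Nil: "answers P W S t inp \<omega> \<mu> [] []"
| Cons: "exec W S inp \<omega> P ((\<lambda>_. 0)(0 := x mod W), \<mu>) t' (\<rho>', \<mu>') \<Longrightarrow> real t' \<le> t \<Longrightarrow>
    answers P W S t inp \<omega> \<mu>' xs bs \<Longrightarrow>
    answers P W S t inp \<omega> \<mu> (x # xs) ((\<rho>' 0 \<noteq> 0) # bs)"

definition tape_measure :: "random_tape measure" where
  "tape_measure = (\<Pi>\<^sub>M i\<in>UNIV. measure_pmf (bernoulli_pmf (1 / 2)))"

text \<open>Algorithm \<open>(P, L)\<close> is a \<open>(t, s, \<delta>)\<close>-local computation algorithm for \<open>\<phi>\<close> answering up to \<open>q\<close>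
  queries. The time and space bounds hold for every random tape. The local memory (\<open>s\<close> words) is
  zero initially.\<close>

definition local_computation_algorithm ::
  "com \<Rightarrow> nat \<Rightarrow> real \<Rightarrow> nat \<Rightarrow> real \<Rightarrow> real \<Rightarrow> nat \<Rightarrow> cnf \<Rightarrow> bool" where
  "local_computation_algorithm P L t s \<delta> q n \<phi> \<longleftrightarrow>
    (\<forall>inp xs. input_of inp n \<phi> \<longrightarrow> set xs \<subseteq> {..<n} \<longrightarrow> real (length xs) \<le> q \<longrightarrow>
      (\<forall>\<omega>. \<exists>bs. answers P (word_bound L n) s t inp \<omega> (\<lambda>_. 0) xs bs) \<and>
      measure tape_measure
        {\<omega>. \<exists>bs \<sigma>. answers P (word_bound L n) s t inp \<omega> (\<lambda>_. 0) xs bs \<and>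
                    satisfies \<sigma> \<phi> \<and> bs = map \<sigma> xs} \<ge> 1 - \<delta>)"

text \<open>For every choice of \<open>k\<close>, \<open>d\<close> and bounds depending on \<open>n\<close>: one algorithm that works for all
  sufficiently large \<open>n\<close>, with local memory \<open>O(m)\<close>.\<close>

definition exists_lca ::
  "nat \<Rightarrow> nat \<Rightarrow> (nat \<Rightarrow> real) \<Rightarrow> (nat \<Rightarrow> real) \<Rightarrow> (nat \<Rightarrow> real) \<Rightarrow> bool" where
  "exists_lca k d t \<delta> q \<longleftrightarrow>
    (\<exists>P L K n0. \<forall>n\<ge>n0. \<forall>\<phi>. kcnf k n \<phi> \<longrightarrow> max_occurrences d n \<phi> \<longrightarrow>
      local_computation_algorithm P L (t n) (K * length \<phi>) (\<delta> n) (q n) n \<phi>)"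


section \<open>Sanity checks\<close>

text \<open>Executions are deterministic for a fixed tape, so the answers are unique.\<close>

inductive_cases exec_SkipE: "exec W S inp \<omega> Skip s t s'"
inductive_cases exec_ArithE: "exec W S inp \<omega> (Arith r f a b) s t s'"
inductive_cases exec_LoadE: "exec W S inp \<omega> (Load r a) s t s'"
inductive_cases exec_StoreE: "exec W S inp \<omega> (Store a b) s t s'"
inductive_cases exec_ReadInputE: "exec W S inp \<omega> (ReadInput r a) s t s'"
inductive_cases exec_ReadRandomE: "exec W S inp \<omega> (ReadRandom r a) s t s'"
inductive_cases exec_SeqE: "exec W S inp \<omega> (Seq c c') s t s'"
inductive_cases exec_IfE: "exec W S inp \<omega> (If a c c') s t s'"
inductive_cases exec_WhileE: "exec W S inp \<omega> (While a c) s t s'"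

lemma exec_deterministic:
  "exec W S inp \<omega> c s t s' \<Longrightarrow> exec W S inp \<omega> c s u s'' \<Longrightarrow> t = u \<and> s' = s''"
proof (induction arbitrary: u s'' rule: exec.induct)
  case Skip from Skip.prems show ?case by (rule exec_SkipE) simp_all
next
  case Arith from Arith.prems show ?case by (rule exec_ArithE) simp_all
next
  case Load from Load.prems show ?case by (rule exec_LoadE) simp_all
next
  case Store from Store.prems show ?case by (rule exec_StoreE) simp_all
next
  case ReadInput from ReadInput.prems show ?case by (rule exec_ReadInputE) simp_all
next
  case ReadRandom from ReadRandom.prems show ?case by (rule exec_ReadRandomE) simp_all
next
  case (Seq c s t s' c' t' s2)
  from Seq.prems obtain t1 t2 s1 where *: "u = t1 + t2"
    "exec W S inp \<omega> c s t1 s1" "exec W S inp \<omega> c' s1 t2 s''"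
    by (rule exec_SeqE)
  from Seq.IH(1)[OF *(2)] have "t = t1" "s' = s1" by simp_all
  with Seq.IH(2)[of t2 s''] * show ?case by simp
next
  case (IfTrue s a c t s' c')
  show ?case using IfTrue.prems
    by (rule exec_IfE) (use IfTrue.hyps(1) IfTrue.IH in \<open>fastforce+\<close>)
next
  case (IfFalse s a c' t s' c)
  show ?case using IfFalse.prems
    by (rule exec_IfE) (use IfFalse.hyps(1) IfFalse.IH in \<open>fastforce+\<close>)
next
  case (WhileTrue s a c t s' t' s2)
  show ?case using WhileTrue.prems
  proof (rule exec_WhileE)
    fix t1 s1 t2
    assume *: "u = Suc (t1 + t2)" "exec W S inp \<omega> c s t1 s1" "exec W S inp \<omega> (While a c) s1 t2 s''"
    from WhileTrue.IH(1)[OF *(2)] have "t = t1" "s' = s1" by simp_all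
    with WhileTrue.IH(2)[of t2 s''] * show ?thesis by simp
  next
    assume "val W (fst s) a = 0"
    with WhileTrue.hyps(1) show ?thesis by simp
  qed
next
  case (WhileFalse s a c)
  show ?case using WhileFalse.prems
    by (rule exec_WhileE) (use WhileFalse.hyps in simp_all)
qed

lemma answers_deterministic:
  "answers P W S t inp \<omega> \<mu> xs bs \<Longrightarrow> answers P W S t inp \<omega> \<mu> xs bs' \<Longrightarrow> bs = bs'"
proof (induction arbitrary: bs' rule: answers.induct)
  case Nil then show ?case by (rule answers.cases) simp_all
next
  case (Cons x \<mu> t' \<rho>' \<mu>' xs bs)
  show ?case using Cons.prems
  proof (cases rule: answers.cases)
    case (Cons t2 \<rho>2 \<mu>2 bs2)
    from exec_deterministic[OF Cons.hyps(1) Cons(2)] have eq: "\<rho>2 = \<rho>'" "\<mu>2 = \<mu>'" by simp_all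
    with Cons.IH[of bs2] Cons(4) have "bs = bs2" by simp
    with Cons(1) eq show ?thesis by simp
  qed
qed

text \<open>Every formula has an input representation.\<close>

lemma linked_list_layout1:
  assumes "a > 0"
  shows "\<exists>h cs. length cs = 2 * length vs \<and>
    (\<forall>pre post. length pre = a \<longrightarrow> linked_list (pre @ cs @ post) h vs)"
  using assms
proof (induction vs arbitrary: a)
  case Nil show ?case by (rule exI[of _ 0], rule exI[of _ "[]"]) simp
next
  case (Cons v vs)
  from Cons.IH[of "a + 2"] obtain h cs where len: "length cs = 2 * length vs"
    and l: "\<And>pre post. length pre = a + 2 \<Longrightarrow> linked_list (pre @ cs @ post) h vs" by auto
  have "linked_list (pre @ (v # h # cs) @ post) a (v # vs)" if "length pre = a" for pre post
    using l[of "pre @ [v, h]" post] that Cons.prems by (simp add: nth_append)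
  with len show ?case by (intro exI[of _ a] exI[of _ "v # h # cs"]) auto
qed

lemma linked_list_layout:
  assumes "a > 0"
  shows "\<exists>hs cs. length hs = length vss \<and> length cs = 2 * sum_list (map length vss) \<and>
    (\<forall>pre post. length pre = a \<longrightarrow>
      (\<forall>i<length vss. linked_list (pre @ cs @ post) (hs ! i) (vss ! i)))"
  using assms
proof (induction vss arbitrary: a)
  case Nil show ?case by (rule exI[of _ "[]"], rule exI[of _ "[]"]) simp
next
  case (Cons vs vss)
  obtain h cs where len: "length cs = 2 * length vs"
    and l: "\<And>pre post. length pre = a \<Longrightarrow> linked_list (pre @ cs @ post) h vs"
    using linked_list_layout1[OF Cons.prems] by blast
  obtain hs ds where len': "length hs = length vss" "length ds = 2 * sum_list (map length vss)"
    and l': "\<And>pre post i. length pre = a + length cs \<Longrightarrow> i < length vss \<Longrightarrow>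
      linked_list (pre @ ds @ post) (hs ! i) (vss ! i)"
    using Cons.IH[of "a + length cs"] Cons.prems by auto
  have "linked_list (pre @ (cs @ ds) @ post) ((h # hs) ! i) ((vs # vss) ! i)"
    if "length pre = a" "i < length (vs # vss)" for pre post i
    using l[of pre "ds @ post"] l'[of "pre @ cs" "i - 1" post] that by (cases i) auto
  with len len' show ?case by (intro exI[of _ "h # hs"] exI[of _ "cs @ ds"]) auto
qed

lemma sum_occurrences:
  assumes "kcnf k n \<phi>"
  shows "(\<Sum>x<n. card (occurrences \<phi> x)) = sum_list (map length \<phi>)"
proof -
  have "(\<Sum>x<n. card (occurrences \<phi> x)) =
      (\<Sum>x<n. \<Sum>c<length \<phi>. of_bool (x \<in> clause_vars (\<phi> ! c)))"
    by (intro sum.cong refl) (auto simp: occurrences_def of_bool_def sum.If_cases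
        intro!: arg_cong[where f = card])
  also have "\<dots> = (\<Sum>c<length \<phi>. \<Sum>x<n. of_bool (x \<in> clause_vars (\<phi> ! c)))"
    by (rule sum.swap)
  also have "\<dots> = (\<Sum>c<length \<phi>. length (\<phi> ! c))"
  proof (intro sum.cong refl)
    fix c assume "c \<in> {..<length \<phi>}"
    then have C: "distinct (map fst (\<phi> ! c))" "clause_vars (\<phi> ! c) \<subseteq> {..<n}"
      using assms by (auto simp: kcnf_def)
    have "(\<Sum>x<n. of_bool (x \<in> clause_vars (\<phi> ! c))) = card ({..<n} \<inter> clause_vars (\<phi> ! c))"
      by (auto simp: of_bool_def sum.If_cases)
    also have "\<dots> = card (set (map fst (\<phi> ! c)))"
      using C(2) by (intro arg_cong[where f = card]) (auto simp: clause_vars_def)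
    also have "\<dots> = length (\<phi> ! c)" using distinct_card[OF C(1)] by simp
    finally show "(\<Sum>x<n. of_bool (x \<in> clause_vars (\<phi> ! c))) = length (\<phi> ! c)" .
  qed
  also have "\<dots> = sum_list (map length \<phi>)"
    by (simp add: sum_list_sum_nth atLeast0LessThan)
  finally show ?thesis .
qed

lemma input_exists:
  assumes "kcnf k n \<phi>"
  shows "\<exists>inp. input_of inp n \<phi>"
proof -
  define m where "m = length \<phi>"
  define us where "us = map (\<lambda>x. sorted_list_of_set (occurrences \<phi> x)) [0..<n]"
  define vss where "vss = us @ map (map literal_code) \<phi>"
  have fin: "finite (occurrences \<phi> x)" for x by (simp add: occurrences_def)
  have "sum_list (map length us) = sum_list (map length \<phi>)"
    using sum_occurrences[OF assms]
    by (simp add: us_def o_def interv_sum_list_conv_sum_set_nat atLeast0LessThan)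
  then have tot: "sum_list (map length vss) = 2 * sum_list (map length \<phi>)"
    by (simp add: vss_def o_def)
  obtain hs cs where len: "length hs = n + m" "length cs = 2 * sum_list (map length vss)"
    and l: "\<And>pre post i. length pre = 2 + n + m \<Longrightarrow> i < n + m \<Longrightarrow>
      linked_list (pre @ cs @ post) (hs ! i) (vss ! i)"
    using linked_list_layout[of "2 + n + m" vss] by (auto simp: vss_def us_def m_def)
  define inp where "inp = [n, m] @ hs @ cs"
  have ll: "linked_list inp (inp ! (2 + i)) (vss ! i)" if "i < n + m" for i
    using l[of "[n, m] @ hs" i "[]"] that len by (simp add: inp_def nth_append)
  have "\<exists>cs. distinct cs \<and> set cs = occurrences \<phi> x \<and> linked_list inp (inp ! (2 + x)) cs"
    if "x < n" for x
    using ll[of x] that fin[of x]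
    by (intro exI[of _ "vss ! x"]) (simp add: vss_def us_def nth_append)
  moreover have "linked_list inp (inp ! (2 + n + c)) (map literal_code (\<phi> ! c))" if "c < m" for c
    using ll[of "n + c"] that by (simp add: vss_def us_def nth_append m_def add.assoc)
  moreover have "length inp = 2 + n + m + 4 * sum_list (map length \<phi>)"
    using len tot by (simp add: inp_def)
  ultimately have "input_of inp n \<phi>"
    by (simp add: input_of_def Let_def m_def[symmetric]) (simp add: inp_def)
  then show ?thesis ..
qed

end

theory Submission
  imports Defs "HOL-Real_Asymp.Real_Asymp"
begin

text \<open>
  The algorithm is a Moser--Tardos resampling process: the \<open>i\<close>-th value of variable \<open>x\<close> is read from a
  block of the tape, and the local memory only stores how often each variable has been resampled.
  A query \<open>x\<close> makes \<open>O(log n)\<close> passes over the walks of length \<open>R = \<Theta>(log n)\<close> from \<open>x\<close> in the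
  formula, resampling every violated clause that it meets, and answers with the current value.

  Resampling a clause can only violate clauses that conflict with it, i.e. contain the negation of
  one of its literals. So an event of the process that is preceded by a causal chain of \<open>h\<close> events has
  a witness, a layered set of more than \<open>h\<close> clauses, whose falsification pins down distinct table entries;
  hence any strategy of resampling, even one that knows the table, produces the event only if the witness
  is consistent with the table. With the variables biased as by Gebauer, Szabo and Tardos, the lopsided
  local lemma condition holds with a factor \<open>\<rho> = e d (k + 1) / 2 ^ (k + 1) < 1\<close> to spare for every clause,
  so the consistent witnesses with more than \<open>h\<close> clauses have total probability \<open>O(\<rho> ^ h)\<close>.

  A clause near \<open>x\<close> that is still violated after all passes has a chain through all of them. A later event
  that changes \<open>x\<close> has a chain that enters from outside of the ball of radius \<open>R\<close>, since the query has left the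
  ball free of violated clauses. Outside of these rare events, continuing the process over the whole formula
  ends in a satisfying assignment that agrees with all answers. As a ball has at most \<open>(d k) ^ R\<close> walks,
  \<open>R\<close> can be taken almost \<open>\<beta> log n / log (d (k + 1))\<close>.
\<close>

section \<open>Resampling logs and their witnesses\<close>

text \<open>The bound \<open>2 ^ (k + 1) / e\<close> is about twice what the local lemma yields with
  fair bits when all clauses sharing a variable count as dependent. Hence only conflicts may be
  counted, and biases must compensate for uneven signs. The price: a witness forgets the order of
  two events that share a variable with the same sign, so the row of the table that an event has
  read cannot be recovered from it. This is harmless because such events demand the same value:
  exchanging them changes who is charged for a row, not what the row must contain.

  One estimate for chains is used with two lengths. Chains with \<open>J\<close> links are excluded
  at all clauses, which costs a factor of order \<open>n\<close>, but \<open>J\<close> enters the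
  time linearly. Chains with \<open>R\<close> links are excluded only around queried variables, and
  \<open>R\<close> enters the time as \<open>(d * k) ^ R\<close>. In (a) the hypothesis says \<rho>
  \<le> \<Lambda> powr - \<eta> for \<Lambda> = d (k + 1); with \<open>R\<close> close to \<beta>
  log n / log \<Lambda> one query fails with probability about n powr - (\<beta> \<eta>), and
  \<alpha> + \<gamma> < \<beta> \<eta> leaves room for n powr \<alpha> queries. In (b) a fixed
  \<rho> < 1 gives a negative power of \<open>n\<close>, which beats every power of log n.\<close>

definition violated :: "(nat \<Rightarrow> nat \<Rightarrow> bool) \<Rightarrow> cnf \<Rightarrow> (nat \<Rightarrow> nat) \<Rightarrow> nat \<Rightarrow> bool" where
  "violated U \<phi> \<kappa> c \<longleftrightarrow> (\<forall>(x, b)\<in>set (\<phi> ! c). U x (\<kappa> x) \<noteq> b)"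

definition resamplings :: "cnf \<Rightarrow> nat list \<Rightarrow> nat \<Rightarrow> nat" where
  "resamplings \<phi> l x = length (filter (\<lambda>c. x \<in> clause_vars (\<phi> ! c)) l)"

text \<open>Logs are newest first: the tail is the history that the head has seen. Any violated
  clause may come next, so a bound on valid logs covers the queries as well as every completion,
  even one chosen with knowledge of \<open>U\<close>.\<close>

fun valid_log :: "(nat \<Rightarrow> nat \<Rightarrow> bool) \<Rightarrow> cnf \<Rightarrow> nat list \<Rightarrow> bool" where
  "valid_log U \<phi> [] \<longleftrightarrow> True"
| "valid_log U \<phi> (c # l) \<longleftrightarrow> c < length \<phi> \<and> violated U \<phi> (resamplings \<phi> l) c \<and> valid_log U \<phi> l"

definition conflict :: "cnf \<Rightarrow> nat \<Rightarrow> nat \<Rightarrow> bool" where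
  "conflict \<phi> c c' \<longleftrightarrow> (\<exists>x b. (x, b) \<in> set (\<phi> ! c) \<and> (x, \<not> b) \<in> set (\<phi> ! c'))"

text \<open>Equality is included because a resampled clause may come out violated again, while a
  clause with distinct variables never conflicts with itself.\<close>

definition adjacent :: "cnf \<Rightarrow> nat \<Rightarrow> nat \<Rightarrow> bool" where
  "adjacent \<phi> c c' \<longleftrightarrow> c = c' \<or> conflict \<phi> c c'"

text \<open>A causal chain with \<open>h\<close> links that ends in the newest event;
  \<open>l1\<close> collects the events skipped by a link.\<close>

fun deep :: "cnf \<Rightarrow> nat \<Rightarrow> nat list \<Rightarrow> bool" where
  "deep \<phi> 0 l \<longleftrightarrow> l \<noteq> []"
| "deep \<phi> (Suc h) l \<longleftrightarrow>
    (\<exists>c l1 c' l2. l = c # l1 @ c' # l2 \<and> adjacent \<phi> c' c \<and> deep \<phi> h (c' # l2))"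

text \<open>The Moser-Tardos witness tree, flattened to pairs of depth and clause. Events are
  offered from new to old, and one that is adjacent to nothing in \<open>W\<close> is dropped. As
  adjacency is reflexive, an inserted pair is always new, so a set loses no repetitions.\<close>

definition insert_event :: "cnf \<Rightarrow> (nat \<times> nat) set \<Rightarrow> nat \<Rightarrow> (nat \<times> nat) set" where
  "insert_event \<phi> W e =
    (let A = {i. \<exists>c. (i, c) \<in> W \<and> adjacent \<phi> e c} in
      if A = {} then W else insert (Suc (Max A), e) W)"

definition witness :: "cnf \<Rightarrow> nat \<Rightarrow> nat list \<Rightarrow> (nat \<times> nat) set" where
  "witness \<phi> c l = foldl (insert_event \<phi>) {(0, c)} l"

text \<open>Depth runs backwards in time: the deeper events are charged for the earlier rows of
  column \<open>y\<close>. Within one layer of a witness no two clauses are adjacent, so they agree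
  on the sign of \<open>y\<close>, and breaking ties by clause number serves only to give them
  different rows.\<close>

definition deeper :: "cnf \<Rightarrow> (nat \<times> nat) set \<Rightarrow> nat \<Rightarrow> nat \<Rightarrow> nat \<Rightarrow> (nat \<times> nat) set" where
  "deeper \<phi> W i c y =
    {(j, c') \<in> W. y \<in> clause_vars (\<phi> ! c') \<and> (i < j \<or> i = j \<and> c' < c)}"

definition consistent :: "(nat \<Rightarrow> nat \<Rightarrow> bool) \<Rightarrow> cnf \<Rightarrow> (nat \<times> nat) set \<Rightarrow> bool" where
  "consistent U \<phi> W \<longleftrightarrow>
    (\<forall>(i, c)\<in>W. \<forall>(y, b)\<in>set (\<phi> ! c). U y (card (deeper \<phi> W i c y)) \<noteq> b)"

lemma conflict_sym: "conflict \<phi> c c' \<Longrightarrow> conflict \<phi> c' c"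
  unfolding conflict_def by (elim exE, rename_tac x b, rule_tac x = x in exI, rule_tac x = "\<not> b" in exI) simp

lemma conflictI: "(x, b) \<in> set (\<phi> ! c) \<Longrightarrow> (x, b') \<in> set (\<phi> ! c') \<Longrightarrow> b \<noteq> b' \<Longrightarrow> conflict \<phi> c c'"
  unfolding conflict_def by (rule exI[of _ x], rule exI[of _ b]) (cases b; cases b'; simp)

lemma resamplings_simps [simp]:
  "resamplings \<phi> [] x = 0"
  "resamplings \<phi> (c # l) x = resamplings \<phi> l x + of_bool (x \<in> clause_vars (\<phi> ! c))"
  "resamplings \<phi> (l @ l') x = resamplings \<phi> l x + resamplings \<phi> l' x"
  by (auto simp: resamplings_def)

lemma clause_vars_iff: "x \<in> clause_vars C \<longleftrightarrow> (\<exists>b. (x, b) \<in> set C)"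
  by (force simp: clause_vars_def)

lemma violated_shift:
  "violated U \<phi> (resamplings \<phi> (l @ [e])) c \<longleftrightarrow>
   violated (\<lambda>x i. U x (i + of_bool (x \<in> clause_vars (\<phi> ! e)))) \<phi> (resamplings \<phi> l) c"
  by (simp add: violated_def)

text \<open>The oldest event sees row 0 of every column; the later events form a valid log for the
  table in which it has consumed one row of each of its variables. Inductions over logs therefore
  run from the old end, with \<open>U\<close> generalised.\<close>

lemma valid_log_shift:
  "valid_log U \<phi> (l @ [e]) \<longleftrightarrow> e < length \<phi> \<and> violated U \<phi> (\<lambda>_. 0) e \<and>
     valid_log (\<lambda>x i. U x (i + of_bool (x \<in> clause_vars (\<phi> ! e)))) \<phi> l"
proof (induction l)
  case Nil
  have "resamplings \<phi> [] = (\<lambda>_. 0)" by (rule ext) simp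
  then show ?case by simp
next
  case (Cons a l)
  show ?case unfolding append_Cons valid_log.simps Cons.IH
    using violated_shift[of U \<phi> l e a] by auto
qed

section \<open>Inserting events into a witness\<close>

lemma finite_insert_event: "finite W \<Longrightarrow> finite (insert_event \<phi> W e)"
  by (simp add: insert_event_def Let_def)

lemma witness_snoc: "witness \<phi> c (l @ [e]) = insert_event \<phi> (witness \<phi> c l) e"
  by (simp add: witness_def)

lemma witness_Nil: "witness \<phi> c [] = {(0, c)}"
  by (simp add: witness_def)

lemma finite_witness: "finite (witness \<phi> c l)"
  by (induction l rule: rev_induct) (auto simp: witness_Nil witness_snoc finite_insert_event)

lemma insert_event_mono: "W \<subseteq> insert_event \<phi> W e"
  by (auto simp: insert_event_def Let_def)

lemma finite_adjacent_depths:
  assumes "finite W" shows "finite {i. \<exists>c. (i, c) \<in> W \<and> adjacent \<phi> e c}"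
proof -
  have "{i. \<exists>c. (i, c) \<in> W \<and> adjacent \<phi> e c} \<subseteq> fst ` W" by force
  then show ?thesis using assms finite_surj by blast
qed

lemma insert_event_adjacent:
  assumes "finite W" "(i, c) \<in> W" "adjacent \<phi> e c"
  obtains D where "i < D" "insert_event \<phi> W e = insert (D, e) W"
proof -
  let ?A = "{i. \<exists>c. (i, c) \<in> W \<and> adjacent \<phi> e c}"
  have "i \<in> ?A" using assms by auto
  then have "i \<le> Max ?A" "?A \<noteq> {}" using finite_adjacent_depths[OF assms(1)] by auto
  then show ?thesis using that[of "Suc (Max ?A)"]
    by (simp only: insert_event_def Let_def if_False le_imp_less_Suc)
qed

lemma insert_event_cases:
  assumes "finite W"
  obtains (skip) "insert_event \<phi> W e = W" "\<forall>(i, c)\<in>W. \<not> adjacent \<phi> e c"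
  | (new) D c where "insert_event \<phi> W e = insert (Suc D, e) W" "(D, c) \<in> W" "adjacent \<phi> e c"
      "\<forall>(i, c)\<in>W. adjacent \<phi> e c \<longrightarrow> i \<le> D"
proof (cases "{i. \<exists>c. (i, c) \<in> W \<and> adjacent \<phi> e c} = {}")
  case True then show ?thesis using skip by (auto simp: insert_event_def Let_def)
next
  case False
  let ?A = "{i. \<exists>c. (i, c) \<in> W \<and> adjacent \<phi> e c}"
  have fin: "finite ?A" by (rule finite_adjacent_depths[OF assms])
  have "Max ?A \<in> ?A" using Max_in[OF fin False] .
  then obtain c where "(Max ?A, c) \<in> W" "adjacent \<phi> e c" by auto
  moreover have "\<forall>(i, c)\<in>W. adjacent \<phi> e c \<longrightarrow> i \<le> Max ?A"
    using Max_ge[OF fin] by auto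
  moreover have "insert_event \<phi> W e = insert (Suc (Max ?A), e) W"
    using False by (simp only: insert_event_def Let_def if_False)
  ultimately show ?thesis using new by blast
qed

text \<open>\<open>deeper\<close> comes from a linear order of the events containing
  \<open>y\<close>, so the topmost of the deeper events has exactly one event less below it. This
  finds the event that is charged for the preceding row.\<close>

lemma shallowest_deeper:
  assumes "finite W" "card (deeper \<phi> W i c y) = Suc r"
  obtains j c' where "(j, c') \<in> deeper \<phi> W i c y" "card (deeper \<phi> W j c' y) = r"
proof -
  let ?X = "deeper \<phi> W i c y"
  have fin: "finite ?X" using assms(1) by (rule finite_subset[rotated]) (auto simp: deeper_def)
  have ne: "?X \<noteq> {}" using assms(2) by auto
  define j where "j = Min (fst ` ?X)"
  have finj: "finite {c'. (j, c') \<in> ?X}"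
    by (rule finite_subset[of _ "snd ` ?X"]) (use fin in force)+
  have "j \<in> fst ` ?X" unfolding j_def using fin ne by (intro Min_in) auto
  then have nej: "{c'. (j, c') \<in> ?X} \<noteq> {}" by force
  define c' where "c' = Max {c'. (j, c') \<in> ?X}"
  have in_X: "(j, c') \<in> ?X" using Max_in[OF finj nej] by (simp add: c'_def)
  have "deeper \<phi> W j c' y = ?X - {(j, c')}"
  proof (rule set_eqI, clarify)
    fix a b
    have "j \<le> a" if "(a, b) \<in> ?X" unfolding j_def using that fin by (force intro: Min_le)
    moreover have "b \<le> c'" if "(j, b) \<in> ?X" unfolding c'_def using that finj by (intro Max_ge) auto
    ultimately show "((a, b) \<in> deeper \<phi> W j c' y) = ((a, b) \<in> ?X - {(j, c')})"
      using in_X by (force simp: deeper_def)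
  qed
  then have "card (deeper \<phi> W j c' y) = r" using in_X fin assms(2) by simp
  with in_X show ?thesis using that by blast
qed

text \<open>Removing the oldest event \<open>e\<close> of a log shifts the table columns of its variables by one. An
  event sharing a variable \<open>y\<close> with \<open>e\<close> that is not deeper than it asks for the same value of \<open>y\<close>
  as \<open>e\<close>, so that being shifted or not makes no difference to it.\<close>

lemma consistent_insert_event:
  assumes fin: "finite W"
    and dist: "\<And>c. (\<exists>i. (i, c) \<in> W) \<or> c = e \<Longrightarrow> distinct (map fst (\<phi> ! c))"
    and e: "violated U \<phi> (\<lambda>_. 0) e"
    and IH: "consistent (\<lambda>x i. U x (i + of_bool (x \<in> clause_vars (\<phi> ! e)))) \<phi> W"
  shows "consistent U \<phi> (insert_event \<phi> W e)"
proof -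
  let ?W = "insert_event \<phi> W e"
  have sign: "b = b'" if "(y, b) \<in> set (\<phi> ! c)" "(y, b') \<in> set (\<phi> ! c)" "(\<exists>i. (i, c) \<in> W) \<or> c = e"
    for y b b' c
    using eq_key_imp_eq_value[OF dist[OF that(3)] that(1,2)] .
  \<comment> \<open>Row 0 has the required value because \<open>e\<close> itself was violated. For
    row \<open>Suc r\<close>, the topmost deeper event reads row \<open>r\<close> of the shifted
    table, which is row \<open>Suc r\<close> of \<open>U\<close>; not being adjacent to
    \<open>e\<close>, it carries the same literal on \<open>y\<close>.\<close>
  have same: "U y (card (deeper \<phi> W i c y)) \<noteq> b"
    if ye: "(y, b) \<in> set (\<phi> ! e)" and na: "\<forall>(j, c')\<in>deeper \<phi> W i c y. \<not> adjacent \<phi> e c'"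
    for y b i c
  proof (cases "card (deeper \<phi> W i c y)")
    case 0 then show ?thesis using e ye by (auto simp: violated_def)
  next
    case (Suc r)
    obtain j c' where jc: "(j, c') \<in> deeper \<phi> W i c y" "card (deeper \<phi> W j c' y) = r"
      by (rule shallowest_deeper[OF fin Suc])
    have inW: "(j, c') \<in> W" and yv: "y \<in> clause_vars (\<phi> ! c')" using jc(1) by (auto simp: deeper_def)
    obtain b' where b': "(y, b') \<in> set (\<phi> ! c')" using yv by (auto simp: clause_vars_iff)
    have "\<not> conflict \<phi> e c'" using na jc(1) by (auto simp: adjacent_def)
    then have "b' = b" using b' ye by (metis conflictI)
    moreover have "y \<in> clause_vars (\<phi> ! e)" using ye by (auto simp: clause_vars_iff)
    ultimately show ?thesis using IH inW b' jc(2) Suc by (fastforce simp: consistent_def)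
  qed
  have "U y (card (deeper \<phi> ?W i c y)) \<noteq> b" if ic: "(i, c) \<in> ?W" and yb: "(y, b) \<in> set (\<phi> ! c)"
    for i c y b
  proof (cases "insert_event \<phi> W e = W \<and> (\<forall>(i, c)\<in>W. \<not> adjacent \<phi> e c)")
    case True
    then have W: "?W = W" and na: "\<forall>(i, c)\<in>W. \<not> adjacent \<phi> e c" by auto
    have inW: "(i, c) \<in> W" using ic W by simp
    show ?thesis
    proof (cases "y \<in> clause_vars (\<phi> ! e)")
      case False then show ?thesis using IH inW yb W by (fastforce simp: consistent_def)
    next
      case True
      then obtain be where be: "(y, be) \<in> set (\<phi> ! e)" by (auto simp: clause_vars_iff)
      have "\<not> conflict \<phi> e c" using na inW by (auto simp: adjacent_def)
      then have "be = b" using be yb by (metis conflictI)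
      moreover have "\<forall>(j, c')\<in>deeper \<phi> W i c y. \<not> adjacent \<phi> e c'"
        using na by (auto simp: deeper_def)
      ultimately show ?thesis using same be W by simp
    qed
  next
    case False
    then obtain D where D: "?W = insert (D, e) W" "\<forall>(i, c)\<in>W. adjacent \<phi> e c \<longrightarrow> i < D"
      using insert_event_cases[OF fin, of \<phi> e thesis] by (metis (no_types, lifting) case_prodD case_prodI2 le_imp_less_Suc)
    have new: "(D, e) \<notin> W" using D(2) by (auto simp: adjacent_def)
    show ?thesis
    proof (cases "(i, c) = (D, e)")
      case True
      then have "deeper \<phi> ?W i c y = deeper \<phi> W i c y" using D by (auto simp: deeper_def)
      moreover have "\<forall>(j, c')\<in>deeper \<phi> W i c y. \<not> adjacent \<phi> e c'"
        using D(2) True by (fastforce simp: deeper_def)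
      ultimately show ?thesis using same yb True by simp
    next
      case False
      then have inW: "(i, c) \<in> W" using ic D by auto
      have old: "U y (card (deeper \<phi> W i c y) + of_bool (y \<in> clause_vars (\<phi> ! e))) \<noteq> b"
        using IH inW yb by (fastforce simp: consistent_def)
      show ?thesis
      proof (cases "y \<in> clause_vars (\<phi> ! e) \<and> (i < D \<or> i = D \<and> e < c)")
        case True
        \<comment> \<open>The new event below \<open>(i, c)\<close> raises its row by one, which is
          exactly the shift of the table.\<close>
        then have "deeper \<phi> ?W i c y = insert (D, e) (deeper \<phi> W i c y)"
          using D by (auto simp: deeper_def)
        moreover have "finite (deeper \<phi> W i c y)"
          using fin by (rule finite_subset[rotated]) (auto simp: deeper_def)
        ultimately have "card (deeper \<phi> ?W i c y) = Suc (card (deeper \<phi> W i c y))"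
          using new by (simp add: deeper_def)
        then show ?thesis using old True by simp
      next
        case nd: False
        then have eq: "deeper \<phi> ?W i c y = deeper \<phi> W i c y" using D by (auto simp: deeper_def)
        show ?thesis
        proof (cases "y \<in> clause_vars (\<phi> ! e)")
          case False then show ?thesis using old eq by simp
        next
          case True
          then obtain be where be: "(y, be) \<in> set (\<phi> ! e)" by (auto simp: clause_vars_iff)
          have "D \<le> i" using nd True by auto
          then have "\<forall>(j, c')\<in>deeper \<phi> W i c y. \<not> adjacent \<phi> e c'" "\<not> adjacent \<phi> e c"
            using D(2) inW by (fastforce simp: deeper_def)+
          moreover from this(2) have "be = b" using be yb
            unfolding adjacent_def by (metis conflictI)
          ultimately show ?thesis using same be eq by simp
        qed
      qed
    qed
  qed
  then show ?thesis by (auto simp: consistent_def)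
qed

lemma snd_witness: "(i, e) \<in> witness \<phi> c l \<Longrightarrow> e \<in> insert c (set l)"
proof (induction l arbitrary: i e rule: rev_induct)
  case Nil then show ?case by (simp add: witness_Nil)
next
  case (snoc a l)
  from snoc.prems have "(i, e) \<in> insert_event \<phi> (witness \<phi> c l) a" by (simp add: witness_snoc)
  then show ?case using snoc.IH by (auto simp: insert_event_def Let_def split: if_splits)
qed

lemma valid_log_less: "valid_log U \<phi> l \<Longrightarrow> c \<in> set l \<Longrightarrow> c < length \<phi>"
  by (induction l) auto

text \<open>The witness grows from new to old, so its last insertion is the oldest event, the very
  one that \<open>valid_log_shift\<close> peels off. Afterwards the strategy that produced the log
  no longer matters: only the witness and the table occur.\<close>

lemma consistent_witness:
  assumes dist: "\<And>c. c < length \<phi> \<Longrightarrow> distinct (map fst (\<phi> ! c))"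
  shows "valid_log U \<phi> (c # l) \<Longrightarrow> consistent U \<phi> (witness \<phi> c l)"
proof (induction l arbitrary: U rule: rev_induct)
  case Nil
  have "resamplings \<phi> [] = (\<lambda>_. 0)" by (rule ext) simp
  moreover have "deeper \<phi> {(0, c)} 0 c y = {}" for y by (auto simp: deeper_def)
  ultimately show ?case using Nil by (auto simp: consistent_def witness_Nil violated_def)
next
  case (snoc e l)
  let ?U = "\<lambda>x i. U x (i + of_bool (x \<in> clause_vars (\<phi> ! e)))"
  from snoc.prems have *: "e < length \<phi>" "violated U \<phi> (\<lambda>_. 0) e" "valid_log ?U \<phi> (c # l)"
    using valid_log_shift[of U \<phi> "c # l" e] by auto
  show ?case unfolding witness_snoc
  proof (rule consistent_insert_event[OF finite_witness _ *(2) snoc.IH[OF *(3)]])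
    fix a assume "(\<exists>i. (i, a) \<in> witness \<phi> c l) \<or> a = e"
    then have "a < length \<phi>" using snd_witness valid_log_less[OF *(3)] *(1) by fastforce
    then show "distinct (map fst (\<phi> ! a))" by (rule dist)
  qed
qed

section \<open>Depth and layers of a witness\<close>

lemma witness_mono: "witness \<phi> c l \<subseteq> witness \<phi> c (l @ l')"
proof (induction l' rule: rev_induct)
  case (snoc x xs)
  then show ?case unfolding append_assoc[symmetric] witness_snoc using insert_event_mono by blast
qed simp

text \<open>An event lands strictly below everything adjacent to it, so each link of a chain goes at
  least one layer down and no member of the chain is dropped. Here \<open>l\<close> is the part of
  the log that has already been inserted.\<close>

lemma deep_witness_aux:
  "(i, c) \<in> witness \<phi> c0 l \<Longrightarrow> deep \<phi> h (c # l') \<Longrightarrow> \<exists>j\<ge>i + h. \<exists>e. (j, e) \<in> witness \<phi> c0 (l @ l')"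
proof (induction h arbitrary: i c l l')
  case 0 then show ?case using witness_mono[of \<phi> c0 l l'] by auto
next
  case (Suc h)
  from Suc.prems(2) obtain l1 c' l2 where l': "l' = l1 @ c' # l2" and ad: "adjacent \<phi> c' c"
    and dp: "deep \<phi> h (c' # l2)" by auto
  have "(i, c) \<in> witness \<phi> c0 (l @ l1)" using Suc.prems(1) witness_mono by blast
  then obtain D where "i < D" "insert_event \<phi> (witness \<phi> c0 (l @ l1)) c' = insert (D, c') (witness \<phi> c0 (l @ l1))"
    using insert_event_adjacent[OF finite_witness] ad by metis
  then have D: "i < D" "(D, c') \<in> witness \<phi> c0 ((l @ l1) @ [c'])" by (auto simp only: witness_snoc)
  from Suc.IH[OF D(2) dp] obtain j e where "j \<ge> D + h" "(j, e) \<in> witness \<phi> c0 (((l @ l1) @ [c']) @ l2)"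
    by auto
  then show ?case using D(1) l' by (intro exI[of _ j]) auto
qed

lemma deep_witness:
  assumes "deep \<phi> h (c # l)" shows "\<exists>j\<ge>h. \<exists>e. (j, e) \<in> witness \<phi> c l"
  using deep_witness_aux[of 0 c \<phi> c "[]" h l] assms by (simp add: witness_Nil)

text \<open>An event is placed directly under the deepest adjacent one, so there are no gaps. This
  makes every layer a set of neighbours of the one above, and it turns depth into a lower bound for
  the number of events.\<close>

lemma witness_layers:
  assumes "(i, e) \<in> witness \<phi> c l"
  shows "(i = 0 \<longrightarrow> e = c) \<and> (\<forall>j. i = Suc j \<longrightarrow> (\<exists>e'. (j, e') \<in> witness \<phi> c l \<and> adjacent \<phi> e e'))"
  using assms
proof (induction l arbitrary: i e rule: rev_induct)
  case Nil then show ?case by (simp add: witness_Nil)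
next
  case (snoc a l)
  show ?case
  proof (cases "(i, e) \<in> witness \<phi> c l")
    case True
    then show ?thesis using snoc.IH[OF True] witness_mono[of \<phi> c l "[a]"] by blast
  next
    case False
    with snoc.prems have "(i, e) \<in> insert_event \<phi> (witness \<phi> c l) a" by (simp add: witness_snoc)
    with False obtain D c' where "i = Suc D" "e = a" "(D, c') \<in> witness \<phi> c l" "adjacent \<phi> a c'"
      using insert_event_cases[OF finite_witness[of \<phi> c l], where \<phi> = \<phi> and e = a and thesis = thesis] by fastforce
    then show ?thesis using witness_mono[of \<phi> c l "[a]"] by blast
  qed
qed

lemma witness_root: "(0, e) \<in> witness \<phi> c l \<longleftrightarrow> e = c"
  using witness_layers[of 0 e \<phi> c l] witness_mono[of \<phi> c "[]" l] by (auto simp: witness_Nil)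

lemma witness_depths: "(i, e) \<in> witness \<phi> c l \<Longrightarrow> j \<le> i \<Longrightarrow> \<exists>e'. (j, e') \<in> witness \<phi> c l"
proof (induction i arbitrary: e)
  case (Suc i)
  then show ?case using witness_layers[OF Suc.prems(1)] by (cases "j = Suc i") auto
qed auto

lemma card_witness:
  assumes "deep \<phi> h (c # l)" shows "Suc h \<le> card (witness \<phi> c l)"
proof -
  obtain i e where ie: "i \<ge> h" "(i, e) \<in> witness \<phi> c l" using deep_witness[OF assms] by blast
  have "{..h} \<subseteq> fst ` witness \<phi> c l"
  proof
    fix j assume "j \<in> {..h}"
    with ie obtain e' where "(j, e') \<in> witness \<phi> c l" using witness_depths[of i e \<phi> c l j] by auto
    then show "j \<in> fst ` witness \<phi> c l" by (rule rev_image_eqI) simp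
  qed
  then have "card {..h} \<le> card (fst ` witness \<phi> c l)" by (intro card_mono) (simp_all add: finite_witness)
  also have "\<dots> \<le> card (witness \<phi> c l)" by (rule card_image_le[OF finite_witness])
  finally show ?thesis by simp
qed

lemma witness_depth_le: "(i, e) \<in> witness \<phi> c l \<Longrightarrow> i \<le> length l"
proof (induction l arbitrary: i e rule: rev_induct)
  case Nil then show ?case by (simp add: witness_Nil)
next
  case (snoc a l)
  then have "(i, e) \<in> insert_event \<phi> (witness \<phi> c l) a" by (simp add: witness_snoc)
  then show ?case using snoc.IH
    by (cases rule: insert_event_cases[OF finite_witness[of \<phi> c l], where \<phi> = \<phi> and e = a]) fastforce+
qed

section \<open>Weights of layerings and events on the tape\<close>

definition neighbours :: "cnf \<Rightarrow> nat set \<Rightarrow> nat set" where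
  "neighbours \<phi> S = {c. c < length \<phi> \<and> (\<exists>c'\<in>S. adjacent \<phi> c c')}"

text \<open>A superset of the witnesses: adjacent clauses within one layer and empty layers are
  allowed. That freedom lets the sum over the next layer run over a full power set and hence
  factorise.\<close>

fun layerings :: "cnf \<Rightarrow> nat \<Rightarrow> nat set \<Rightarrow> nat set list set" where
  "layerings \<phi> 0 S = {[S]}"
| "layerings \<phi> (Suc r) S = (\<Union>S'\<in>Pow (neighbours \<phi> S). (#) S ` layerings \<phi> r S')"

definition layer_set :: "nat set list \<Rightarrow> (nat \<times> nat) set" where
  "layer_set Ls = {(i, c). i < length Ls \<and> c \<in> Ls ! i}"

definition layer_weight :: "(nat \<Rightarrow> real) \<Rightarrow> nat set list \<Rightarrow> real" where
  "layer_weight p Ls = (\<Prod>S\<leftarrow>Ls. prod p S)"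

section \<open>Summing the weights of all layerings\<close>

lemma finite_neighbours [simp]: "finite (neighbours \<phi> S)"
  by (simp add: neighbours_def)

lemma finite_layerings [simp]: "finite (layerings \<phi> r S)"
  by (induction r arbitrary: S) auto

lemma layerings_Cons: "Ls \<in> layerings \<phi> r S \<Longrightarrow> \<exists>Ls'. Ls = S # Ls'"
  by (cases r) auto

lemma layerings_less:
  "Ls \<in> layerings \<phi> r S \<Longrightarrow> S \<subseteq> {..<length \<phi>} \<Longrightarrow> T \<in> set Ls \<Longrightarrow> T \<subseteq> {..<length \<phi>}"
proof (induction r arbitrary: S Ls)
  case (Suc r)
  then obtain S' Ls' where *: "S' \<subseteq> neighbours \<phi> S" "Ls = S # Ls'" "Ls' \<in> layerings \<phi> r S'" by auto
  then have "S' \<subseteq> {..<length \<phi>}" by (auto simp: neighbours_def)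
  with Suc.IH[OF *(3)] Suc.prems * show ?case by auto
qed auto

lemma layerings_snoc_empty: "Ls \<in> layerings \<phi> r S \<Longrightarrow> Ls @ [{}] \<in> layerings \<phi> (Suc r) S"
proof (induction r arbitrary: S Ls)
  case (Suc r)
  then obtain S' Ls' where *: "S' \<subseteq> neighbours \<phi> S" "Ls = S # Ls'" "Ls' \<in> layerings \<phi> r S'" by auto
  from Suc.IH[OF *(3)] * show ?case by (subst layerings.simps) auto
qed auto

lemma layer_set_snoc_empty: "layer_set (Ls @ [{}]) = layer_set Ls"
  by (auto simp: layer_set_def nth_append less_Suc_eq split: if_splits)

lemma layer_set_Cons: "layer_set (S # Ls) = {0} \<times> S \<union> map_prod Suc id ` layer_set Ls"
proof -
  have "(i, c) \<in> layer_set (S # Ls) \<longleftrightarrow> (i, c) \<in> {0} \<times> S \<union> map_prod Suc id ` layer_set Ls" for i c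
    by (cases i) (auto simp: layer_set_def image_iff split_paired_Ex split: prod.splits)
  then show ?thesis by auto
qed

lemma finite_layer_set:
  assumes "\<And>S. S \<in> set Ls \<Longrightarrow> finite S" shows "finite (layer_set Ls)"
  using assms
  by (induction Ls) (simp_all add: layer_set_Cons, simp add: layer_set_def)

lemma layer_weight_eq:
  assumes "\<And>S. S \<in> set Ls \<Longrightarrow> finite S"
  shows "layer_weight p Ls = (\<Prod>(i, c)\<in>layer_set Ls. p c)"
  using assms
proof (induction Ls)
  case Nil then show ?case by (simp add: layer_weight_def layer_set_def)
next
  case (Cons S Ls)
  then have fin: "finite S" "finite (layer_set Ls)" by (auto intro: finite_layer_set)
  have inj: "inj_on (map_prod Suc id) (layer_set Ls)" by (rule inj_onI) (auto simp: map_prod_def split: prod.splits)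
  have "(\<Prod>(i, c)\<in>layer_set (S # Ls). p c) =
      (\<Prod>(i, c)\<in>{0::nat} \<times> S. p c) * (\<Prod>(i, c)\<in>map_prod Suc id ` layer_set Ls. p c)"
    unfolding layer_set_Cons by (rule prod.union_disjoint) (use fin in auto)
  also have "(\<Prod>(i, c)\<in>{0::nat} \<times> S. p c) = prod p S"
    by (simp add: prod.cartesian_product[symmetric])
  also have "(\<Prod>(i, c)\<in>map_prod Suc id ` layer_set Ls. p c) = (\<Prod>(i, c)\<in>layer_set Ls. p c)"
    by (simp add: prod.reindex[OF inj] case_prod_unfold)
  finally show ?case using Cons by (simp add: layer_weight_def)
qed

lemma sum_Pow_power:
  fixes \<mu> :: real
  assumes "finite A" shows "(\<Sum>S\<in>Pow A. \<mu> ^ card S) = (1 + \<mu>) ^ card A"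
  using prod_add[OF assms, of "\<lambda>_. \<mu>" "\<lambda>_. 1"] by (simp add: add.commute)

lemma card_neighbours_le:
  assumes "finite S" shows "card (neighbours \<phi> S) \<le> (\<Sum>c\<in>S. card (neighbours \<phi> {c}))"
proof -
  have "neighbours \<phi> S = (\<Union>c\<in>S. neighbours \<phi> {c})" by (auto simp: neighbours_def)
  then show ?thesis using card_UN_le[OF assms] by metis
qed

text \<open>Peeling off the first layer: the weights of the possible second layers \<open>S'\<close> add up to
  \<open>(1 + \<mu>) ^ card (neighbours \<phi> S)\<close>, which the hypothesis distributes over the clauses of \<open>S\<close>.\<close>

lemma layer_weight_sum_le:
  fixes \<mu> :: real
  assumes \<mu>: "0 \<le> \<mu>" and p: "\<And>c. 0 \<le> p c"
    and lll: "\<And>c. c < length \<phi> \<Longrightarrow> p c * (1 + \<mu>) ^ card (neighbours \<phi> {c}) \<le> \<mu>"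
  shows "S \<subseteq> {..<length \<phi>} \<Longrightarrow> (\<Sum>Ls\<in>layerings \<phi> r S. layer_weight p Ls) \<le> \<mu> ^ card S"
proof (induction r arbitrary: S)
  case 0
  have "p c \<le> \<mu>" if "c \<in> S" for c
  proof -
    have "p c * 1 \<le> p c * (1 + \<mu>) ^ card (neighbours \<phi> {c})"
      using \<mu> p by (intro mult_left_mono one_le_power) auto
    then show ?thesis using lll[of c] that 0 by fastforce
  qed
  then have "prod p S \<le> (\<Prod>c\<in>S. \<mu>)" using p by (intro prod_mono) auto
  then show ?case by (simp add: layer_weight_def)
next
  case (Suc r)
  have fin: "finite S" using Suc.prems finite_subset by blast
  have nb: "S' \<subseteq> {..<length \<phi>}" if "S' \<subseteq> neighbours \<phi> S" for S'
    using that by (auto simp: neighbours_def)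
  have "(\<Sum>Ls\<in>layerings \<phi> (Suc r) S. layer_weight p Ls) =
      (\<Sum>S'\<in>Pow (neighbours \<phi> S). \<Sum>Ls\<in>(#) S ` layerings \<phi> r S'. layer_weight p Ls)"
    unfolding layerings.simps
    by (rule sum.UNION_disjoint) (auto dest!: layerings_Cons)
  also have "\<dots> = (\<Sum>S'\<in>Pow (neighbours \<phi> S). \<Sum>Ls\<in>layerings \<phi> r S'. layer_weight p (S # Ls))"
    by (subst sum.reindex) (auto simp: o_def)
  also have "\<dots> = (\<Sum>S'\<in>Pow (neighbours \<phi> S). prod p S * (\<Sum>Ls\<in>layerings \<phi> r S'. layer_weight p Ls))"
    by (simp add: layer_weight_def sum_distrib_left)
  also have "\<dots> \<le> (\<Sum>S'\<in>Pow (neighbours \<phi> S). prod p S * \<mu> ^ card S')"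
    using Suc.IH nb p by (intro sum_mono mult_left_mono prod_nonneg) auto
  also have "\<dots> = prod p S * (1 + \<mu>) ^ card (neighbours \<phi> S)"
    by (simp add: sum_distrib_left[symmetric] sum_Pow_power)
  also have "\<dots> \<le> prod p S * (1 + \<mu>) ^ (\<Sum>c\<in>S. card (neighbours \<phi> {c}))"
    using \<mu> p card_neighbours_le[OF fin, of \<phi>]
    by (intro mult_left_mono power_increasing prod_nonneg) auto
  also have "\<dots> = (\<Prod>c\<in>S. p c * (1 + \<mu>) ^ card (neighbours \<phi> {c}))"
    by (simp add: power_sum prod.distrib)
  also have "\<dots> \<le> (\<Prod>c\<in>S. \<mu>)"
    using lll p \<mu> Suc.prems by (intro prod_mono conjI mult_nonneg_nonneg) auto
  finally show ?case by simp
qed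

lemma layers_in_layerings:
  assumes "\<And>j. L (Suc j) \<subseteq> neighbours \<phi> (L j)"
  shows "map L [i..<Suc (i + r)] \<in> layerings \<phi> r (L i)"
proof (induction r arbitrary: i)
  case (Suc r)
  have "map L [Suc i..<Suc (Suc i + r)] \<in> layerings \<phi> r (L (Suc i))" by (rule Suc.IH)
  moreover have "map L [i..<Suc (i + Suc r)] = L i # map L [Suc i..<Suc (Suc i + r)]"
    using upt_conv_Cons[of i "Suc (i + Suc r)"] by (simp del: upt_Suc)
  moreover have "L (Suc i) \<in> Pow (neighbours \<phi> (L i))" using assms by simp
  ultimately show ?case unfolding layerings.simps by (metis UN_I imageI)
qed simp

lemma witness_layering:
  assumes "valid_log U \<phi> (c # l)"
  obtains Ls where "Ls \<in> layerings \<phi> (length l) {c}" "layer_set Ls = witness \<phi> c l"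
proof -
  define L where "L = (\<lambda>i. {e. (i, e) \<in> witness \<phi> c l})"
  have "L (Suc j) \<subseteq> neighbours \<phi> (L j)" for j
  proof
    fix e assume "e \<in> L (Suc j)"
    then have "(Suc j, e) \<in> witness \<phi> c l" by (simp add: L_def)
    moreover from snd_witness[OF this] have "e < length \<phi>" using valid_log_less[OF assms, of e] by simp
    ultimately show "e \<in> neighbours \<phi> (L j)"
      using witness_layers[of "Suc j" e \<phi> c l] by (auto simp: neighbours_def L_def)
  qed
  then have "map L [0..<Suc (0 + length l)] \<in> layerings \<phi> (length l) (L 0)" by (rule layers_in_layerings)
  moreover have "L 0 = {c}" by (auto simp: L_def witness_root)
  moreover have "layer_set (map L [0..<Suc (0 + length l)]) = witness \<phi> c l"
    using witness_depth_le[of _ _ \<phi> c l]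
    by (auto simp: layer_set_def L_def less_Suc_eq_le simp del: upt_Suc)
  ultimately show ?thesis using that by metis
qed

section \<open>Events decided by finitely many bits of the tape\<close>

definition determined :: "nat set \<Rightarrow> random_tape set \<Rightarrow> bool" where
  "determined I A \<longleftrightarrow> (\<forall>\<omega> \<omega>'. (\<forall>i\<in>I. \<omega> i = \<omega>' i) \<longrightarrow> (\<omega> \<in> A \<longleftrightarrow> \<omega>' \<in> A))"

lemma space_tape [simp]: "space tape_measure = UNIV"
  by (simp add: tape_measure_def space_PiM PiE_UNIV_domain)

interpretation tape: prob_space tape_measure
  unfolding tape_measure_def by (intro prob_space_PiM measure_pmf.prob_space_axioms)

abbreviation coin :: "nat \<Rightarrow> bool measure" where
  "coin \<equiv> \<lambda>_. measure_pmf (bernoulli_pmf (1 / 2))"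

lemma indep_coordinates: "tape.indep_vars coin (\<lambda>i \<omega>. \<omega> i) UNIV"
proof -
  have distr: "distr tape_measure (coin i) (\<lambda>\<omega>. \<omega> i) = coin i" for i
    unfolding tape_measure_def
    by (rule distr_PiM_component) (auto intro: measure_pmf.prob_space_axioms)
  have "distr tape_measure (\<Pi>\<^sub>M i\<in>UNIV. coin i) (\<lambda>\<omega>. \<lambda>i\<in>UNIV. \<omega> i) = (\<Pi>\<^sub>M i\<in>UNIV. distr tape_measure (coin i) (\<lambda>\<omega>. \<omega> i))"
    by (simp only: distr restrict_UNIV) (simp add: tape_measure_def distr_id2)
  then show ?thesis
    by (subst tape.indep_vars_iff_distr_eq_PiM) (auto simp: tape_measure_def)
qed

lemma sets_PiM_coin:
  assumes "finite I" "S \<subseteq> (\<Pi>\<^sub>E i\<in>I. UNIV)" shows "S \<in> sets (PiM I coin)"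
proof -
  have "finite (\<Pi>\<^sub>E i\<in>I. (UNIV :: bool set))" using assms(1) by (intro finite_PiE) auto
  then have "finite S" using assms(2) finite_subset by blast
  moreover have "{f} \<in> sets (PiM I coin)" if "f \<in> S" for f
  proof -
    have "(\<Pi>\<^sub>E i\<in>I. {f i}) \<in> sets (PiM I coin)" using assms(1) by (intro sets_PiM_I_finite) auto
    moreover have "(\<Pi>\<^sub>E i\<in>I. {f i}) = {f}" using that assms(2) by (intro PiE_singleton) (auto simp: PiE_def)
    ultimately show ?thesis by simp
  qed
  ultimately show ?thesis using sets.finite_UN[of S "\<lambda>f. {f}" "PiM I coin"] by simp
qed

lemma determined_vimage:
  assumes "determined I A"
  shows "A = (\<lambda>\<omega>. restrict \<omega> I) -` ((\<lambda>\<omega>. restrict \<omega> I) ` A)"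
proof -
  have "\<omega> \<in> A" if "restrict \<omega> I = restrict \<omega>' I" "\<omega>' \<in> A" for \<omega> \<omega>'
    using assms that unfolding determined_def by (metis restrict_apply')
  then show ?thesis by auto
qed

lemma sets_determined:
  assumes "finite I" "determined I A" shows "A \<in> sets tape_measure"
proof -
  have "(\<lambda>\<omega>. restrict \<omega> I) ` A \<in> sets (PiM I coin)" by (rule sets_PiM_coin) (auto simp: assms)
  moreover have "(\<lambda>\<omega>. restrict \<omega> I) \<in> measurable tape_measure (PiM I coin)"
    unfolding tape_measure_def by (rule measurable_restrict_subset) simp
  ultimately have "(\<lambda>\<omega>. restrict \<omega> I) -` ((\<lambda>\<omega>. restrict \<omega> I) ` A) \<inter> space tape_measure \<in> sets tape_measure"
    by (rule measurable_sets[rotated])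
  then show ?thesis using determined_vimage[OF assms(2)] by simp
qed

text \<open>Over finitely many bits every set is measurable, so disjoint sets of bits suffice for
  independence and no measurability has to be checked for the individual events.\<close>

lemma determined_indep:
  assumes "finite I" "finite J" "I \<inter> J = {}" "determined I A" "determined J C"
  shows "tape.prob (A \<inter> C) = tape.prob A * tape.prob C"
proof -
  have "tape.indep_var (PiM I coin) (\<lambda>\<omega>. restrict (\<lambda>i. \<omega> i) I) (PiM J coin) (\<lambda>\<omega>. restrict (\<lambda>i. \<omega> i) J)"
    by (rule tape.indep_var_restrict[OF indep_coordinates]) (use assms in auto)
  from tape.indep_varD[OF this, of "(\<lambda>\<omega>. restrict \<omega> I) ` A" "(\<lambda>\<omega>. restrict \<omega> J) ` C"]
  have "tape.prob ((\<lambda>x. (restrict x I, restrict x J)) -` (((\<lambda>\<omega>. restrict \<omega> I) ` A) \<times> ((\<lambda>\<omega>. restrict \<omega> J) ` C))) =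
     tape.prob ((\<lambda>\<omega>. restrict \<omega> I) -` ((\<lambda>\<omega>. restrict \<omega> I) ` A)) * tape.prob ((\<lambda>\<omega>. restrict \<omega> J) -` ((\<lambda>\<omega>. restrict \<omega> J) ` C))"
    using sets_PiM_coin[OF assms(1)] sets_PiM_coin[OF assms(2)] by (auto simp: image_subset_iff)
  moreover have "(\<lambda>x. (restrict x I, restrict x J)) -` (((\<lambda>\<omega>. restrict \<omega> I) ` A) \<times> ((\<lambda>\<omega>. restrict \<omega> J) ` C))
      = ((\<lambda>\<omega>. restrict \<omega> I) -` ((\<lambda>\<omega>. restrict \<omega> I) ` A)) \<inter> ((\<lambda>\<omega>. restrict \<omega> J) -` ((\<lambda>\<omega>. restrict \<omega> J) ` C))"
    by auto
  ultimately show ?thesis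
    using determined_vimage[OF assms(4)] determined_vimage[OF assms(5)] by metis
qed

lemma determined_Int: "determined I A \<Longrightarrow> determined J C \<Longrightarrow> determined (I \<union> J) (A \<inter> C)"
  unfolding determined_def by blast

lemma determined_Collect_bit: "i \<in> I \<Longrightarrow> determined I {\<omega>. \<omega> i = b}"
  by (auto simp: determined_def)

text \<open>Determinedness is carried along because each new factor is split off against the whole
  intersection of the others.\<close>

lemma prob_INT_determined:
  assumes "finite E" "\<And>e. e \<in> E \<Longrightarrow> finite (J e)" "disjoint_family_on J E"
    "\<And>e. e \<in> E \<Longrightarrow> determined (J e) (A e)"
  shows "tape.prob (\<Inter>e\<in>E. A e) = (\<Prod>e\<in>E. tape.prob (A e)) \<and> determined (\<Union>e\<in>E. J e) (\<Inter>e\<in>E. A e)"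
  using assms
proof (induction E)
  case empty then show ?case using tape.prob_space by (simp add: determined_def)
next
  case (insert e E)
  then have IH: "tape.prob (\<Inter>e\<in>E. A e) = (\<Prod>e\<in>E. tape.prob (A e))"
    "determined (\<Union>e\<in>E. J e) (\<Inter>e\<in>E. A e)" by (auto simp: disjoint_family_on_def)
  have "J e \<inter> (\<Union>e\<in>E. J e) = {}" using insert.hyps insert.prems by (auto simp: disjoint_family_on_def)
  then have "tape.prob (A e \<inter> (\<Inter>e\<in>E. A e)) = tape.prob (A e) * tape.prob (\<Inter>e\<in>E. A e)"
    using insert IH(2) by (intro determined_indep[where I = "J e" and J = "\<Union>e\<in>E. J e"]) auto
  then show ?case using insert IH determined_Int[of "J e" "A e"] by simp
qed

lemma prob_bit: "tape.prob {\<omega>. \<omega> i = b} = 1 / 2"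
proof -
  have "tape.prob {\<omega>. \<omega> i = b} = measure (distr tape_measure (coin i) (\<lambda>\<omega>. \<omega> i)) {b}"
    by (subst measure_distr) (auto simp: tape_measure_def vimage_def space_PiM PiE_UNIV_domain)
  also have "distr tape_measure (coin i) (\<lambda>\<omega>. \<omega> i) = coin i"
    unfolding tape_measure_def
    by (rule distr_PiM_component) (auto intro: measure_pmf.prob_space_axioms)
  also have "measure (coin i) {b} = 1 / 2" by (cases b) (simp_all add: measure_pmf_single)
  finally show ?thesis .
qed

section \<open>Blocks of bits as uniform numbers\<close>

definition block_value :: "nat \<Rightarrow> nat \<Rightarrow> random_tape \<Rightarrow> nat" where
  "block_value B a \<omega> = (\<Sum>b<B. 2 ^ b * of_bool (\<omega> (a + b)))"

lemma block_value_Suc: "block_value (Suc B) a \<omega> = block_value B a \<omega> + 2 ^ B * of_bool (\<omega> (a + B))"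
  by (simp add: block_value_def)

lemma block_value_less: "block_value B a \<omega> < 2 ^ B"
proof (induction B)
  case (Suc B) then show ?case by (cases "\<omega> (a + B)") (simp_all add: block_value_Suc)
qed (simp add: block_value_def)

lemma determined_block_value: "determined {a..<a + B} {\<omega>. P (block_value B a \<omega>)}"
proof -
  have "block_value B a \<omega> = block_value B a \<omega>'" if "\<forall>i\<in>{a..<a + B}. \<omega> i = \<omega>' i" for \<omega> \<omega>'
    unfolding block_value_def using that by (intro sum.cong) auto
  then show ?thesis unfolding determined_def by (metis (no_types, lifting) mem_Collect_eq)
qed

text \<open>The top bit splits the range into two halves; at least one of them lies entirely inside
  or outside of the event, and the lower bits decide the other.\<close>

lemma prob_block_value: "t \<le> 2 ^ B \<Longrightarrow> tape.prob {\<omega>. block_value B a \<omega> < t} = t / 2 ^ B"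
proof (induction B arbitrary: t)
  case 0
  then have "t = 0 \<or> t = 1" by auto
  then show ?case using tape.prob_space by (auto simp: block_value_def)
next
  case (Suc B)
  have ind: "tape.prob ({\<omega>. block_value B a \<omega> < s} \<inter> {\<omega>. \<omega> (a + B) = v}) = s / 2 ^ B * (1 / 2)"
    if "s \<le> 2 ^ B" for s v
    using determined_indep[OF _ _ _ determined_block_value[of a B "\<lambda>x. x < s"], of "{a + B}" "{\<omega>. \<omega> (a + B) = v}"]
      Suc.IH[OF that] determined_Collect_bit[of "a + B" "{a + B}" v] by (simp add: prob_bit)
  have meas: "{\<omega>. block_value B a \<omega> < s} \<inter> {\<omega>. \<omega> (a + B) = v} \<in> sets tape_measure" for s v
    by (intro sets.Int sets_determined[OF _ determined_block_value] sets_determined[OF _ determined_Collect_bit[of _ "{a + B}"]]) auto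
  show ?case
  proof (cases "t \<le> 2 ^ B")
    case True
    have "{\<omega>. block_value (Suc B) a \<omega> < t} = {\<omega>. block_value B a \<omega> < t} \<inter> {\<omega>. \<omega> (a + B) = False}"
      using True by (auto simp: block_value_Suc split: if_splits)
    then show ?thesis using ind[OF True, of False] by (simp add: mult.commute)
  next
    case False
    then have t: "t - 2 ^ B \<le> 2 ^ B" "2 ^ B \<le> t" using Suc.prems by auto
    have "{\<omega>. block_value (Suc B) a \<omega> < t} = ({\<omega>. block_value B a \<omega> < 2 ^ B} \<inter> {\<omega>. \<omega> (a + B) = False})
        \<union> ({\<omega>. block_value B a \<omega> < t - 2 ^ B} \<inter> {\<omega>. \<omega> (a + B) = True})"
    proof (rule set_eqI)
      fix \<omega> :: random_tape
      show "(\<omega> \<in> {\<omega>. block_value (Suc B) a \<omega> < t}) =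
        (\<omega> \<in> ({\<omega>. block_value B a \<omega> < 2 ^ B} \<inter> {\<omega>. \<omega> (a + B) = False})
          \<union> ({\<omega>. block_value B a \<omega> < t - 2 ^ B} \<inter> {\<omega>. \<omega> (a + B) = True}))"
        using t(2) block_value_less[of B a \<omega>]
        by (cases "\<omega> (a + B)") (auto simp: block_value_Suc less_diff_conv)
    qed
    moreover have "tape.prob \<dots> = 2 ^ B / 2 ^ B * (1 / 2) + (t - 2 ^ B) / 2 ^ B * (1 / 2)"
    proof (subst tape.finite_measure_Union)
      show "tape.prob ({\<omega>. block_value B a \<omega> < 2 ^ B} \<inter> {\<omega>. \<omega> (a + B) = False}) +
          tape.prob ({\<omega>. block_value B a \<omega> < t - 2 ^ B} \<inter> {\<omega>. \<omega> (a + B) = True}) =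
          2 ^ B / 2 ^ B * (1 / 2) + (t - 2 ^ B) / 2 ^ B * (1 / 2)"
        unfolding ind[OF t(1)] ind[OF order_refl] using t(2) by (simp add: of_nat_diff)
    qed (use meas in \<open>blast+\<close>)
    ultimately show ?thesis using t(2) by (simp add: field_simps)
  qed
qed

section \<open>The local lemma\<close>

definition literal_occurrences :: "cnf \<Rightarrow> nat \<Rightarrow> bool \<Rightarrow> nat" where
  "literal_occurrences \<phi> x b = card {c. c < length \<phi> \<and> (x, b) \<in> set (\<phi> ! c)}"

text \<open>The more often a variable occurs positively, the less likely it is to be true (Gebauer,
  Szabo and Tardos): clauses with many conflicts thereby become more likely to be satisfied.\<close>

definition threshold :: "nat \<Rightarrow> nat \<Rightarrow> nat \<Rightarrow> cnf \<Rightarrow> nat \<Rightarrow> nat" where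
  "threshold k d B \<phi> x = 2 ^ B * (d * (k + 1) - 2 * literal_occurrences \<phi> x True) div (2 * d * k)"

text \<open>The table is laid out row by row with \<open>n\<close> columns, one block of
  \<open>B\<close> bits per entry. For x < n different entries occupy disjoint blocks.\<close>

definition sample :: "nat \<Rightarrow> nat \<Rightarrow> nat \<Rightarrow> nat \<Rightarrow> cnf \<Rightarrow> random_tape \<Rightarrow> nat \<Rightarrow> nat \<Rightarrow> bool" where
  "sample k d B n \<phi> \<omega> x i \<longleftrightarrow> block_value B ((i * n + x) * B) \<omega> < threshold k d B \<phi> x"

lemma blocks_disjoint:
  fixes a a' B :: nat
  assumes "a \<noteq> a'" shows "{a * B..<a * B + B} \<inter> {a' * B..<a' * B + B} = {}"
proof -
  have "a * B + B \<le> a' * B" if "a < a'" for a a'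
    using mult_le_mono1[of "Suc a" a' B] that by simp
  then show ?thesis using assms by (cases "a < a'") force+
qed

text \<open>The precision hypothesis lets the slack in \<open>1 + 1 / k < exp (1 / k)\<close> absorb the error of
  rounding the biases to multiples of \<open>1 / 2 ^ B\<close>.\<close>

locale sparse_cnf =
  fixes k d n B :: nat and \<phi> :: cnf
  assumes kcnf: "kcnf k n \<phi>" and occ: "max_occurrences d n \<phi>"
    and k: "2 \<le> k" and d: "1 \<le> d"
    and precision: "1 / 2 ^ B \<le> (exp (1 / k) - 1 - 1 / k) / 2 * (1 - 2 / (k + 1))"
begin

abbreviation "U \<equiv> sample k d B n \<phi>"

definition falsity :: "nat \<Rightarrow> bool \<Rightarrow> real" where
  "falsity x b = tape.prob {\<omega>. U \<omega> x 0 \<noteq> b}"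

definition clause_weight :: "nat \<Rightarrow> real" where
  "clause_weight c = (\<Prod>(x, b)\<in>set (\<phi> ! c). falsity x b)"

definition conflicts :: "nat \<Rightarrow> nat" where
  "conflicts c = (\<Sum>(x, b)\<in>set (\<phi> ! c). literal_occurrences \<phi> x (\<not> b))"

text \<open>\<open>z\<close> is the weight that the local lemma assigns to every clause, and \<mu>
  the corresponding weight per event in sums over witnesses, with 1 + \<mu> = 1 / (1 - z). The slack
  \<rho> is normalised so that \<open>exp 1 / 2 ^ k / \<rho>\<close> is exactly
  \<open>z\<close>.\<close>

definition z :: real where "z = 2 / (real d * (real k + 1))"
definition \<rho> :: real where "\<rho> = exp 1 * (real d * (real k + 1)) / 2 ^ (k + 1)"
definition \<mu> :: real where "\<mu> = z / (1 - z)"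

section \<open>Biased literals and the weight of a clause\<close>

lemma distinct_clause: "c < length \<phi> \<Longrightarrow> distinct (map fst (\<phi> ! c))"
  and length_clause: "c < length \<phi> \<Longrightarrow> length (\<phi> ! c) = k"
  and clause_less: "c < length \<phi> \<Longrightarrow> (x, b) \<in> set (\<phi> ! c) \<Longrightarrow> x < n"
  using kcnf by (force simp: kcnf_def clause_vars_def)+

lemma same_sign:
  "c < length \<phi> \<Longrightarrow> (x, b) \<in> set (\<phi> ! c) \<Longrightarrow> (x, b') \<in> set (\<phi> ! c) \<Longrightarrow> b = b'"
  using eq_key_imp_eq_value[OF distinct_clause] .

lemma occurrences_add: "x < n \<Longrightarrow> literal_occurrences \<phi> x b + literal_occurrences \<phi> x (\<not> b) \<le> d"
proof -
  assume x: "x < n"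
  let ?O = "\<lambda>b. {c. c < length \<phi> \<and> (x, b) \<in> set (\<phi> ! c)}"
  have "card (?O b) + card (?O (\<not> b)) = card (?O b \<union> ?O (\<not> b))"
    by (rule card_Un_disjoint[symmetric]) (auto dest: same_sign)
  also have "\<dots> \<le> card (occurrences \<phi> x)"
    by (intro card_mono) (auto simp: occurrences_def clause_vars_iff)
  also have "\<dots> \<le> d" using occ x by (simp add: max_occurrences_def)
  finally show ?thesis by (simp add: literal_occurrences_def)
qed

text \<open>\<open>T\<close> is the ideal probability of true. With \<open>o\<close> positive
  occurrences it equals \<open>(1 + 1 / k) / 2 * (1 - o * z)\<close>, and the threshold rounds it
  down to a multiple of \<open>1 / 2 ^ B\<close>.\<close>

lemma threshold_bounds:
  assumes "x < n"
  defines "t \<equiv> threshold k d B \<phi> x / 2 ^ B"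
    and "T \<equiv> (real d * (real k + 1) - 2 * real (literal_occurrences \<phi> x True)) / (2 * d * k)"
  shows "t \<le> T" "T \<le> t + 1 / 2 ^ B" "threshold k d B \<phi> x \<le> 2 ^ B"
proof -
  let ?o = "literal_occurrences \<phi> x True" and ?D = "2 * d * k"
  let ?a = "2 ^ B * (d * (k + 1) - 2 * ?o)"
  have D: "?D > 0" using k d by simp
  have "2 * ?o \<le> 2 * d" using occurrences_add[OF assms(1), of True] by simp
  also have "\<dots> \<le> d * (k + 1)" using k by (simp add: mult.commute)
  finally have o: "2 * ?o \<le> d * (k + 1)" .
  then have a: "real ?a = 2 ^ B * (T * ?D)"
    using D by (simp add: T_def of_nat_diff distrib_left)
  have "real (?a div ?D) \<le> real ?a / real ?D" by (rule of_nat_div_le_of_nat)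
  also have "\<dots> = 2 ^ B * T" unfolding a using D by simp
  finally show "t \<le> T" by (simp add: t_def threshold_def field_simps)
  have "real ?a / real ?D \<le> real (?a div ?D) + 1"
    using divide_nat_diff_div_nat_less_one[of ?a ?D] by simp
  then have "2 ^ B * T \<le> real (?a div ?D) + 1" unfolding a using D by simp
  then show "T \<le> t + 1 / 2 ^ B" by (simp add: t_def threshold_def field_simps)
  have "d * (k + 1) \<le> ?D" using k by simp
  then have "?a \<le> 2 ^ B * ?D" by (intro mult_left_mono order_trans[OF diff_le_self]) auto
  then show "threshold k d B \<phi> x \<le> 2 ^ B"
    unfolding threshold_def using div_le_mono[of ?a "2 ^ B * ?D" ?D] D by simp
qed

lemma prob_sample:
  assumes "x < n"
  shows "tape.prob {\<omega>. U \<omega> x i \<noteq> b} =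
    (if b then 1 - threshold k d B \<phi> x / 2 ^ B else threshold k d B \<phi> x / 2 ^ B)"
proof -
  have *: "tape.prob {\<omega>. U \<omega> x i} = threshold k d B \<phi> x / 2 ^ B"
    unfolding sample_def by (rule prob_block_value) (rule threshold_bounds[OF assms])
  have "{\<omega>. U \<omega> x i} \<in> sets tape_measure"
    unfolding sample_def by (rule sets_determined[OF _ determined_block_value]) simp
  then show ?thesis using tape.prob_compl[of "{\<omega>. U \<omega> x i}"] *
    by (cases b) (simp_all add: Compl_eq_Diff_UNIV[symmetric] Collect_neg_eq)
qed

text \<open>Up to rounding, a literal is false with probability at most
  \<open>(1 + 1 / k) / 2 * (1 - o * z)\<close>, where \<open>o\<close> counts the opposite literal;
  for positive literals this needs that both counts add up to at most \<open>d\<close>. Bernoulli's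
  inequality makes a power of it, so that the exponents of a clause add up to
  \<open>conflicts c\<close>.\<close>

lemma falsity_le:
  assumes "x < n"
  shows "falsity x b \<le> exp (1 / k) / 2 * (1 - z) ^ literal_occurrences \<phi> x (\<not> b)"
proof -
  let ?o = "\<lambda>b. real (literal_occurrences \<phi> x b)"
  have kd: "real k \<ge> 2" "real d \<ge> 1" using k d by auto
  have o: "?o b + ?o (\<not> b) \<le> d" for b using occurrences_add[OF assms, of b] by linarith
  have "falsity x b \<le> (real d * (real k + 1) - 2 * ?o (\<not> b)) / (2 * d * k) + 1 / 2 ^ B"
  proof (cases b)
    case False
    then show ?thesis using threshold_bounds(1)[OF assms] prob_sample[OF assms, of 0 b]
      by (simp add: falsity_def add_increasing2)
  next
    case True
    have "1 - (real d * (real k + 1) - 2 * ?o True) / (2 * d * k) \<le> (real d * (real k + 1) - 2 * ?o False) / (2 * d * k)"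
    proof -
      have "1 = (2 * real d * k) / (2 * d * k)" using kd by simp
      then have "1 - (real d * (real k + 1) - 2 * ?o True) / (2 * d * k) = (2 * real d * k - (real d * (real k + 1) - 2 * ?o True)) / (2 * d * k)"
        by (simp only: diff_divide_distrib)
      also have "\<dots> \<le> (real d * (real k + 1) - 2 * ?o False) / (2 * d * k)"
        using o[of True] kd by (intro divide_right_mono) (auto simp: algebra_simps)
      finally show ?thesis .
    qed
    then show ?thesis using threshold_bounds(2)[OF assms] prob_sample[OF assms, of 0 b] True
      by (simp add: falsity_def)
  qed
  also have "(real d * (real k + 1) - 2 * ?o (\<not> b)) / (2 * d * k) = (1 + 1 / k) / 2 * (1 - ?o (\<not> b) * z)"
  proof -
    show ?thesis using kd by (simp add: z_def divide_simps)
  qed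
  \<comment> \<open>The rounding error has to be a multiple of the same factor
    \<open>1 - o * z\<close>. As \<open>o\<close> is at most \<open>d\<close>, this factor is at
    least \<open>1 - 2 / (k + 1)\<close>, whence the form of \<open>precision\<close>.\<close>
  also have "1 / 2 ^ B \<le> (exp (1 / k) - 1 - 1 / k) / 2 * (1 - ?o (\<not> b) * z)"
  proof -
    have "?o (\<not> b) * z \<le> d * z" using o[of b] kd by (intro mult_right_mono) (auto simp: z_def)
    also have "\<dots> = 2 / (k + 1)" using kd by (simp add: z_def)
    finally have "1 - 2 / (k + 1) \<le> 1 - ?o (\<not> b) * z" by simp
    moreover have "0 \<le> exp (1 / real k) - 1 - 1 / k"
      using exp_ge_add_one_self[of "1 / real k"] by linarith
    ultimately show ?thesis by (intro order_trans[OF precision] mult_left_mono) auto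
  qed
  also have "(1 + a) / 2 * X + (e - 1 - a) / 2 * X = e / 2 * X" for a e X :: real
    by (simp add: field_simps)
  finally have "falsity x b \<le> exp (1 / k) / 2 * (1 - ?o (\<not> b) * z)" by simp
  also have "1 - ?o (\<not> b) * z \<le> (1 - z) ^ literal_occurrences \<phi> x (\<not> b)"
  proof -
    have "1 * 2 \<le> real d * (real k + 1)" using kd by (intro mult_mono) auto
    then have "z \<le> 1" by (simp add: z_def)
    then show ?thesis using Bernoulli_inequality[of "- z" "literal_occurrences \<phi> x (\<not> b)"] by simp
  qed
  finally show ?thesis by (simp add: mult_left_mono)
qed

lemma z_bounds: "0 < z" "z < 1"
proof -
  have "1 * 3 \<le> real d * (real k + 1)" using k d by (intro mult_mono) auto
  then show "0 < z" "z < 1" by (auto simp: z_def)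
qed

lemma falsity_nonneg: "0 \<le> falsity x b"
  by (simp add: falsity_def)

lemma clause_weight_le:
  assumes "c < length \<phi>"
  shows "clause_weight c \<le> exp 1 / 2 ^ k * (1 - z) ^ conflicts c"
proof -
  have "clause_weight c \<le> (\<Prod>(x, b)\<in>set (\<phi> ! c). exp (1 / k) / 2 * (1 - z) ^ literal_occurrences \<phi> x (\<not> b))"
    unfolding clause_weight_def
    using falsity_nonneg falsity_le clause_less[OF assms] by (intro prod_mono) (auto split: prod.splits)
  also have "\<dots> = (\<Prod>(x, b)\<in>set (\<phi> ! c). exp (1 / k) / 2) * (1 - z) ^ conflicts c"
    unfolding case_prod_unfold prod.distrib conflicts_def power_sum ..
  also have "(\<Prod>(x, b)\<in>set (\<phi> ! c). exp (1 / real k) / 2) = (exp (1 / k) / 2) ^ k"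
    using length_clause[OF assms] distinct_clause[OF assms]
    by (simp add: case_prod_unfold distinct_card distinct_map)
  also have "\<dots> = exp 1 / 2 ^ k"
    using k by (simp add: power_divide exp_divide_power_eq)
  finally show ?thesis .
qed

lemma clause_weight_nonneg: "0 \<le> clause_weight c"
  unfolding clause_weight_def by (intro prod_nonneg) (auto simp: falsity_nonneg)

lemma card_neighbours:
  "card (neighbours \<phi> {c}) \<le> Suc (conflicts c)"
proof -
  have "neighbours \<phi> {c} \<subseteq> insert c (\<Union>(x, b)\<in>set (\<phi> ! c). {c'. c' < length \<phi> \<and> (x, \<not> b) \<in> set (\<phi> ! c')})"
  proof
    fix c' assume c': "c' \<in> neighbours \<phi> {c}"
    then have "c' = c \<or> conflict \<phi> c c'" using conflict_sym by (auto simp: neighbours_def adjacent_def)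
    then show "c' \<in> insert c (\<Union>(x, b)\<in>set (\<phi> ! c). {c'. c' < length \<phi> \<and> (x, \<not> b) \<in> set (\<phi> ! c')})"
      using c' unfolding conflict_def neighbours_def by blast
  qed
  then have "card (neighbours \<phi> {c}) \<le> card (insert c (\<Union>(x, b)\<in>set (\<phi> ! c). {c'. c' < length \<phi> \<and> (x, \<not> b) \<in> set (\<phi> ! c')}))"
    by (intro card_mono) auto
  also have "\<dots> \<le> Suc (card (\<Union>(x, b)\<in>set (\<phi> ! c). {c'. c' < length \<phi> \<and> (x, \<not> b) \<in> set (\<phi> ! c')}))"
    by (intro card_insert_le_m1) auto
  also have "card (\<Union>(x, b)\<in>set (\<phi> ! c). {c'. c' < length \<phi> \<and> (x, \<not> b) \<in> set (\<phi> ! c')}) \<le> conflicts c"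
    unfolding conflicts_def literal_occurrences_def case_prod_unfold by (rule card_UN_le) simp
  finally show ?thesis by simp
qed

lemma \<rho>_pos: "0 < \<rho>"
  using d by (simp add: \<rho>_def add_nonneg_pos)

text \<open>The lopsided local lemma with all slack spent: after division by \<rho> a clause has
  weight at most \<open>z * (1 - z) ^ conflicts c\<close>. Each conflict contributes a factor 1 +
  \<mu>, which cancels 1 - z, and the clause's adjacency to itself turns \<open>z\<close> into
  \<mu>.\<close>

lemma local_lemma_condition:
  assumes "c < length \<phi>"
  shows "clause_weight c / \<rho> * (1 + \<mu>) ^ card (neighbours \<phi> {c}) \<le> \<mu>"
proof -
  have \<mu>: "1 + \<mu> = 1 / (1 - z)" using z_bounds by (simp add: \<mu>_def field_simps)
  have "(1 + \<mu>) ^ card (neighbours \<phi> {c}) \<le> (1 + \<mu>) ^ Suc (conflicts c)"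
    using z_bounds card_neighbours by (intro power_increasing) (simp_all add: \<mu>)
  moreover have "clause_weight c / \<rho> \<le> z * (1 - z) ^ conflicts c"
  proof -
    have "clause_weight c / \<rho> \<le> exp 1 / 2 ^ k * (1 - z) ^ conflicts c / \<rho>"
      using clause_weight_le[OF assms] \<rho>_pos by (intro divide_right_mono) auto
    also have "\<dots> = (exp 1 / 2 ^ k / \<rho>) * (1 - z) ^ conflicts c" by simp
    also have "exp 1 / 2 ^ k / \<rho> = z" by (simp add: \<rho>_def z_def)
    finally show ?thesis .
  qed
  ultimately have "clause_weight c / \<rho> * (1 + \<mu>) ^ card (neighbours \<phi> {c})
      \<le> z * (1 - z) ^ conflicts c * (1 + \<mu>) ^ Suc (conflicts c)"
    using z_bounds by (intro mult_mono) (auto simp: \<mu>)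
  also have "\<dots> = z * ((1 - z) * (1 + \<mu>)) ^ conflicts c * (1 + \<mu>)"
    unfolding power_mult_distrib by simp
  also have "(1 - z) * (1 + \<mu>) = 1" using z_bounds by (simp add: \<mu>)
  also have "z * 1 ^ conflicts c * (1 + \<mu>) = \<mu>" unfolding \<mu> by (simp add: \<mu>_def)
  finally show ?thesis .
qed

section \<open>Probability of consistent witnesses\<close>

lemma card_deeper_less:
  assumes "finite W" "(i, c) \<in> deeper \<phi> W i' c' y"
  shows "card (deeper \<phi> W i c y) < card (deeper \<phi> W i' c' y)"
proof (rule psubset_card_mono)
  show "finite (deeper \<phi> W i' c' y)"
    using assms(1) by (rule finite_subset[rotated]) (auto simp: deeper_def)
  have "(i, c) \<notin> deeper \<phi> W i c y" by (simp add: deeper_def)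
  moreover have "deeper \<phi> W i c y \<subseteq> deeper \<phi> W i' c' y" using assms(2) by (auto simp: deeper_def)
  ultimately show "deeper \<phi> W i c y \<subset> deeper \<phi> W i' c' y" using assms(2) by blast
qed

text \<open>Two different events containing \<open>y\<close> are comparable by depth and clause
  number, so their counts of deeper events differ and they read different rows. The required entries
  thus lie in disjoint blocks, and the probability of a wrong value does not depend on the
  row.\<close>

lemma prob_consistent:
  assumes fin: "finite W" and less: "snd ` W \<subseteq> {..<length \<phi>}"
  shows "{\<omega>. consistent (U \<omega>) \<phi> W} \<in> sets tape_measure"
    "tape.prob {\<omega>. consistent (U \<omega>) \<phi> W} = (\<Prod>(i, c)\<in>W. clause_weight c)"
proof -
  define E where "E = (SIGMA (i, c):W. set (\<phi> ! c))"
  define idx where "idx = (\<lambda>((i, c), (y, b :: bool)). card (deeper \<phi> W i c y) * n + y)"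
  define A where "A = (\<lambda>((i, c), (y, b)). {\<omega>. U \<omega> y (card (deeper \<phi> W i c y)) \<noteq> b})"
  define J where "J = (\<lambda>e. {idx e * B..<idx e * B + B})"
  have finE: "finite E" unfolding E_def using fin by (intro finite_SigmaI) auto
  have vars: "y < n \<and> c < length \<phi>" if "((i, c), (y, b)) \<in> E" for i c y b
  proof -
    have "(i, c) \<in> W" "(y, b) \<in> set (\<phi> ! c)" using that by (auto simp: E_def)
    moreover from this have "c < length \<phi>" using less by (auto simp: image_subset_iff)
    ultimately show ?thesis using clause_less by blast
  qed
  have idx: "idx e \<noteq> idx e'" if "e \<in> E" "e' \<in> E" "e \<noteq> e'" for e e'
  proof -
    obtain p q p' q' where pq: "e = (p, q)" "e' = (p', q')" by (cases e, cases e')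
    obtain i c y b where pq': "p = (i, c)" "q = (y, b)" by (cases p, cases q)
    obtain i' c' y' b' where pq'': "p' = (i', c')" "q' = (y', b')" by (cases p', cases q')
    note e = pq[unfolded pq' pq'']
    have y: "y < n" "y' < n" "c < length \<phi>" using vars that e by auto
    show ?thesis
    proof (rule ccontr)
      assume "\<not> ?thesis"
      then have eq: "card (deeper \<phi> W i c y) * n + y = card (deeper \<phi> W i' c' y') * n + y'"
        by (simp add: idx_def e)
      have "y = y'" using arg_cong[OF eq, of "\<lambda>a. a mod n"] y by simp
      moreover have "card (deeper \<phi> W i c y) = card (deeper \<phi> W i' c' y')"
        using arg_cong[OF eq, of "\<lambda>a. a div n"] y by simp
      moreover have "(i, c) \<in> W" "(i', c') \<in> W" "(y, b) \<in> set (\<phi> ! c)" "(y', b') \<in> set (\<phi> ! c')"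
        using that e by (auto simp: E_def)
      moreover from this have "(i, c) = (i', c') \<or> (i, c) \<in> deeper \<phi> W i' c' y \<or> (i', c') \<in> deeper \<phi> W i c y"
        using \<open>y = y'\<close> by (auto simp: deeper_def clause_vars_iff)
      ultimately have "(i, c) = (i', c')"
        using card_deeper_less[OF fin, of i c i' c' y] card_deeper_less[OF fin, of i' c' i c y] by auto
      then have "b = b'" using same_sign[OF y(3)] \<open>y = y'\<close> \<open>(y, b) \<in> _\<close> \<open>(y', b') \<in> _\<close> by auto
      then show False using that e \<open>(i, c) = (i', c')\<close> \<open>y = y'\<close> by simp
    qed
  qed
  have "disjoint_family_on J E" unfolding disjoint_family_on_def J_def
    by (intro ballI impI blocks_disjoint idx)
  moreover have "determined (J e) (A e)" for e
  proof -
    obtain p q where "e = (p, q)" by (cases e)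
    moreover obtain i c y b where "p = (i, c)" "q = (y, b)" by (cases p, cases q)
    ultimately have e: "e = ((i, c), (y, b))" by simp
    show ?thesis using determined_block_value[of "idx e * B" B "\<lambda>v. (v < threshold k d B \<phi> y) \<noteq> b"]
      by (simp add: J_def A_def sample_def e idx_def)
  qed
  ultimately have P: "tape.prob (\<Inter>e\<in>E. A e) = (\<Prod>e\<in>E. tape.prob (A e))"
      "determined (\<Union>e\<in>E. J e) (\<Inter>e\<in>E. A e)"
    using prob_INT_determined[of E J A] finE by (auto simp: J_def)
  have eq: "{\<omega>. consistent (U \<omega>) \<phi> W} = (\<Inter>e\<in>E. A e)"
  proof (rule set_eqI)
    fix \<omega>
    have "\<omega> \<in> (\<Inter>e\<in>E. A e) \<longleftrightarrow> (\<forall>i c y b. ((i, c), (y, b)) \<in> E \<longrightarrow> \<omega> \<in> A ((i, c), (y, b)))"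
      unfolding INT_iff Ball_def split_paired_All ..
    also have "\<dots> \<longleftrightarrow> (\<forall>i c y b. (i, c) \<in> W \<and> (y, b) \<in> set (\<phi> ! c) \<longrightarrow> U \<omega> y (card (deeper \<phi> W i c y)) \<noteq> b)"
      by (simp add: E_def A_def)
    also have "\<dots> \<longleftrightarrow> consistent (U \<omega>) \<phi> W" unfolding consistent_def Ball_def split_paired_All prod.case by blast
    finally show "\<omega> \<in> {\<omega>. consistent (U \<omega>) \<phi> W} \<longleftrightarrow> \<omega> \<in> (\<Inter>e\<in>E. A e)" by simp
  qed
  show "{\<omega>. consistent (U \<omega>) \<phi> W} \<in> sets tape_measure"
    unfolding eq by (rule sets_determined[OF _ P(2)]) (auto simp: finE J_def)
  have "(\<Prod>e\<in>E. tape.prob (A e)) = (\<Prod>((i, c), (y, b))\<in>E. falsity y b)"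
  proof (intro prod.cong refl, clarify)
    fix i c y b assume "((i, c), (y, b)) \<in> E"
    then have "y < n" using vars by auto
    then show "tape.prob (A ((i, c), (y, b))) = falsity y b"
      using prob_sample[of y "card (deeper \<phi> W i c y)" b] prob_sample[of y 0 b]
      by (simp add: A_def falsity_def)
  qed
  also have "\<dots> = (\<Prod>w\<in>W. \<Prod>l\<in>set (\<phi> ! snd w). falsity (fst l) (snd l))"
  proof -
    have "E = Sigma W (\<lambda>w. set (\<phi> ! snd w))" by (auto simp: E_def)
    then show ?thesis using fin by (simp add: prod.Sigma case_prod_unfold)
  qed
  also have "\<dots> = (\<Prod>(i, c)\<in>W. clause_weight c)"
    by (simp add: clause_weight_def case_prod_unfold)
  finally show "tape.prob {\<omega>. consistent (U \<omega>) \<phi> W} = (\<Prod>(i, c)\<in>W. clause_weight c)"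
    using P(1) eq by simp
qed

text \<open>Union bound over layerings, in which each of the at least \<open>Suc h\<close> events
  contributes a factor \<rho> and the rest sums to at most \<mu>. The result is a measurable cover
  \<open>A\<close>, so measurability of the event itself need not be discussed.\<close>

lemma deep_log_bound:
  assumes c: "c < length \<phi>" and \<rho>: "\<rho> \<le> 1"
  obtains A where "A \<in> sets tape_measure" "tape.prob A \<le> \<rho> ^ Suc h * \<mu>"
    "{\<omega>. \<exists>l. valid_log (U \<omega>) \<phi> (c # l) \<and> deep \<phi> h (c # l)} \<subseteq> A"
proof -
  define L where "L = (\<lambda>r. {Ls \<in> layerings \<phi> r {c}. Suc h \<le> card (layer_set Ls)})"
  define A where "A = (\<lambda>r. \<Union>Ls\<in>L r. {\<omega>. consistent (U \<omega>) \<phi> (layer_set Ls)})"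
  have fin: "finite (layer_set Ls)" and less: "snd ` layer_set Ls \<subseteq> {..<length \<phi>}"
    and finS: "\<And>S. S \<in> set Ls \<Longrightarrow> finite S" if "Ls \<in> L r" for Ls r
  proof -
    have *: "S \<subseteq> {..<length \<phi>}" if "S \<in> set Ls" for S
      using layerings_less[of Ls \<phi> r "{c}"] that \<open>Ls \<in> L r\<close> c by (auto simp: L_def)
    then show finS: "\<And>S. S \<in> set Ls \<Longrightarrow> finite S" using finite_subset by blast
    then show "finite (layer_set Ls)" by (rule finite_layer_set)
    show "snd ` layer_set Ls \<subseteq> {..<length \<phi>}"
    proof clarify
      fix i e assume "(i, e) \<in> layer_set Ls"
      then have "Ls ! i \<in> set Ls" "e \<in> Ls ! i" by (auto simp: layer_set_def)
      then show "snd (i, e) < length \<phi>" using * by auto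
    qed
  qed
  have finL: "finite (L r)" for r by (simp add: L_def)
  have A: "A r \<in> sets tape_measure" for r
    unfolding A_def by (rule sets.finite_UN[OF finL prob_consistent(1)[OF fin less]])
  have "tape.prob (A r) \<le> \<rho> ^ Suc h * \<mu>" for r
  proof -
    have "tape.prob (A r) \<le> (\<Sum>Ls\<in>L r. tape.prob {\<omega>. consistent (U \<omega>) \<phi> (layer_set Ls)})"
      unfolding A_def
      by (rule tape.finite_measure_subadditive_finite[OF finL image_subsetI[OF prob_consistent(1)[OF fin less]]])
    also have "\<dots> \<le> (\<Sum>Ls\<in>L r. \<rho> ^ Suc h * layer_weight (\<lambda>c. clause_weight c / \<rho>) Ls)"
    proof (rule sum_mono)
      fix Ls assume Ls: "Ls \<in> L r"
      have "tape.prob {\<omega>. consistent (U \<omega>) \<phi> (layer_set Ls)} = (\<Prod>(i, c)\<in>layer_set Ls. \<rho> * (clause_weight c / \<rho>))"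
        using prob_consistent(2)[OF fin[OF Ls] less[OF Ls]] \<rho>_pos by simp
      also have "\<dots> = \<rho> ^ card (layer_set Ls) * layer_weight (\<lambda>c. clause_weight c / \<rho>) Ls"
        by (simp only: layer_weight_eq[OF finS[OF Ls]] case_prod_unfold prod.distrib prod_constant)
      also have "\<dots> \<le> \<rho> ^ Suc h * layer_weight (\<lambda>c. clause_weight c / \<rho>) Ls"
        using Ls \<rho> \<rho>_pos clause_weight_nonneg
        by (intro mult_right_mono power_decreasing) (auto simp: L_def layer_weight_eq[OF finS[OF Ls]] intro!: prod_nonneg)
      finally show "tape.prob {\<omega>. consistent (U \<omega>) \<phi> (layer_set Ls)}
        \<le> \<rho> ^ Suc h * layer_weight (\<lambda>c. clause_weight c / \<rho>) Ls" .
    qed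
    also have "\<dots> = \<rho> ^ Suc h * (\<Sum>Ls\<in>L r. layer_weight (\<lambda>c. clause_weight c / \<rho>) Ls)"
      by (simp add: sum_distrib_left)
    also have "(\<Sum>Ls\<in>L r. layer_weight (\<lambda>c. clause_weight c / \<rho>) Ls)
        \<le> (\<Sum>Ls\<in>layerings \<phi> r {c}. layer_weight (\<lambda>c. clause_weight c / \<rho>) Ls)"
      using clause_weight_nonneg \<rho>_pos
      by (intro sum_mono2) (auto simp: L_def layer_weight_def intro!: prod_list_nonneg prod_nonneg)
    also have "\<dots> \<le> \<mu> ^ card {c}"
      using z_bounds clause_weight_nonneg \<rho>_pos local_lemma_condition c
      by (intro layer_weight_sum_le) (auto simp: \<mu>_def)
    finally show ?thesis using \<rho>_pos by (simp add: mult_left_mono)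
  qed
  \<comment> \<open>Logs have no bounded length. Appending an empty layer does not change the set of
    events, so \<open>A r\<close> increases with \<open>r\<close>, and continuity from below
    transfers the uniform bound to all lengths at once.\<close>
  moreover have "incseq A"
  proof (rule incseq_SucI)
    fix r
    have "Ls @ [{}] \<in> L (Suc r)" if "Ls \<in> L r" for Ls
      using that layerings_snoc_empty by (simp add: L_def layer_set_snoc_empty del: layerings.simps)
    then have "layer_set ` L r \<subseteq> layer_set ` L (Suc r)"
      by (intro image_subsetI) (metis layer_set_snoc_empty rev_image_eqI)
    then have "(\<Union>W\<in>layer_set ` L r. {\<omega>. consistent (U \<omega>) \<phi> W})
        \<subseteq> (\<Union>W\<in>layer_set ` L (Suc r). {\<omega>. consistent (U \<omega>) \<phi> W})"
      by (rule UN_mono) simp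
    then show "A r \<le> A (Suc r)" by (simp only: A_def image_image)
  qed
  then have "(\<lambda>r. tape.prob (A r)) \<longlonglongrightarrow> tape.prob (\<Union>r. A r)"
    using A by (intro tape.finite_Lim_measure_incseq image_subsetI)
  ultimately have "tape.prob (\<Union>r. A r) \<le> \<rho> ^ Suc h * \<mu>"
    by (intro LIMSEQ_le_const2[of "\<lambda>r. tape.prob (A r)"]) simp_all
  moreover have "\<omega> \<in> (\<Union>r. A r)" if l: "valid_log (U \<omega>) \<phi> (c # l)" "deep \<phi> h (c # l)" for \<omega> l
  proof -
    obtain Ls where Ls: "Ls \<in> layerings \<phi> (length l) {c}" "layer_set Ls = witness \<phi> c l"
      using witness_layering[OF l(1)] .
    have "consistent (U \<omega>) \<phi> (layer_set Ls)"
      unfolding Ls(2) using distinct_clause l(1) by (rule consistent_witness)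
    moreover have "Ls \<in> L (length l)" using Ls card_witness[OF l(2)] by (simp add: L_def)
    ultimately show ?thesis by (auto simp: A_def)
  qed
  ultimately show ?thesis using A by (intro that[of "\<Union>r. A r"]) (simp_all add: subset_iff, blast)
qed

end

section \<open>Passes and stability\<close>

definition visit :: "(nat \<Rightarrow> nat \<Rightarrow> bool) \<Rightarrow> cnf \<Rightarrow> nat \<Rightarrow> nat list \<Rightarrow> nat list" where
  "visit V \<phi> c l = (if violated V \<phi> (resamplings \<phi> l) c then c # l else l)"

abbreviation visits :: "(nat \<Rightarrow> nat \<Rightarrow> bool) \<Rightarrow> cnf \<Rightarrow> nat list \<Rightarrow> nat list \<Rightarrow> nat list" where
  "visits V \<phi> \<equiv> fold (visit V \<phi>)"

text \<open>Distance 0 means containing \<open>x\<close>, so reaching distance \<open>r\<close>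
  takes a walk through \<open>Suc r\<close> clauses. Walks with \<open>R\<close> clauses therefore
  cover the distances r < R.\<close>

fun near :: "cnf \<Rightarrow> nat \<Rightarrow> nat \<Rightarrow> nat \<Rightarrow> bool" where
  "near \<phi> 0 x c \<longleftrightarrow> c < length \<phi> \<and> x \<in> clause_vars (\<phi> ! c)"
| "near \<phi> (Suc r) x c \<longleftrightarrow>
    (\<exists>c0 y. c0 < length \<phi> \<and> x \<in> clause_vars (\<phi> ! c0) \<and> y \<in> clause_vars (\<phi> ! c0) \<and> near \<phi> r y c)"

lemma visit_extends: "\<exists>ev. visit V \<phi> c l = ev @ l \<and> set ev \<subseteq> {c} \<and> length ev \<le> 1"
  by (auto simp: visit_def)

lemma visits_extends: "\<exists>ev. visits V \<phi> vs l = ev @ l \<and> set ev \<subseteq> set vs \<and> length ev \<le> length vs"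
proof (induction vs arbitrary: l)
  case (Cons v vs)
  obtain ev where ev: "visits V \<phi> vs (visit V \<phi> v l) = ev @ visit V \<phi> v l"
      "set ev \<subseteq> set vs" "length ev \<le> length vs" using Cons.IH by blast
  obtain ev' where ev': "visit V \<phi> v l = ev' @ l" "set ev' \<subseteq> {v}" "length ev' \<le> 1"
    using visit_extends by blast
  show ?case using ev ev' by (intro exI[of _ "ev @ ev'"]) auto
qed simp

lemma valid_log_visits:
  "valid_log V \<phi> l \<Longrightarrow> set vs \<subseteq> {..<length \<phi>} \<Longrightarrow> valid_log V \<phi> (visits V \<phi> vs l)"
  by (induction vs arbitrary: l) (auto simp: visit_def)

text \<open>The true literal of \<open>c\<close> that is lost lies on a variable of
  \<open>v\<close>. Since \<open>v\<close> was violated, its own literal on that variable was false,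
  hence has the opposite sign. This is why conflicts suffice as causes.\<close>

lemma newly_violated_visit:
  assumes "\<not> violated V \<phi> (resamplings \<phi> l) c" "violated V \<phi> (resamplings \<phi> (visit V \<phi> v l)) c"
  shows "visit V \<phi> v l = v # l" "violated V \<phi> (resamplings \<phi> l) v" "conflict \<phi> v c"
proof -
  show v: "violated V \<phi> (resamplings \<phi> l) v" and vl: "visit V \<phi> v l = v # l"
    using assms by (auto simp: visit_def split: if_splits)
  obtain x b where x: "(x, b) \<in> set (\<phi> ! c)" "V x (resamplings \<phi> l x) = b"
    using assms(1) by (auto simp: violated_def)
  have "V x (resamplings \<phi> (v # l) x) \<noteq> b" using assms(2) x(1) vl by (auto simp: violated_def)
  with x(2) have "x \<in> clause_vars (\<phi> ! v)" by (cases "x \<in> clause_vars (\<phi> ! v)") auto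
  then obtain b' where b': "(x, b') \<in> set (\<phi> ! v)" by (auto simp: clause_vars_iff)
  then have "b' \<noteq> b" using v x(2) by (auto simp: violated_def)
  then show "conflict \<phi> v c" using conflictI[OF b' x(1)] by simp
qed

lemma newly_violated_visits:
  assumes "\<not> violated V \<phi> (resamplings \<phi> l) c" "violated V \<phi> (resamplings \<phi> (visits V \<phi> vs l)) c"
  obtains v1 c' v2 ev where "vs = v1 @ c' # v2" "violated V \<phi> (resamplings \<phi> (visits V \<phi> v1 l)) c'"
    "conflict \<phi> c' c" "visits V \<phi> vs l = ev @ c' # visits V \<phi> v1 l"
  using assms
proof (induction vs arbitrary: l thesis)
  case (Cons v vs)
  show ?case
  proof (cases "violated V \<phi> (resamplings \<phi> (visit V \<phi> v l)) c")
    case True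
    note * = newly_violated_visit[OF Cons.prems(2) True]
    obtain ev where "visits V \<phi> vs (v # l) = ev @ v # l" using visits_extends by blast
    then show ?thesis using * by (intro Cons.prems(1)[of "[]" v vs ev]) simp_all
  next
    case False
    obtain v1 c' v2 ev where *: "vs = v1 @ c' # v2"
      "violated V \<phi> (resamplings \<phi> (visits V \<phi> v1 (visit V \<phi> v l))) c'"
      "conflict \<phi> c' c" "visits V \<phi> vs (visit V \<phi> v l) = ev @ c' # visits V \<phi> v1 (visit V \<phi> v l)"
      using Cons.IH[OF _ False] Cons.prems(3) by (metis fold_simps(2))
    then show ?thesis by (intro Cons.prems(1)[of "v # v1" c' v2 ev]) simp_all
  qed
qed simp

text \<open>A clause violated after several passes was either resampled at its last visit or was satisfied
  then and has been violated by a later event; that event in turn has had a visit in the pass before.\<close>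

lemma deep_after_passes:
  assumes "\<forall>p\<in>set ps. set p = S" "set vs \<subseteq> S" "c \<in> S"
    "violated V \<phi> (resamplings \<phi> (visits V \<phi> (concat ps @ vs) l)) c"
  shows "deep \<phi> (length ps) (c # visits V \<phi> (concat ps @ vs) l)"
  using assms
proof (induction ps arbitrary: vs c rule: rev_induct)
  case (snoc p ps)
  \<comment> \<open>\<open>vs\<close> is an unfinished pass. The last complete pass \<open>p\<close>
    visits \<open>c\<close>; the cause found from this visit on is preceded by the passes
    \<open>ps\<close> and a new unfinished pass, to which the induction hypothesis applies.\<close>
  then obtain p1 p2 where p: "p = p1 @ c # p2" by (metis in_set_conv_decomp last_in_set snoc_eq_iff_butlast)
  have S: "set p1 \<subseteq> S" "set p2 \<subseteq> S" "set vs \<subseteq> S" "\<forall>p\<in>set ps. set p = S"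
    using snoc.prems p by auto
  define l1 where "l1 = visits V \<phi> (concat ps @ p1) l"
  define L where "L = visits V \<phi> (p2 @ vs) (visit V \<phi> c l1)"
  have L: "visits V \<phi> (concat (ps @ [p]) @ vs) l = L" by (simp add: L_def l1_def p)
  have "\<exists>ev c' l2. L = ev @ c' # l2 \<and> adjacent \<phi> c' c \<and> deep \<phi> (length ps) (c' # l2)"
  proof (cases "violated V \<phi> (resamplings \<phi> (visit V \<phi> c l1)) c")
    case True
    then have viol: "violated V \<phi> (resamplings \<phi> l1) c" by (auto simp: visit_def split: if_splits)
    then have v: "visit V \<phi> c l1 = c # l1" by (simp add: visit_def)
    obtain ev where "L = ev @ c # l1" using visits_extends unfolding L_def v by blast
    moreover have "deep \<phi> (length ps) (c # l1)"
      unfolding l1_def using snoc.IH[of p1 c] S snoc.prems(3) viol by (simp add: l1_def)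
    ultimately show ?thesis by (auto simp: adjacent_def)
  next
    case False
    obtain v1 c' v2 ev where *: "p2 @ vs = v1 @ c' # v2"
      "violated V \<phi> (resamplings \<phi> (visits V \<phi> v1 (visit V \<phi> c l1))) c'" "conflict \<phi> c' c"
      "L = ev @ c' # visits V \<phi> v1 (visit V \<phi> c l1)"
      using newly_violated_visits[OF False, of "p2 @ vs"] snoc.prems(4) L unfolding L_def by metis
    have eq: "visits V \<phi> v1 (visit V \<phi> c l1) = visits V \<phi> (concat ps @ (p1 @ c # v1)) l"
      by (simp add: l1_def)
    have "set (v1 @ c' # v2) \<subseteq> S" using S *(1) by (metis set_append Un_least)
    then have "deep \<phi> (length ps) (c' # visits V \<phi> v1 (visit V \<phi> c l1))"
      unfolding eq using snoc.IH[of "p1 @ c # v1" c'] S snoc.prems(3) *(2) eq by simp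
    then show ?thesis using * by (auto simp: adjacent_def)
  qed
  then show ?case unfolding L by auto
qed simp

section \<open>Stability of an answered variable\<close>

lemma near_step:
  "near \<phi> r x c \<Longrightarrow> y \<in> clause_vars (\<phi> ! c) \<Longrightarrow> c' < length \<phi> \<Longrightarrow> y \<in> clause_vars (\<phi> ! c') \<Longrightarrow>
    near \<phi> (Suc r) x c'"
proof (induction r arbitrary: x)
  case (Suc r)
  then obtain c0 u where "c0 < length \<phi>" "x \<in> clause_vars (\<phi> ! c0)" "u \<in> clause_vars (\<phi> ! c0)" "near \<phi> r u c"
    by auto
  then show ?case using Suc.IH[of u] Suc.prems by (subst near.simps) blast
qed auto

text \<open>As everything at distance below \<open>R\<close> is satisfied in \<open>l\<close>, a
  later violation at distance \<open>r\<close> has a cause among the visits after \<open>l\<close>,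
  and conflicting clauses share a variable, so it lies at distance \<open>Suc r\<close>. The chain
  goes outwards until distance \<open>R\<close>, where nothing is known.\<close>

lemma deep_if_near:
  assumes sat: "\<And>r c. r < R \<Longrightarrow> near \<phi> r x c \<Longrightarrow> \<not> violated V \<phi> (resamplings \<phi> l) c"
    and "r \<le> R" "near \<phi> r x c" "set vs \<subseteq> {..<length \<phi>}"
    "violated V \<phi> (resamplings \<phi> (visits V \<phi> vs l)) c"
  shows "deep \<phi> (R - r) (c # visits V \<phi> vs l)"
  using assms(2-)
proof (induction "R - r" arbitrary: r c vs)
  case (Suc i)
  then have r: "r < R" "i = R - Suc r" "R - r = Suc i" by auto
  obtain v1 c' v2 ev where *: "vs = v1 @ c' # v2"
      "violated V \<phi> (resamplings \<phi> (visits V \<phi> v1 l)) c'"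
      "conflict \<phi> c' c" "visits V \<phi> vs l = ev @ c' # visits V \<phi> v1 l"
    using newly_violated_visits[OF sat[OF r(1) Suc.prems(2)] Suc.prems(4)] .
  obtain y where "y \<in> clause_vars (\<phi> ! c)" "y \<in> clause_vars (\<phi> ! c')"
    using *(3) by (auto simp: conflict_def clause_vars_iff)
  then have "near \<phi> (Suc r) x c'"
    using near_step[OF Suc.prems(2), of y c'] *(1) Suc.prems(3) by auto
  then have "deep \<phi> i (c' # visits V \<phi> v1 l)"
    using Suc.hyps(1)[OF r(2)] r *(1,2) Suc.prems(3) by auto
  then show ?case unfolding r(3) *(4) using *(3) by (auto simp: adjacent_def)
qed simp

text \<open>A change of \<open>x\<close> would resample a clause at distance 0, whose chain has all
  \<open>R\<close> links.\<close>

lemma resamplings_stable: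
  assumes sat: "\<And>r c. r < R \<Longrightarrow> near \<phi> r x c \<Longrightarrow> \<not> violated V \<phi> (resamplings \<phi> l) c"
    and valid: "valid_log V \<phi> l"
    and shallow: "\<And>c l. x \<in> clause_vars (\<phi> ! c) \<Longrightarrow> valid_log V \<phi> (c # l) \<Longrightarrow> \<not> deep \<phi> R (c # l)"
  shows "set vs \<subseteq> {..<length \<phi>} \<Longrightarrow> resamplings \<phi> (visits V \<phi> vs l) x = resamplings \<phi> l x"
proof (induction vs rule: rev_induct)
  case (snoc v vs)
  have "\<not> (x \<in> clause_vars (\<phi> ! v) \<and> violated V \<phi> (resamplings \<phi> (visits V \<phi> vs l)) v)"
  proof
    assume *: "x \<in> clause_vars (\<phi> ! v) \<and> violated V \<phi> (resamplings \<phi> (visits V \<phi> vs l)) v"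
    have "near \<phi> 0 x v" using * snoc.prems by simp
    then have "deep \<phi> (R - 0) (v # visits V \<phi> vs l)"
      using * snoc.prems by (intro deep_if_near[OF sat]) auto
    moreover have "valid_log V \<phi> (v # visits V \<phi> vs l)"
      using * snoc.prems valid_log_visits[OF valid, of vs] by simp
    ultimately show False using shallow[of v "visits V \<phi> vs l"] * by simp
  qed
  then have "resamplings \<phi> (visit V \<phi> v (visits V \<phi> vs l)) x = resamplings \<phi> (visits V \<phi> vs l) x"
    unfolding visit_def[of V \<phi> v] by (auto simp del: fold_simps)
  then show ?case using snoc by simp
qed simp

section \<open>Enumeration of walks and the abstract algorithm\<close>

definition step_clause :: "(nat \<Rightarrow> nat list) \<Rightarrow> nat \<Rightarrow> nat \<Rightarrow> nat \<Rightarrow> nat \<Rightarrow> nat" where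
  "step_clause occs d k w y = occs y ! min (w mod (d * k) mod d) (length (occs y) - 1)"

text \<open>The digits of \<open>w\<close> to base \<open>d * k\<close> encode a walk in the formula: each digit selects a clause of the
  current variable and then a literal of this clause, whose variable is the next one. A clause number beyond
  the end of the list is read as the last one.\<close>

fun walk :: "(nat \<Rightarrow> nat list) \<Rightarrow> cnf \<Rightarrow> nat \<Rightarrow> nat \<Rightarrow> nat \<Rightarrow> nat \<Rightarrow> nat \<Rightarrow> nat list" where
  "walk occs \<phi> d k 0 w y = []"
| "walk occs \<phi> d k (Suc r) w y = step_clause occs d k w y #
    walk occs \<phi> d k r (w div (d * k)) (fst (\<phi> ! step_clause occs d k w y ! (w mod (d * k) div d)))"

text \<open>Decreasing order of walk numbers, because the loops of the program count down.\<close>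

definition explore :: "(nat \<Rightarrow> nat list) \<Rightarrow> cnf \<Rightarrow> nat \<Rightarrow> nat \<Rightarrow> nat \<Rightarrow> nat \<Rightarrow> nat list" where
  "explore occs \<phi> d k R x = concat (map (\<lambda>w. walk occs \<phi> d k R w x) (rev [0..<(d * k) ^ R]))"

text \<open>A variable without occurrences has no clause to start from and no cell for a counter; it
  is treated separately here and answered by false in \<open>serve\<close>.\<close>

definition query :: "(nat \<Rightarrow> nat \<Rightarrow> bool) \<Rightarrow> (nat \<Rightarrow> nat list) \<Rightarrow> cnf \<Rightarrow> nat \<Rightarrow> nat \<Rightarrow> nat \<Rightarrow> nat \<Rightarrow> nat \<Rightarrow> nat list \<Rightarrow> nat list" where
  "query V occs \<phi> d k R J x l =
    (if occs x = [] then l else visits V \<phi> (concat (replicate J (explore occs \<phi> d k R x))) l)"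

fun serve :: "(nat \<Rightarrow> nat \<Rightarrow> bool) \<Rightarrow> (nat \<Rightarrow> nat list) \<Rightarrow> cnf \<Rightarrow> nat \<Rightarrow> nat \<Rightarrow> nat \<Rightarrow> nat \<Rightarrow> nat list \<Rightarrow> nat list \<Rightarrow> bool list" where
  "serve V occs \<phi> d k R J [] l = []"
| "serve V occs \<phi> d k R J (x # xs) l =
    (occs x \<noteq> [] \<and> V x (resamplings \<phi> (query V occs \<phi> d k R J x l) x)) #
    serve V occs \<phi> d k R J xs (query V occs \<phi> d k R J x l)"

locale occurrence_lists =
  fixes k d n :: nat and \<phi> :: cnf and occs :: "nat \<Rightarrow> nat list"
  assumes kcnf: "kcnf k n \<phi>" and k: "0 < k" and d: "0 < d"
    and set_occs: "x < n \<Longrightarrow> set (occs x) = occurrences \<phi> x"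
    and length_occs: "x < n \<Longrightarrow> length (occs x) \<le> d"
begin

lemma occs_nonempty: "c < length \<phi> \<Longrightarrow> y \<in> clause_vars (\<phi> ! c) \<Longrightarrow> y < n \<and> occs y \<noteq> []"
proof -
  assume *: "c < length \<phi>" "y \<in> clause_vars (\<phi> ! c)"
  then have y: "y < n" using kcnf by (force simp: kcnf_def)
  have "c \<in> set (occs y)" using * set_occs[OF y] by (simp add: occurrences_def)
  then show ?thesis using y by auto
qed

lemma step_clause_occurrence:
  assumes "x < n" "occs x \<noteq> []"
  shows "step_clause occs d k w x < length \<phi>" "x \<in> clause_vars (\<phi> ! step_clause occs d k w x)"
proof -
  have "step_clause occs d k w x \<in> set (occs x)"
    using assms(2) unfolding step_clause_def
    by (intro nth_mem) (simp add: min_less_iff_disj)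
  then show "step_clause occs d k w x < length \<phi>" "x \<in> clause_vars (\<phi> ! step_clause occs d k w x)"
    using set_occs[OF assms(1)] by (auto simp: occurrences_def)
qed

lemma digit_less: "w mod (d * k) div d < k"
proof -
  have "w mod (d * k) < d * k" using k d by simp
  then show ?thesis by (simp add: less_mult_imp_div_less mult.commute)
qed

lemma step_variable:
  assumes "c < length \<phi>" "j < k" shows "fst (\<phi> ! c ! j) < n" "occs (fst (\<phi> ! c ! j)) \<noteq> []"
proof -
  have "length (\<phi> ! c) = k" using kcnf assms(1) by (simp add: kcnf_def)
  then have "fst (\<phi> ! c ! j) \<in> clause_vars (\<phi> ! c)" using assms(2) by (simp add: clause_vars_def)
  then show "fst (\<phi> ! c ! j) < n" "occs (fst (\<phi> ! c ! j)) \<noteq> []"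
    using occs_nonempty[OF assms(1)] by auto
qed

lemma set_walk: "x < n \<Longrightarrow> occs x \<noteq> [] \<Longrightarrow> set (walk occs \<phi> d k R w x) \<subseteq> {..<length \<phi>}"
proof (induction R arbitrary: w x)
  case (Suc R)
  note c = step_clause_occurrence[OF Suc.prems]
  show ?case using c Suc.IH[OF step_variable[OF c(1) digit_less]] by simp
qed simp

text \<open>The least significant digit is the first step, so a walk from the next variable is
  extended by multiplying its number by \<open>d * k\<close> and adding a digit.\<close>

lemma near_walk:
  "near \<phi> r x c \<Longrightarrow> r < R \<Longrightarrow> \<exists>w<(d * k) ^ R. c \<in> set (walk occs \<phi> d k R w x)"
proof (induction r arbitrary: x R)
  case 0
  then obtain R' where R: "R = Suc R'" by (cases R) auto
  have x: "x < n" "c \<in> set (occs x)"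
    using 0 occs_nonempty[of c x] set_occs[of x] by (auto simp: occurrences_def)
  then obtain i where i: "i < length (occs x)" "occs x ! i = c" by (auto simp: in_set_conv_nth)
  then have "i < d" using length_occs[OF x(1)] by simp
  moreover have "d * 1 \<le> d * k" using k by (intro mult_le_mono) auto
  ultimately have id: "i < d" "i < d * k" by linarith+
  then have "step_clause occs d k i x = c" using i by (simp add: step_clause_def)
  moreover have "d * k * 1 \<le> d * k * (d * k) ^ R'" using k d by (intro mult_le_mono) auto
  ultimately show ?case using id(2) R by (intro exI[of _ i]) (simp add: order_less_le_trans)
next
  case (Suc r)
  then obtain R' where R: "R = Suc R'" "r < R'" by (cases R) auto
  from Suc.prems obtain c0 y where c0: "c0 < length \<phi>" "x \<in> clause_vars (\<phi> ! c0)"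
    "y \<in> clause_vars (\<phi> ! c0)" "near \<phi> r y c" by auto
  obtain w where w: "w < (d * k) ^ R'" "c \<in> set (walk occs \<phi> d k R' w y)"
    using Suc.IH[OF c0(4) R(2)] by blast
  have x: "x < n" "c0 \<in> set (occs x)"
    using c0 occs_nonempty[of c0 x] set_occs[of x] by (auto simp: occurrences_def)
  then obtain i where i: "i < length (occs x)" "occs x ! i = c0" by (auto simp: in_set_conv_nth)
  then have id: "i < d" using length_occs[OF x(1)] by simp
  have "length (\<phi> ! c0) = k" using kcnf c0(1) by (simp add: kcnf_def)
  then obtain j where j: "j < k" "fst (\<phi> ! c0 ! j) = y"
    using c0(3) by (force simp: clause_vars_def in_set_conv_nth)
  \<comment> \<open>The digit that selects clause \<open>i\<close> by its remainder and literal
    \<open>j\<close> by its quotient modulo \<open>d\<close>.\<close>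
  define e where "e = i + d * j"
  have "e < d + d * j" using id by (simp add: e_def)
  also have "\<dots> \<le> d * k" using j mult_le_mono2[of "Suc j" k d] by simp
  finally have e: "e < d * k" .
  define w' where "w' = e + d * k * w"
  have w': "w' mod (d * k) = e" "w' div (d * k) = w" using e k d by (simp_all add: w'_def)
  have ed: "e mod d = i" "e div d = j" using id by (simp_all add: e_def)
  have "step_clause occs d k w' x = c0" using i by (simp add: step_clause_def w' ed)
  then have "c \<in> set (walk occs \<phi> d k R w' x)" using w(2) by (simp add: R w' ed j)
  moreover have "w' < (d * k) ^ R"
  proof -
    have "w' < d * k + d * k * w" using e by (simp add: w'_def)
    also have "\<dots> \<le> d * k * (d * k) ^ R'" using w(1) mult_le_mono2[of "Suc w" "(d * k) ^ R'" "d * k"] by simp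
    finally show ?thesis by (simp add: R)
  qed
  ultimately show ?case by blast
qed

lemma set_explore: "x < n \<Longrightarrow> occs x \<noteq> [] \<Longrightarrow> set (explore occs \<phi> d k R x) \<subseteq> {..<length \<phi>}"
  using set_walk by (auto simp: explore_def)

lemma near_explore: "near \<phi> r x c \<Longrightarrow> r < R \<Longrightarrow> c \<in> set (explore occs \<phi> d k R x)"
  using near_walk by (fastforce simp: explore_def)

lemma query_visits:
  assumes "x < n" obtains vs where "set vs \<subseteq> {..<length \<phi>}"
    "\<And>l. query V occs \<phi> d k R J x l = visits V \<phi> vs l"
proof (cases "occs x = []")
  case True then show ?thesis using that[of "[]"] by (simp add: query_def)
next
  case False
  have "set (concat (replicate J (explore occs \<phi> d k R x))) \<subseteq> {..<length \<phi>}"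
    using set_explore[OF assms False, of R] by auto
  then show ?thesis using False by (intro that) (auto simp: query_def)
qed

text \<open>After a query the first hypothesis leaves no violated clause in the ball, so the answer
  survives whatever is visited later. Quantifying over all continuations \<open>us\<close> covers
  the later queries and also the completion to a full assignment.\<close>

lemma serve_stable:
  assumes good: "\<forall>l. valid_log V \<phi> l \<longrightarrow> \<not> deep \<phi> J l"
    and "\<forall>x\<in>set xs. \<forall>c l. x \<in> clause_vars (\<phi> ! c) \<longrightarrow> valid_log V \<phi> (c # l) \<longrightarrow> \<not> deep \<phi> R (c # l)"
    and "set xs \<subseteq> {..<n}" "valid_log V \<phi> l"
  shows "\<exists>vs. set vs \<subseteq> {..<length \<phi>} \<and> (\<forall>us. set us \<subseteq> {..<length \<phi>} \<longrightarrow>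
    serve V occs \<phi> d k R J xs l =
      map (\<lambda>x. occs x \<noteq> [] \<and> V x (resamplings \<phi> (visits V \<phi> (vs @ us) l) x)) xs)"
  using assms(2-)
proof (induction xs arbitrary: l)
  case Nil show ?case by (rule exI[of _ "[]"]) simp
next
  case (Cons x xs)
  then have x: "x < n" by simp
  obtain vx where vx: "set vx \<subseteq> {..<length \<phi>}" "\<And>l. query V occs \<phi> d k R J x l = visits V \<phi> vx l"
    using query_visits[OF x] by blast
  define l1 where "l1 = visits V \<phi> vx l"
  have l1: "valid_log V \<phi> l1" unfolding l1_def by (rule valid_log_visits[OF Cons.prems(3) vx(1)])
  obtain vs where vs: "set vs \<subseteq> {..<length \<phi>}" "\<And>us. set us \<subseteq> {..<length \<phi>} \<Longrightarrow>
    serve V occs \<phi> d k R J xs l1 =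
      map (\<lambda>x. occs x \<noteq> [] \<and> V x (resamplings \<phi> (visits V \<phi> (vs @ us) l1) x)) xs"
  proof -
    have "set xs \<subseteq> {..<n}" "\<forall>x\<in>set xs. \<forall>c l. x \<in> clause_vars (\<phi> ! c) \<longrightarrow>
        valid_log V \<phi> (c # l) \<longrightarrow> \<not> deep \<phi> R (c # l)"
      using Cons.prems(1,2) by auto
    from Cons.IH[OF this(2,1) l1] show ?thesis using that by blast
  qed
  have stable: "resamplings \<phi> (visits V \<phi> us l1) x = resamplings \<phi> l1 x"
    if "occs x \<noteq> []" "set us \<subseteq> {..<length \<phi>}" for us
  proof (rule resamplings_stable[OF _ l1 _ that(2)])
    fix r c assume r: "r < R" "near \<phi> r x c"
    let ?E = "explore occs \<phi> d k R x"
    have l1': "l1 = visits V \<phi> (concat (replicate J ?E) @ []) l"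
      using vx(2)[of l] that(1) by (simp add: l1_def query_def)
    have c: "c \<in> set ?E" using near_explore r by blast
    show "\<not> violated V \<phi> (resamplings \<phi> l1) c"
    proof
      assume viol: "violated V \<phi> (resamplings \<phi> l1) c"
      have "deep \<phi> (length (replicate J ?E)) (c # visits V \<phi> (concat (replicate J ?E) @ []) l)"
        using viol c l1' by (intro deep_after_passes[where S = "set ?E"]) auto
      then have "deep \<phi> J (c # l1)" by (simp add: l1')
      moreover have "valid_log V \<phi> (c # l1)"
        using viol l1 c set_explore[OF x that(1)] by auto
      ultimately show False using good by blast
    qed
  next
    show "\<And>c l. x \<in> clause_vars (\<phi> ! c) \<Longrightarrow> valid_log V \<phi> (c # l) \<Longrightarrow> \<not> deep \<phi> R (c # l)"
      using Cons.prems(1) by simp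
  qed
  show ?case
  proof (rule exI[of _ "vx @ vs"], intro conjI allI impI)
    show "set (vx @ vs) \<subseteq> {..<length \<phi>}" using vx vs by simp
    fix us assume us: "set us \<subseteq> {..<length \<phi>}"
    have "visits V \<phi> ((vx @ vs) @ us) l = visits V \<phi> (vs @ us) l1" by (simp add: l1_def)
    moreover have "resamplings \<phi> (visits V \<phi> (vs @ us) l1) x = resamplings \<phi> l1 x" if "occs x \<noteq> []"
      using stable[OF that, of "vs @ us"] us vs(1) by simp
    ultimately show "serve V occs \<phi> d k R J (x # xs) l =
      map (\<lambda>x. occs x \<noteq> [] \<and> V x (resamplings \<phi> (visits V \<phi> ((vx @ vs) @ us) l) x)) (x # xs)"
      using vs(2)[OF us] vx(2)[of l] by (auto simp: l1_def)
  qed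
qed

text \<open>The completion consists of \<open>J\<close> fictitious passes over the whole formula: a
  clause still violated after them would have a chain with \<open>J\<close> links. They are part of
  the analysis only and cost no time.\<close>

lemma serve_satisfying:
  assumes good: "\<forall>l. valid_log V \<phi> l \<longrightarrow> \<not> deep \<phi> J l"
    and "\<forall>x\<in>set xs. \<forall>c l. x \<in> clause_vars (\<phi> ! c) \<longrightarrow> valid_log V \<phi> (c # l) \<longrightarrow> \<not> deep \<phi> R (c # l)"
    and "set xs \<subseteq> {..<n}"
  shows "\<exists>\<sigma>. satisfies \<sigma> \<phi> \<and> serve V occs \<phi> d k R J xs [] = map \<sigma> xs"
proof -
  obtain vs where vs: "set vs \<subseteq> {..<length \<phi>}" "\<And>us. set us \<subseteq> {..<length \<phi>} \<Longrightarrow>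
    serve V occs \<phi> d k R J xs [] =
      map (\<lambda>x. occs x \<noteq> [] \<and> V x (resamplings \<phi> (visits V \<phi> (vs @ us) []) x)) xs"
    using serve_stable[OF assms valid_log.simps(1)[THEN iffD2, OF TrueI]] by blast
  let ?A = "concat (replicate J [0..<length \<phi>])"
  define L where "L = visits V \<phi> (?A @ []) (visits V \<phi> vs [])"
  have A: "set ?A \<subseteq> {..<length \<phi>}" by auto
  have L: "valid_log V \<phi> L" unfolding L_def
    by (intro valid_log_visits) (use A vs(1) in auto)
  define \<sigma> where "\<sigma> = (\<lambda>x. occs x \<noteq> [] \<and> V x (resamplings \<phi> L x))"
  have "\<not> violated V \<phi> (resamplings \<phi> L) c" if c: "c < length \<phi>" for c
  proof
    assume viol: "violated V \<phi> (resamplings \<phi> L) c"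
    have "deep \<phi> (length (replicate J [0..<length \<phi>])) (c # L)"
      unfolding L_def using viol c by (intro deep_after_passes[where S = "{..<length \<phi>}"]) (auto simp: L_def)
    moreover have "valid_log V \<phi> (c # L)" using viol c L by simp
    ultimately show False using good by simp
  qed
  then have "\<exists>(x, b)\<in>set C. \<sigma> x = b" if C: "C \<in> set \<phi>" for C
  proof -
    obtain c where c: "c < length \<phi>" "C = \<phi> ! c" using C by (auto simp: in_set_conv_nth)
    then obtain x b where xb: "(x, b) \<in> set C" "V x (resamplings \<phi> L x) = b"
      using \<open>\<And>c. c < length \<phi> \<Longrightarrow> \<not> violated V \<phi> (resamplings \<phi> L) c\<close>[OF c(1)] by (auto simp: violated_def)
    then have "occs x \<noteq> []" using occs_nonempty[OF c(1), of x] c(2) by (auto simp: clause_vars_iff)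
    then show ?thesis using xb by (auto simp: \<sigma>_def)
  qed
  then have "satisfies \<sigma> \<phi>" by (simp add: satisfies_def)
  moreover have "serve V occs \<phi> d k R J xs [] = map \<sigma> xs"
    using vs(2)[OF A] by (simp add: \<sigma>_def L_def)
  ultimately show ?thesis by blast
qed

end

section \<open>A program logic for the word RAM\<close>

notation Seq (infixr ";;" 60)

definition list_loop :: "reg \<Rightarrow> reg \<Rightarrow> com \<Rightarrow> com" where
  "list_loop p q body = While (Reg p) (body ;; Arith q Add (Reg p) (Const 1) ;; ReadInput p (Reg q))"

text \<open>The counter is decremented before the body, which thus sees the values from one below
  the initial value down to 0.\<close>

definition for_loop :: "reg \<Rightarrow> com \<Rightarrow> com" where
  "for_loop r body = While (Reg r) (Arith r Sub (Reg r) (Const 1) ;; body)"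

fun writes :: "com \<Rightarrow> reg set" where
  "writes Skip = {}"
| "writes (Arith r f a b) = {r}"
| "writes (Load r a) = {r}"
| "writes (Store a b) = {}"
| "writes (ReadInput r a) = {r}"
| "writes (ReadRandom r a) = {r}"
| "writes (Seq c c') = writes c \<union> writes c'"
| "writes (If a c c') = writes c \<union> writes c'"
| "writes (While a c) = writes c"

lemma exec_frame: "exec W S inp \<omega> c s t s' \<Longrightarrow> r \<notin> writes c \<Longrightarrow> fst s' r = fst s r"
  by (induction rule: exec.induct) auto

lemma writes_loops [simp]:
  "writes (list_loop p q c) = insert p (insert q (writes c))"
  "writes (for_loop r c) = insert r (writes c)"
  by (auto simp: list_loop_def for_loop_def)

locale word_ram =
  fixes W S :: nat and inp :: "nat list" and \<omega> :: random_tape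
begin

text \<open>Total correctness with the number of steps as an argument of the postcondition, so that
  time bounds are proved together with results.\<close>

definition wp :: "com \<Rightarrow> (nat \<Rightarrow> regs \<times> memory \<Rightarrow> bool) \<Rightarrow> regs \<times> memory \<Rightarrow> bool" where
  "wp c Q s \<longleftrightarrow> (\<exists>t s'. exec W S inp \<omega> c s t s' \<and> Q t s')"

lemma wpI: "exec W S inp \<omega> c s t s' \<Longrightarrow> Q t s' \<Longrightarrow> wp c Q s"
  unfolding wp_def by blast

lemma wp_Skip [simp]: "wp Skip Q (\<rho>, \<mu>) \<longleftrightarrow> Q 1 (\<rho>, \<mu>)"
  by (rule iffI) (auto simp: wp_def elim: exec_SkipE intro!: exI exec.Skip)

lemma wp_Arith [simp]:
  "wp (Arith r f a b) Q (\<rho>, \<mu>) \<longleftrightarrow> Q 1 (\<rho>(r := arith_op f (val W \<rho> a) (val W \<rho> b) mod W), \<mu>)"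
  by (rule iffI, force simp: wp_def elim: exec_ArithE, erule wpI[OF exec.Arith])

lemma wp_Load [simp]:
  "wp (Load r a) Q (\<rho>, \<mu>) \<longleftrightarrow> val W \<rho> a < S \<and> Q 1 (\<rho>(r := \<mu> (val W \<rho> a)), \<mu>)"
  by (rule iffI, force simp: wp_def elim: exec_LoadE, elim conjE, erule wpI[OF exec.Load])

lemma wp_Store [simp]:
  "wp (Store a b) Q (\<rho>, \<mu>) \<longleftrightarrow> val W \<rho> a < S \<and> Q 1 (\<rho>, \<mu>(val W \<rho> a := val W \<rho> b))"
  by (rule iffI, force simp: wp_def elim: exec_StoreE, elim conjE, erule wpI[OF exec.Store])

lemma wp_ReadInput [simp]:
  "wp (ReadInput r a) Q (\<rho>, \<mu>) \<longleftrightarrow>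
    Q 1 (\<rho>(r := (if val W \<rho> a < length inp then inp ! val W \<rho> a mod W else 0)), \<mu>)"
  by (rule iffI, force simp: wp_def elim: exec_ReadInputE split del: if_split, erule wpI[OF exec.ReadInput])

lemma wp_ReadRandom [simp]:
  "wp (ReadRandom r a) Q (\<rho>, \<mu>) \<longleftrightarrow> Q 1 (\<rho>(r := of_bool (\<omega> (val W \<rho> a)) mod W), \<mu>)"
  by (rule iffI, force simp: wp_def elim: exec_ReadRandomE, erule wpI[OF exec.ReadRandom])

lemma wp_Seq [simp]: "wp (c ;; c') Q s \<longleftrightarrow> wp c (\<lambda>t. wp c' (\<lambda>t'. Q (t + t'))) s"
proof
  assume "wp (c ;; c') Q s"
  then obtain t s' where *: "exec W S inp \<omega> (c ;; c') s t s'" "Q t s'" by (auto simp: wp_def)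
  from *(1) show "wp c (\<lambda>t. wp c' (\<lambda>t'. Q (t + t'))) s"
    by (rule exec_SeqE) (use *(2) in \<open>auto intro!: wpI\<close>)
next
  assume "wp c (\<lambda>t. wp c' (\<lambda>t'. Q (t + t'))) s"
  then obtain t s' t' s'' where "exec W S inp \<omega> c s t s'" "exec W S inp \<omega> c' s' t' s''" "Q (t + t') s''"
    by (auto simp: wp_def)
  then show "wp (c ;; c') Q s" by (blast intro: wpI exec.Seq)
qed

lemma wp_If [simp]:
  "wp (If a c c') Q (\<rho>, \<mu>) \<longleftrightarrow>
    (if val W \<rho> a \<noteq> 0 then wp c (\<lambda>t. Q (1 + t)) (\<rho>, \<mu>) else wp c' (\<lambda>t. Q (1 + t)) (\<rho>, \<mu>))"
proof
  assume "wp (If a c c') Q (\<rho>, \<mu>)"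
  then obtain t s' where *: "exec W S inp \<omega> (If a c c') (\<rho>, \<mu>) t s'" "Q t s'" by (auto simp: wp_def)
  from *(1) show "if val W \<rho> a \<noteq> 0 then wp c (\<lambda>t. Q (1 + t)) (\<rho>, \<mu>) else wp c' (\<lambda>t. Q (1 + t)) (\<rho>, \<mu>)"
    by (rule exec_IfE) (use *(2) in \<open>auto intro!: wpI\<close>)
next
  assume *: "if val W \<rho> a \<noteq> 0 then wp c (\<lambda>t. Q (1 + t)) (\<rho>, \<mu>) else wp c' (\<lambda>t. Q (1 + t)) (\<rho>, \<mu>)"
  show "wp (If a c c') Q (\<rho>, \<mu>)"
  proof (cases "val W \<rho> a = 0")
    case True
    then obtain t s' where "exec W S inp \<omega> c' (\<rho>, \<mu>) t s'" "Q (1 + t) s'" using * by (auto simp: wp_def)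
    with exec.IfFalse[of W "(\<rho>, \<mu>)" a S inp \<omega> c' t s' c] True show ?thesis by (auto intro: wpI)
  next
    case False
    then obtain t s' where "exec W S inp \<omega> c (\<rho>, \<mu>) t s'" "Q (1 + t) s'" using * by (auto simp: wp_def)
    with exec.IfTrue[of W "(\<rho>, \<mu>)" a S inp \<omega> c t s' c'] False show ?thesis by (auto intro: wpI)
  qed
qed

lemma wp_While:
  "wp (While a c) Q (\<rho>, \<mu>) \<longleftrightarrow>
    (if val W \<rho> a = 0 then Q 1 (\<rho>, \<mu>) else wp c (\<lambda>t. wp (While a c) (\<lambda>t'. Q (1 + t + t'))) (\<rho>, \<mu>))"
  (is "?L \<longleftrightarrow> ?R")
proof
  assume ?L
  then obtain t s' where *: "exec W S inp \<omega> (While a c) (\<rho>, \<mu>) t s'" "Q t s'" by (auto simp: wp_def)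
  from *(1) show ?R
    by (rule exec_WhileE) (use *(2) in \<open>auto intro!: wpI\<close>)
next
  assume R: ?R
  show ?L
  proof (cases "val W \<rho> a = 0")
    case True
    then show ?thesis using R exec.WhileFalse[of W "(\<rho>, \<mu>)" a S inp \<omega> c] by (auto intro: wpI)
  next
    case False
    then obtain t s1 t' s2 where "exec W S inp \<omega> c (\<rho>, \<mu>) t s1" "exec W S inp \<omega> (While a c) s1 t' s2"
      "Q (1 + t + t') s2" using R by (auto simp: wp_def)
    with exec.WhileTrue[of W "(\<rho>, \<mu>)" a S inp \<omega> c t s1 t' s2] False show ?thesis by (auto intro: wpI)
  qed
qed

lemma wp_mono: "wp c Q s \<Longrightarrow> (\<And>t \<rho> \<mu>. Q t (\<rho>, \<mu>) \<Longrightarrow> Q' t (\<rho>, \<mu>)) \<Longrightarrow> wp c Q' s"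
  unfolding wp_def by (metis surj_pair)

text \<open>A frame rule: registers that \<open>c\<close> does not write need not be mentioned in
  its specification.\<close>

lemma wp_use:
  assumes "wp c Q (\<rho>, \<mu>)"
    and "\<And>t \<rho>' \<mu>'. Q t (\<rho>', \<mu>') \<Longrightarrow> (\<And>r. r \<notin> writes c \<Longrightarrow> \<rho>' r = \<rho> r) \<Longrightarrow> Q' t (\<rho>', \<mu>')"
  shows "wp c Q' (\<rho>, \<mu>)"
proof -
  obtain t \<rho>' \<mu>' where *: "exec W S inp \<omega> c (\<rho>, \<mu>) t (\<rho>', \<mu>')" "Q t (\<rho>', \<mu>')"
    using assms(1) by (auto simp: wp_def)
  show ?thesis unfolding wp_def using * assms(2)[OF *(2)] exec_frame[OF *(1)] by auto
qed

text \<open>\<open>I w\<close> is the invariant with \<open>w\<close> iterations left. The 2 pays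
  for the test and the decrement of each iteration, the 1 for the final test.\<close>

lemma wp_for_loop:
  assumes step: "\<And>w \<rho> \<mu>. w < N \<Longrightarrow> I (Suc w) \<rho> \<mu> \<Longrightarrow> \<rho> r = w \<Longrightarrow>
      wp body (\<lambda>t (\<rho>', \<mu>'). t \<le> T \<and> \<rho>' r = w \<and> I w \<rho>' \<mu>') (\<rho>, \<mu>)"
    and upd: "\<And>w \<rho> \<mu> a. I w (\<rho>(r := a)) \<mu> = I w \<rho> \<mu>"
    and N: "N < W" and W: "1 < W"
  shows "I N \<rho> \<mu> \<Longrightarrow> \<rho> r = N \<Longrightarrow>
    wp (for_loop r body) (\<lambda>t (\<rho>', \<mu>'). t \<le> 1 + N * (T + 2) \<and> \<rho>' r = 0 \<and> I 0 \<rho>' \<mu>') (\<rho>, \<mu>)"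
  using step N
proof (induction N arbitrary: \<rho> \<mu>)
  case 0
  then show ?case unfolding for_loop_def by (subst wp_While) simp
next
  case (Suc N)
  let ?\<rho> = "\<rho>(r := N)"
  have "wp body (\<lambda>t (\<rho>', \<mu>'). t \<le> T \<and> \<rho>' r = N \<and> I N \<rho>' \<mu>') (?\<rho>, \<mu>)"
    using Suc.prems(1) by (intro Suc.prems(3)) (simp_all only: upd lessI fun_upd_same)
  then have "wp body (\<lambda>t. wp (for_loop r body) (\<lambda>t' (\<rho>', \<mu>'). 1 + (1 + t) + t' \<le> 1 + Suc N * (T + 2) \<and> \<rho>' r = 0 \<and> I 0 \<rho>' \<mu>')) (?\<rho>, \<mu>)"
  proof (rule wp_mono)
    fix t \<rho>' \<mu>' assume "case (\<rho>', \<mu>') of (\<rho>', \<mu>') \<Rightarrow> t \<le> T \<and> \<rho>' r = N \<and> I N \<rho>' \<mu>'"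
    then have *: "t \<le> T" "\<rho>' r = N" "I N \<rho>' \<mu>'" by auto
    have "wp (for_loop r body) (\<lambda>t (\<rho>', \<mu>'). t \<le> 1 + N * (T + 2) \<and> \<rho>' r = 0 \<and> I 0 \<rho>' \<mu>') (\<rho>', \<mu>')"
      using Suc.prems(3,4) by (intro Suc.IH *) auto
    then show "wp (for_loop r body) (\<lambda>t' (\<rho>', \<mu>'). 1 + (1 + t) + t' \<le> 1 + Suc N * (T + 2) \<and> \<rho>' r = 0 \<and> I 0 \<rho>' \<mu>') (\<rho>', \<mu>')"
      by (rule wp_mono) (use *(1) in auto)
  qed
  then show ?case using Suc.prems(2,4) W
    unfolding for_loop_def by (subst wp_While) simp
qed

lemma wp_list_loop:
  assumes step: "\<And>i \<rho> \<mu>. i < length vs \<Longrightarrow> I i \<rho> \<mu> \<Longrightarrow> \<rho> p + 1 < length inp \<Longrightarrow> inp ! \<rho> p = vs ! i \<Longrightarrow>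
      wp body (\<lambda>t (\<rho>', \<mu>'). t \<le> T \<and> \<rho>' p = \<rho> p \<and> I (Suc i) \<rho>' \<mu>') (\<rho>, \<mu>)"
    and upd: "\<And>i \<rho> \<mu> a b. I i (\<rho>(q := a, p := b)) \<mu> = I i \<rho> \<mu>"
    and W: "length inp < W" "1 < W" and pq: "p \<noteq> q"
  shows "linked_list inp (\<rho> p) vs \<Longrightarrow> I 0 \<rho> \<mu> \<Longrightarrow>
    wp (list_loop p q body) (\<lambda>t (\<rho>', \<mu>'). t \<le> 1 + length vs * (T + 3) \<and> I (length vs) \<rho>' \<mu>') (\<rho>, \<mu>)"
proof -
  have head: "vs = [] \<and> p = 0 \<or> (\<exists>v vs'. vs = v # vs' \<and> p \<noteq> 0 \<and> p + 1 < length inp \<and> inp ! p = v)"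
    if "linked_list inp p vs" for p and vs :: "nat list" using that by (cases vs) auto
  have main: "wp (list_loop p q body) (\<lambda>t (\<rho>', \<mu>'). t \<le> 1 + length (drop i vs) * (T + 3) \<and> I (length vs) \<rho>' \<mu>') (\<rho>, \<mu>)"
    if "linked_list inp (\<rho> p) (drop i vs)" "I i \<rho> \<mu>" "i \<le> length vs" for i \<rho> \<mu>
    using that
  proof (induction "length vs - i" arbitrary: i \<rho> \<mu>)
    case 0
    then show ?case unfolding list_loop_def by (subst wp_While) simp
  next
    case (Suc j)
    then have i: "i < length vs" "j = length vs - Suc i" by auto
    have ll: "\<rho> p \<noteq> 0" "\<rho> p + 1 < length inp" "inp ! \<rho> p = vs ! i"
        "linked_list inp (inp ! (\<rho> p + 1)) (drop (Suc i) vs)"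
      using Suc.prems(1) by (auto simp: Cons_nth_drop_Suc[OF i(1), symmetric])
    have next_less: "inp ! (\<rho> p + 1) < W" using head[OF ll(4)] W by auto
    have "wp body (\<lambda>t (\<rho>', \<mu>'). t \<le> T \<and> \<rho>' p = \<rho> p \<and> I (Suc i) \<rho>' \<mu>') (\<rho>, \<mu>)"
      by (rule step) (use i ll Suc.prems in auto)
    then have "wp body (\<lambda>t. wp (Arith q Add (Reg p) (Const 1) ;; ReadInput p (Reg q))
       (\<lambda>t'. wp (list_loop p q body) (\<lambda>t'' (\<rho>', \<mu>'). 1 + (t + t') + t'' \<le> 1 + length (drop i vs) * (T + 3) \<and> I (length vs) \<rho>' \<mu>'))) (\<rho>, \<mu>)"
    proof (rule wp_mono)
      fix t \<rho>' \<mu>' assume "case (\<rho>', \<mu>') of (\<rho>', \<mu>') \<Rightarrow> t \<le> T \<and> \<rho>' p = \<rho> p \<and> I (Suc i) \<rho>' \<mu>'"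
      then have *: "t \<le> T" "\<rho>' p = \<rho> p" "I (Suc i) \<rho>' \<mu>'" by auto
      let ?\<rho> = "\<rho>'(q := \<rho> p + 1, p := inp ! (\<rho> p + 1))"
      have "wp (list_loop p q body) (\<lambda>t (\<rho>', \<mu>'). t \<le> 1 + length (drop (Suc i) vs) * (T + 3) \<and> I (length vs) \<rho>' \<mu>') (?\<rho>, \<mu>')"
        using Suc.hyps(1)[OF i(2), of ?\<rho> \<mu>'] ll(4) *(3) i(1) upd by auto
      then have "wp (list_loop p q body) (\<lambda>t'' (\<rho>', \<mu>'). 1 + (t + 2) + t'' \<le> 1 + length (drop i vs) * (T + 3) \<and> I (length vs) \<rho>' \<mu>') (?\<rho>, \<mu>')"
      proof (rule wp_mono)
        fix t'' \<rho>'' \<mu>''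
        assume "case (\<rho>'', \<mu>'') of (\<rho>', \<mu>') \<Rightarrow> t'' \<le> 1 + length (drop (Suc i) vs) * (T + 3) \<and> I (length vs) \<rho>' \<mu>'"
        moreover have "length (drop i vs) = Suc (length (drop (Suc i) vs))" using i(1) by simp
        ultimately show "case (\<rho>'', \<mu>'') of (\<rho>', \<mu>') \<Rightarrow> 1 + (t + 2) + t'' \<le> 1 + length (drop i vs) * (T + 3) \<and> I (length vs) \<rho>' \<mu>'"
          using *(1) by auto
      qed
      then show "wp (Arith q Add (Reg p) (Const 1) ;; ReadInput p (Reg q))
       (\<lambda>t'. wp (list_loop p q body) (\<lambda>t'' (\<rho>', \<mu>'). 1 + (t + t') + t'' \<le> 1 + length (drop i vs) * (T + 3) \<and> I (length vs) \<rho>' \<mu>')) (\<rho>', \<mu>')"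
        using *(2) ll(2) next_less W pq by (simp add: fun_upd_twist)
    qed
    then show ?case using ll(1) unfolding list_loop_def by (subst wp_While) simp
  qed
  show "linked_list inp (\<rho> p) vs \<Longrightarrow> I 0 \<rho> \<mu> \<Longrightarrow> ?thesis"
    using main[where i = 0 and \<rho> = \<rho> and \<mu> = \<mu>] by simp
qed

end

section \<open>Programs\<close>

text \<open>Register 0 holds the query and the answer, 1 the number \<open>n\<close>, 2 the length of the walks, 3 their
  number, 4, 5 and 8 the counters of passes, walks and steps, 6 the current variable, 7 the remaining digits
  of the walk, and 9 the clause to be visited. The subprograms on variables expect their argument in
  register 13; 15 is the cell of this variable, 19 its positive occurrences and then its threshold,
  and 27 its value.\<close>

definition count_positive :: com where
  "count_positive =
    Arith 24 Mul (Reg 13) (Const 2) ;; Arith 24 Add (Reg 24) (Const 1) ;;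
    Arith 19 Mul (Const 0) (Const 0) ;;
    Arith 20 Add (Reg 13) (Const 2) ;; ReadInput 20 (Reg 20) ;;
    list_loop 20 21 (
      ReadInput 16 (Reg 20) ;; Arith 16 Add (Reg 16) (Reg 1) ;; Arith 16 Add (Reg 16) (Const 2) ;;
      ReadInput 16 (Reg 16) ;;
      list_loop 16 17 (
        ReadInput 25 (Reg 16) ;; Arith 26 Sub (Reg 25) (Reg 24) ;; Arith 25 Sub (Reg 24) (Reg 25) ;;
        Arith 25 Add (Reg 25) (Reg 26) ;; If (Reg 25) Skip (Arith 19 Add (Reg 19) (Const 1))))"

definition find_cell :: "nat \<Rightarrow> com" where
  "find_cell k =
    Arith 15 Add (Reg 13) (Const 2) ;; ReadInput 15 (Reg 15) ;; ReadInput 15 (Reg 15) ;;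
    Arith 16 Add (Reg 15) (Reg 1) ;; Arith 16 Add (Reg 16) (Const 2) ;; ReadInput 16 (Reg 16) ;;
    Arith 22 Mul (Reg 15) (Const k) ;;
    list_loop 16 17 (
      ReadInput 25 (Reg 16) ;; Arith 25 Div (Reg 25) (Const 2) ;;
      Arith 26 Sub (Reg 25) (Reg 13) ;; Arith 25 Sub (Reg 13) (Reg 25) ;; Arith 25 Add (Reg 25) (Reg 26) ;;
      If (Reg 25) Skip (Arith 15 Add (Reg 22) (Const 0)) ;; Arith 22 Add (Reg 22) (Const 1))"

definition read_value :: "nat \<Rightarrow> nat \<Rightarrow> nat \<Rightarrow> com" where
  "read_value k d B =
    count_positive ;; find_cell k ;; Load 18 (Reg 15) ;;
    Arith 19 Mul (Reg 19) (Const 2) ;; Arith 19 Sub (Const (d * (k + 1))) (Reg 19) ;;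
    Arith 19 Mul (Const (2 ^ B)) (Reg 19) ;; Arith 19 Div (Reg 19) (Const (2 * d * k)) ;;
    Arith 18 Mul (Reg 18) (Reg 1) ;; Arith 18 Add (Reg 18) (Reg 13) ;; Arith 18 Mul (Reg 18) (Const B) ;;
    Arith 22 Mul (Const 0) (Const 0) ;; Arith 23 Add (Const B) (Const 0) ;;
    for_loop 23 (
      Arith 25 Add (Reg 18) (Reg 23) ;; ReadRandom 25 (Reg 25) ;;
      Arith 22 Mul (Reg 22) (Const 2) ;; Arith 22 Add (Reg 22) (Reg 25)) ;;
    Arith 27 Sub (Reg 19) (Reg 22) ;; If (Reg 27) (Arith 27 Add (Const 1) (Const 0)) Skip"

definition visit_clause :: "nat \<Rightarrow> nat \<Rightarrow> nat \<Rightarrow> com" where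
  "visit_clause k d B =
    Arith 12 Add (Const 1) (Const 0) ;;
    Arith 10 Add (Reg 9) (Reg 1) ;; Arith 10 Add (Reg 10) (Const 2) ;; ReadInput 10 (Reg 10) ;;
    Arith 31 Add (Reg 10) (Const 0) ;;
    list_loop 10 11 (
      ReadInput 13 (Reg 10) ;; Arith 14 Mod (Reg 13) (Const 2) ;; Arith 13 Div (Reg 13) (Const 2) ;;
      read_value k d B ;;
      Arith 25 Sub (Reg 27) (Reg 14) ;; Arith 26 Sub (Reg 14) (Reg 27) ;; Arith 25 Add (Reg 25) (Reg 26) ;;
      If (Reg 25) Skip (Arith 12 Mul (Const 0) (Const 0))) ;;
    If (Reg 12)
      (Arith 10 Add (Reg 31) (Const 0) ;;
       list_loop 10 11 (
         ReadInput 13 (Reg 10) ;; Arith 13 Div (Reg 13) (Const 2) ;; find_cell k ;;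
         Load 18 (Reg 15) ;; Arith 18 Add (Reg 18) (Const 1) ;; Store (Reg 15) (Reg 18)))
      Skip"

definition read_value_time :: "nat \<Rightarrow> nat \<Rightarrow> nat \<Rightarrow> nat" where
  "read_value_time k d B = 40 + d * (9 * k + 8) + 11 * k + 6 * B"

definition visit_clause_time :: "nat \<Rightarrow> nat \<Rightarrow> nat \<Rightarrow> nat" where
  "visit_clause_time k d B = 10 + k * (read_value_time k d B + 11) + k * (11 * k + 20)"

lemma writes_subprograms:
  "writes count_positive = {16, 17, 19, 20, 21, 24, 25, 26}"
  "writes (find_cell k) = {15, 16, 17, 22, 25, 26}"
  "writes (read_value k d B) = {15, 16, 17, 18, 19, 20, 21, 22, 23, 24, 25, 26, 27}"
  "writes (visit_clause k d B) = {10, 11, 12, 13, 14, 15, 16, 17, 18, 19, 20, 21, 22, 23, 24, 25, 26, 27, 31}"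
  unfolding count_positive_def find_cell_def read_value_def visit_clause_def by auto

text \<open>The bounds on \<open>W\<close> keep the intermediate results below \<open>W\<close>, so
  that arithmetic modulo \<open>W\<close> is exact. \<open>maxcount\<close> bounds the length of the
  log, hence the counters and the tape addresses.\<close>

locale machine = word_ram W S inp \<omega> + occurrence_lists k d n \<phi> occs
  for W S :: nat and inp \<omega> and k d n :: nat and \<phi> occs +
  fixes B maxcount :: nat
  assumes input: "input_of inp n \<phi>"
    and max_occurrences: "max_occurrences d n \<phi>"
    and distinct_occs: "x < n \<Longrightarrow> distinct (occs x)"
    and list_occs: "x < n \<Longrightarrow> linked_list inp (inp ! (2 + x)) (occs x)"
    and S: "length \<phi> * k \<le> S"
    and W_inp: "length inp < W" and W_var: "2 * n + 4 < W" and W_cell: "length \<phi> * k + k < W"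
    and W_const: "2 ^ B * (d * (k + 1)) < W" "2 * d * k < W" "B < W" "d + k + 1 < W"
    and W_tape: "(maxcount * n + n) * B + B < W" "(maxcount + 1) * n < W" "maxcount + 1 < W"
begin

text \<open>A variable is identified with its first occurrence, so that cells \<open>0, \<dots>, k * m - 1\<close> suffice.\<close>

definition cell :: "nat \<Rightarrow> nat" where
  "cell x = hd (occs x) * k + (LEAST i. fst (\<phi> ! hd (occs x) ! i) = x)"

definition represents :: "memory \<Rightarrow> nat list \<Rightarrow> bool" where
  "represents \<mu> l \<longleftrightarrow> (\<forall>x<n. occs x \<noteq> [] \<longrightarrow> \<mu> (cell x) = resamplings \<phi> l x)"

abbreviation "V \<equiv> sample k d B n \<phi> \<omega>"

lemma clause_facts:
  assumes "c < length \<phi>"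
  shows "linked_list inp (inp ! (c + n + 2)) (map literal_code (\<phi> ! c))" "c + n + 2 < length inp"
    "length (\<phi> ! c) = k" "distinct (map fst (\<phi> ! c))"
  using input assms kcnf by (auto simp: input_of_def Let_def kcnf_def add.commute add.left_commute)

lemma clause_vars_less: "c < length \<phi> \<Longrightarrow> l \<in> set (\<phi> ! c) \<Longrightarrow> fst l < n"
  using kcnf by (force simp: kcnf_def clause_vars_def)

lemma pointer_less: "linked_list inp p vs \<Longrightarrow> p < W"
  using W_inp by (cases vs) auto

lemma literal_code_less: "c < length \<phi> \<Longrightarrow> l \<in> set (\<phi> ! c) \<Longrightarrow> literal_code l < W"
  using clause_vars_less[of c l] W_var by (simp add: literal_code_def of_bool_def split: if_splits)

lemma var_facts:
  assumes "x < n"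
  shows "linked_list inp (inp ! (x + 2)) (occs x)" "x + 2 < length inp" "\<And>c. c \<in> set (occs x) \<Longrightarrow> c < length \<phi>"
  using input assms list_occs[OF assms] set_occs[OF assms]
  by (auto simp: input_of_def Let_def occurrences_def)

lemma const_bounds:
  "1 < W" "2 < W" "0 < W" "Suc 0 < W" "d < W" "k < W" "d * (k + 1) < W" "2 ^ B < W" "d * k < W"
proof -
  have "1 * (d * (k + 1)) \<le> 2 ^ B * (d * (k + 1))" by (intro mult_le_mono1) simp
  then show "d * (k + 1) < W" using W_const by linarith
  have "2 ^ B * 1 \<le> 2 ^ B * (d * (k + 1))" using d by (intro mult_le_mono2) simp
  then show "2 ^ B < W" using W_const by linarith
  show "1 < W" "2 < W" "0 < W" "Suc 0 < W" "d < W" "k < W" "d * k < W"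
    using W_var W_const by auto
qed

section \<open>Counting positive occurrences and locating cells\<close>

lemma literal_code_eq_iff: "literal_code l = 2 * v + 1 \<longleftrightarrow> l = (v, True)"
  by (cases l; cases "snd l") (auto simp: literal_code_def, presburger)

lemma count_literal_code:
  assumes "c < length \<phi>"
  shows "count_list (map literal_code (\<phi> ! c)) (2 * v + 1) = of_bool ((v, True) \<in> set (\<phi> ! c))"
proof -
  have "count_list (map literal_code C) (2 * v + 1) = of_bool ((v, True) \<in> set C)"
    if "distinct (map fst C)" for C
    using that
  proof (induction C)
    case (Cons l C)
    have "(v, True) \<notin> set C" if "l = (v, True)" using that Cons.prems by force
    then show ?case using Cons literal_code_eq_iff[of l v] by auto
  qed simp
  then show ?thesis using clause_facts(4)[OF assms] .
qed

lemma sum_list_occurrences: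
  assumes "v < n"
  shows "(\<Sum>c\<leftarrow>occs v. of_bool ((v, True) \<in> set (\<phi> ! c))) = literal_occurrences \<phi> v True"
proof -
  have "(\<Sum>c\<leftarrow>occs v. of_bool ((v, True) \<in> set (\<phi> ! c))) = (\<Sum>c\<in>set (occs v). of_bool ((v, True) \<in> set (\<phi> ! c)))"
    by (rule sum_list_distinct_conv_sum_set[OF distinct_occs[OF assms]])
  also have "\<dots> = card {c \<in> set (occs v). (v, True) \<in> set (\<phi> ! c)}"
    by (simp add: of_bool_def sum.If_cases Int_def)
  also have "{c \<in> set (occs v). (v, True) \<in> set (\<phi> ! c)} = {c. c < length \<phi> \<and> (v, True) \<in> set (\<phi> ! c)}"
    using set_occs[OF assms] by (auto simp: occurrences_def clause_vars_iff)
  finally show ?thesis by (simp add: literal_occurrences_def)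
qed

lemma occs_nth_less: "v < n \<Longrightarrow> i < length (occs v) \<Longrightarrow> occs v ! i < length \<phi>"
  using var_facts(3) nth_mem by blast

lemma sum_list_of_bool_le: "(\<Sum>c\<leftarrow>cs. of_bool (P c)) \<le> (length cs :: nat)"
  by (induction cs) auto

lemma count_positive_correct:
  assumes \<rho>: "\<rho> 13 = v" "v < n" "\<rho> 1 = n"
  shows "wp count_positive (\<lambda>t (\<rho>', \<mu>'). t \<le> 6 + d * (9 * k + 8) \<and> \<mu>' = \<mu> \<and> \<rho>' 19 = literal_occurrences \<phi> v True) (\<rho>, \<mu>)"
proof -
  \<comment> \<open>Equality is tested with truncated subtraction: the differences in both
    directions add up to zero iff the numbers are equal.\<close>
  define inner where "inner = list_loop 16 17 (
        ReadInput 25 (Reg 16) ;; Arith 26 Sub (Reg 25) (Reg 24) ;; Arith 25 Sub (Reg 24) (Reg 25) ;;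
        Arith 25 Add (Reg 25) (Reg 26) ;; If (Reg 25) Skip (Arith 19 Add (Reg 19) (Const 1)))"
  have inner: "wp inner (\<lambda>t (\<rho>', \<mu>'). t \<le> 1 + k * 9 \<and> \<mu>' = \<mu> \<and> \<rho>' 19 = \<rho> 19 + of_bool ((v, True) \<in> set (\<phi> ! c))) (\<rho>, \<mu>)"
    if c: "c < length \<phi>" "\<rho> 16 = inp ! (c + n + 2)" "\<rho> 24 = 2 * v + 1" "\<rho> 19 \<le> d" for c \<rho>
  proof -
    let ?vs = "map literal_code (\<phi> ! c)"
    let ?I = "\<lambda>i (\<rho>' :: regs) (\<mu>' :: memory). \<mu>' = \<mu> \<and> \<rho>' 24 = 2 * v + 1 \<and> \<rho>' 19 = \<rho> 19 + count_list (take i ?vs) (2 * v + 1)"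
    have "wp inner (\<lambda>t (\<rho>', \<mu>'). t \<le> 1 + length ?vs * (6 + 3) \<and> ?I (length ?vs) \<rho>' \<mu>') (\<rho>, \<mu>)"
      unfolding inner_def
    proof (rule wp_list_loop)
      fix i and \<rho>' :: regs and \<mu>' :: memory
      assume i: "i < length ?vs" and I: "?I i \<rho>' \<mu>'" and p: "\<rho>' 16 + 1 < length inp" "inp ! \<rho>' 16 = ?vs ! i"
      have less: "?vs ! i < W" using literal_code_less[OF c(1)] i by simp
      have "count_list (take i ?vs) (2 * v + 1) \<le> k"
        using count_le_length[of "take i ?vs"] clause_facts(3)[OF c(1)] by (auto intro: order_trans)
      then have b: "\<rho>' 19 + 1 < W" "2 * v + 1 < W" using I c(4) W_const(4) W_var \<rho>(2) by auto
      have take: "count_list (take (Suc i) ?vs) (2 * v + 1) = count_list (take i ?vs) (2 * v + 1) + of_bool (?vs ! i = 2 * v + 1)"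
        using i by (simp add: take_Suc_conv_app_nth)
      show "wp (ReadInput 25 (Reg 16) ;; Arith 26 Sub (Reg 25) (Reg 24) ;; Arith 25 Sub (Reg 24) (Reg 25) ;;
        Arith 25 Add (Reg 25) (Reg 26) ;; If (Reg 25) Skip (Arith 19 Add (Reg 19) (Const 1)))
        (\<lambda>t (\<rho>'', \<mu>'). t \<le> 6 \<and> \<rho>'' 16 = \<rho>' 16 \<and> ?I (Suc i) \<rho>'' \<mu>') (\<rho>', \<mu>')"
        unfolding take using I p less b const_bounds(1) by auto
    qed (use c clause_facts[OF c(1)] W_inp const_bounds(1) in auto)
    then show ?thesis
      by (rule wp_mono) (use count_literal_code[OF c(1), of v] clause_facts(3)[OF c(1)] in auto)
  qed
  define outer where "outer = list_loop 20 21 (ReadInput 16 (Reg 20) ;; Arith 16 Add (Reg 16) (Reg 1) ;;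
    Arith 16 Add (Reg 16) (Const 2) ;; ReadInput 16 (Reg 16) ;; inner)"
  have outer: "wp outer (\<lambda>t (\<rho>', \<mu>'). t \<le> 1 + d * (9 * k + 8) \<and> \<mu>' = \<mu> \<and> \<rho>' 19 = literal_occurrences \<phi> v True) (\<rho>, \<mu>)"
    if r: "\<rho> 20 = inp ! (v + 2)" "\<rho> 24 = 2 * v + 1" "\<rho> 1 = n" "\<rho> 19 = 0" for \<rho>
  proof -
    let ?vs = "occs v"
    let ?f = "\<lambda>c. of_bool ((v, True) \<in> set (\<phi> ! c)) :: nat"
    let ?I = "\<lambda>i (\<rho>' :: regs) (\<mu>' :: memory). \<mu>' = \<mu> \<and> \<rho>' 24 = 2 * v + 1 \<and> \<rho>' 1 = n \<and> \<rho>' 19 = (\<Sum>c\<leftarrow>take i ?vs. ?f c)"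
    have "wp outer (\<lambda>t (\<rho>', \<mu>'). t \<le> 1 + length ?vs * ((9 * k + 5) + 3) \<and> ?I (length ?vs) \<rho>' \<mu>') (\<rho>, \<mu>)"
      unfolding outer_def
    proof (rule wp_list_loop)
      fix i and \<rho>' :: regs and \<mu>' :: memory
      assume i: "i < length ?vs" and I: "?I i \<rho>' \<mu>'" and p: "\<rho>' 20 + 1 < length inp" "inp ! \<rho>' 20 = ?vs ! i"
      let ?c = "?vs ! i"
      have c: "?c < length \<phi>" by (rule occs_nth_less[OF \<rho>(2) i])
      note cf = clause_facts[OF c]
      have "(\<Sum>c\<leftarrow>take i ?vs. ?f c) \<le> d"
        by (rule order_trans[OF sum_list_of_bool_le]) (use length_occs[OF \<rho>(2)] in simp)
      then have b: "\<rho>' 19 \<le> d" using I by simp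
      have "wp inner (\<lambda>t (\<rho>'', \<mu>''). t \<le> 1 + k * 9 \<and> \<mu>'' = \<mu> \<and> \<rho>'' 19 = (\<rho>'(16 := inp ! (?c + n + 2))) 19 + ?f ?c) (\<rho>'(16 := inp ! (?c + n + 2)), \<mu>)"
        by (rule inner) (use c I b in auto)
      then have "wp inner (\<lambda>t (\<rho>'', \<mu>''). 4 + t \<le> 9 * k + 5 \<and> \<rho>'' 20 = \<rho>' 20 \<and> ?I (Suc i) \<rho>'' \<mu>'') (\<rho>'(16 := inp ! (?c + n + 2)), \<mu>)"
        by (rule wp_use) (use I i in \<open>auto simp: inner_def take_Suc_conv_app_nth\<close>)
      then show "wp (ReadInput 16 (Reg 20) ;; Arith 16 Add (Reg 16) (Reg 1) ;;
        Arith 16 Add (Reg 16) (Const 2) ;; ReadInput 16 (Reg 16) ;; inner)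
        (\<lambda>t (\<rho>'', \<mu>'). t \<le> 9 * k + 5 \<and> \<rho>'' 20 = \<rho>' 20 \<and> ?I (Suc i) \<rho>'' \<mu>') (\<rho>', \<mu>')"
        using I p cf(2) W_inp const_bounds(2) pointer_less[OF cf(1)] by (simp add: numeral_eq_Suc)
    qed (use r var_facts[OF \<rho>(2)] W_inp const_bounds(1) in auto)
    then show ?thesis
    proof (rule wp_mono)
      fix t \<rho>' \<mu>'
      assume *: "case (\<rho>', \<mu>') of (\<rho>', \<mu>') \<Rightarrow> t \<le> 1 + length ?vs * ((9 * k + 5) + 3) \<and> ?I (length ?vs) \<rho>' \<mu>'"
      moreover have "length ?vs * ((9 * k + 5) + 3) \<le> d * (9 * k + 8)"
        using length_occs[OF \<rho>(2)] by (intro mult_le_mono) auto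
      ultimately show "case (\<rho>', \<mu>') of (\<rho>', \<mu>') \<Rightarrow> t \<le> 1 + d * (9 * k + 8) \<and> \<mu>' = \<mu> \<and> \<rho>' 19 = literal_occurrences \<phi> v True"
        using sum_list_occurrences[OF \<rho>(2)] by auto
    qed
  qed
  have "wp outer (\<lambda>t (\<rho>', \<mu>'). 5 + t \<le> 6 + d * (9 * k + 8) \<and> \<mu>' = \<mu> \<and> \<rho>' 19 = literal_occurrences \<phi> v True)
    (\<rho>(24 := 2 * v + 1, 19 := 0, 20 := inp ! (v + 2)), \<mu>)"
    by (rule wp_mono[OF outer]) (use \<rho> in auto)
  then show ?thesis
    using \<rho> var_facts[OF \<rho>(2)] W_var W_inp const_bounds pointer_less[OF var_facts(1)[OF \<rho>(2)]]
    unfolding count_positive_def inner_def[symmetric] outer_def[symmetric]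
    by (simp add: mult.commute)
qed

text \<open>The variables of a clause are distinct, so the match is unique. Hence
  \<open>find_cell\<close> may keep the last match although \<open>cell\<close> is defined by the
  least one.\<close>

lemma cell_eq:
  assumes v: "v < n" "occs v \<noteq> []" and i: "i < k" "fst (\<phi> ! hd (occs v) ! i) = v"
  shows "cell v = hd (occs v) * k + i"
proof -
  let ?C = "\<phi> ! hd (occs v)"
  have c: "hd (occs v) < length \<phi>" using var_facts(3)[OF v(1)] v(2) by simp
  have uniq: "j = i" if "j < k" "fst (?C ! j) = v" for j
  proof -
    have "map fst ?C ! j = map fst ?C ! i" using that i clause_facts(3)[OF c] by simp
    then show ?thesis using nth_eq_iff_index_eq[OF clause_facts(4)[OF c], of j i] that(1) i(1) clause_facts(3)[OF c]
      by (simp only: length_map)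
  qed
  have "(LEAST j. fst (?C ! j) = v) = i"
  proof (rule Least_equality)
    fix j assume "fst (?C ! j) = v"
    then show "i \<le> j" using uniq[of j] i(1) by (cases "j < k") auto
  qed (rule i)
  then show ?thesis by (simp add: cell_def)
qed

lemma cell_position:
  assumes v: "v < n" "occs v \<noteq> []"
  obtains i where "i < k" "fst (\<phi> ! hd (occs v) ! i) = v" "cell v = hd (occs v) * k + i" "hd (occs v) < length \<phi>"
proof -
  have c: "hd (occs v) < length \<phi>" using var_facts(3)[OF v(1)] v(2) by simp
  have "hd (occs v) \<in> occurrences \<phi> v" using set_occs[OF v(1)] v(2) hd_in_set by blast
  then have "v \<in> clause_vars (\<phi> ! hd (occs v))" by (simp add: occurrences_def)
  then obtain l where "l \<in> set (\<phi> ! hd (occs v))" "fst l = v" by (auto simp: clause_vars_def)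
  then obtain i where i: "i < k" "fst (\<phi> ! hd (occs v) ! i) = v"
    unfolding in_set_conv_nth clause_facts(3)[OF c] by auto
  show ?thesis by (rule that[OF i cell_eq[OF v i] c])
qed

lemma cell_less: "v < n \<Longrightarrow> occs v \<noteq> [] \<Longrightarrow> cell v < length \<phi> * k"
proof -
  assume v: "v < n" "occs v \<noteq> []"
  obtain i where i: "i < k" "fst (\<phi> ! hd (occs v) ! i) = v" "cell v = hd (occs v) * k + i" "hd (occs v) < length \<phi>"
    using cell_position[OF v] .
  have "hd (occs v) * k + i < Suc (hd (occs v)) * k" using i by simp
  also have "\<dots> \<le> length \<phi> * k" using i by (intro mult_le_mono1) simp
  finally show ?thesis using i by simp
qed

lemma cell_inj:
  assumes "v < n" "occs v \<noteq> []" "u < n" "occs u \<noteq> []" "cell v = cell u"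
  shows "v = u"
proof -
  obtain i where i: "i < k" "fst (\<phi> ! hd (occs v) ! i) = v" "cell v = hd (occs v) * k + i"
    using cell_position[OF assms(1,2)] .
  obtain j where j: "j < k" "fst (\<phi> ! hd (occs u) ! j) = u" "cell u = hd (occs u) * k + j"
    using cell_position[OF assms(3,4)] .
  have eq: "hd (occs v) * k + i = hd (occs u) * k + j" using i j assms(5) by simp
  have "hd (occs v) = hd (occs u)" using arg_cong[OF eq, of "\<lambda>a. a div k"] i(1) j(1) by simp
  moreover have "i = j" using arg_cong[OF eq, of "\<lambda>a. a mod k"] i(1) j(1) by simp
  ultimately show ?thesis using i(2) j(2) by metis
qed

lemma literal_code_div: "literal_code l div 2 = fst l" and literal_code_mod: "literal_code l mod 2 = of_bool (snd l)"
  by (auto simp: literal_code_def)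

lemma find_cell_correct:
  assumes \<rho>: "\<rho> 13 = v" "v < n" "\<rho> 1 = n" "occs v \<noteq> []"
  shows "wp (find_cell k) (\<lambda>t (\<rho>', \<mu>'). t \<le> 8 + k * 11 \<and> \<mu>' = \<mu> \<and> \<rho>' 15 = cell v) (\<rho>, \<mu>)"
proof -
  define c where "c = hd (occs v)"
  have c: "c < length \<phi>" using var_facts(3)[OF \<rho>(2)] \<rho>(4) by (simp add: c_def)
  note cf = clause_facts[OF c]
  define body where "body = ReadInput 25 (Reg 16) ;; Arith 25 Div (Reg 25) (Const 2) ;;
      Arith 26 Sub (Reg 25) (Reg 13) ;; Arith 25 Sub (Reg 13) (Reg 25) ;; Arith 25 Add (Reg 25) (Reg 26) ;;
      If (Reg 25) Skip (Arith 15 Add (Reg 22) (Const 0)) ;; Arith 22 Add (Reg 22) (Const 1)"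
  let ?vs = "map literal_code (\<phi> ! c)"
  have ck: "c * k + k \<le> length \<phi> * k" using mult_le_mono1[of "Suc c" "length \<phi>" k] c by simp
  have loop: "wp (list_loop 16 17 body) (\<lambda>t (\<rho>', \<mu>'). t \<le> 1 + k * 11 \<and> \<mu>' = \<mu> \<and> \<rho>' 15 = cell v) (\<rho>, \<mu>)"
    if r: "\<rho> 13 = v" "\<rho> 16 = inp ! (c + n + 2)" "\<rho> 22 = c * k" for \<rho>
  proof -
    let ?I = "\<lambda>i (\<rho>' :: regs) (\<mu>' :: memory). \<mu>' = \<mu> \<and> \<rho>' 13 = v \<and> \<rho>' 22 = c * k + i \<and>
      (v \<in> set (map fst (take i (\<phi> ! c))) \<longrightarrow> \<rho>' 15 = cell v)"
    have "wp (list_loop 16 17 body) (\<lambda>t (\<rho>', \<mu>'). t \<le> 1 + length ?vs * (8 + 3) \<and> ?I (length ?vs) \<rho>' \<mu>') (\<rho>, \<mu>)"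
    proof (rule wp_list_loop)
      fix i and \<rho>' :: regs and \<mu>' :: memory
      assume i: "i < length ?vs" and I: "?I i \<rho>' \<mu>'" and p: "\<rho>' 16 + 1 < length inp" "inp ! \<rho>' 16 = ?vs ! i"
      have less: "?vs ! i < W" using literal_code_less[OF c] i by simp
      have less': "fst (\<phi> ! c ! i) < W" using clause_vars_less[OF c, of "\<phi> ! c ! i"] i W_var by simp
      have dv: "?vs ! i div 2 = fst (\<phi> ! c ! i)" using i by (simp add: literal_code_div)
      have ik: "i < k" using i cf(3) by simp
      then have ck': "c * k + i + 1 < W" using ck W_cell by linarith
      have take: "set (map fst (take (Suc i) (\<phi> ! c))) = insert (fst (\<phi> ! c ! i)) (set (map fst (take i (\<phi> ! c))))"
        using i by (simp add: take_Suc_conv_app_nth)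
      have ce: "cell v = c * k + i" if "fst (\<phi> ! c ! i) = v"
        using cell_eq[OF \<rho>(2,4) ik] that by (simp add: c_def)
      show "wp body (\<lambda>t (\<rho>'', \<mu>'). t \<le> 8 \<and> \<rho>'' 16 = \<rho>' 16 \<and> ?I (Suc i) \<rho>'' \<mu>') (\<rho>', \<mu>')"
        unfolding take body_def
        using I p less less' dv ck' ce const_bounds(1-3) \<rho>(2) W_var by auto
    qed (use r cf W_inp const_bounds(1) in auto)
    then show ?thesis
    proof (rule wp_mono)
      fix t \<rho>' \<mu>'
      assume *: "case (\<rho>', \<mu>') of (\<rho>', \<mu>') \<Rightarrow> t \<le> 1 + length ?vs * (8 + 3) \<and> ?I (length ?vs) \<rho>' \<mu>'"
      obtain i where "i < k" "fst (\<phi> ! c ! i) = v" using cell_position[OF \<rho>(2,4)] unfolding c_def .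
      then have "v \<in> set (map fst (take (length ?vs) (\<phi> ! c)))" using cf(3) by force
      with * show "case (\<rho>', \<mu>') of (\<rho>', \<mu>') \<Rightarrow> t \<le> 1 + k * 11 \<and> \<mu>' = \<mu> \<and> \<rho>' 15 = cell v"
        using cf(3) by auto
    qed
  qed
  have c_list: "inp ! (inp ! (v + 2)) = c" "inp ! (v + 2) < length inp"
    using var_facts(1)[OF \<rho>(2)] \<rho>(4) by (cases "occs v"; simp add: c_def)+
  have "wp (list_loop 16 17 body) (\<lambda>t (\<rho>', \<mu>'). 7 + t \<le> 8 + k * 11 \<and> \<mu>' = \<mu> \<and> \<rho>' 15 = cell v)
    (\<rho>(15 := c, 16 := inp ! (c + n + 2), 22 := c * k), \<mu>)"
    by (rule wp_mono[OF loop]) (use \<rho> in auto)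
  then show ?thesis
    using \<rho> var_facts[OF \<rho>(2)] W_var W_inp const_bounds pointer_less[OF cf(1)] c_list cf(2) ck W_cell
    unfolding find_cell_def body_def[symmetric]
    by simp
qed

section \<open>Reading the current value of a variable\<close>

abbreviation value_time :: nat where "value_time \<equiv> read_value_time k d B"

lemma wp_Seq_fun: "wp (c ;; c') Q = wp c (\<lambda>t. wp c' (\<lambda>t'. Q (t + t')))"
  by (rule ext) simp

text \<open>The program reads a block by Horner's scheme from the top bit down, which needs the
  recursion at the low bit instead of the one at the high bit.\<close>

lemma block_value_shift: "block_value (Suc m) a \<omega> = of_bool (\<omega> a) + 2 * block_value m (Suc a) \<omega>"
proof -
  have "block_value (Suc m) a \<omega> = 2 ^ 0 * of_bool (\<omega> (a + 0)) + (\<Sum>b<m. 2 ^ Suc b * of_bool (\<omega> (a + Suc b)))"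
    unfolding block_value_def by (rule sum.lessThan_Suc_shift)
  then show ?thesis
    unfolding block_value_def sum_distrib_left
    by (simp only: power_0 power_Suc mult.assoc add_0_right add_Suc_right add_Suc mult_1)
qed

lemma resamplings_le: "resamplings \<phi> l x \<le> length l"
  by (simp add: resamplings_def)

lemma read_value_correct:
  assumes \<rho>: "\<rho> 13 = v" "v < n" "\<rho> 1 = n" "occs v \<noteq> []"
    and \<mu>: "represents \<mu> l" "length l \<le> maxcount"
  shows "wp (read_value k d B) (\<lambda>t (\<rho>', \<mu>'). t \<le> value_time \<and> \<mu>' = \<mu> \<and> \<rho>' 27 = of_bool (V v (resamplings \<phi> l v))) (\<rho>, \<mu>)"
proof -
  define cnt where "cnt = resamplings \<phi> l v"
  have cnt: "cnt \<le> maxcount" using resamplings_le[of l v] \<mu>(2) by (simp add: cnt_def)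
  define base where "base = (cnt * n + v) * B"
  have cv: "cnt * n + v \<le> maxcount * n + n" using cnt \<rho>(2) by (intro add_mono mult_le_mono1) auto
  then have "base \<le> (maxcount * n + n) * B" unfolding base_def by (rule mult_le_mono1)
  then have base: "base + B < W" using W_tape by linarith
  have cn: "cnt * n + v < W" using cv W_tape(2) by (simp add: add.commute)
  define body where "body = Arith 25 Add (Reg 18) (Reg 23) ;; ReadRandom 25 (Reg 25) ;;
      Arith 22 Mul (Reg 22) (Const 2) ;; Arith 22 Add (Reg 22) (Reg 25)"
  have loop: "wp (for_loop 23 body) (\<lambda>t (\<rho>', \<mu>'). t \<le> 1 + B * (4 + 2) \<and> \<rho>' 23 = 0 \<and>
      (\<mu>' = \<mu> \<and> \<rho>' 18 = base \<and> \<rho>' 22 = block_value (B - 0) (base + 0) \<omega>)) (\<rho>, \<mu>)"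
    if "\<rho> 18 = base" "\<rho> 22 = 0" "\<rho> 23 = B" for \<rho>
  proof (rule wp_for_loop[where I = "\<lambda>w \<rho>' \<mu>'. \<mu>' = \<mu> \<and> \<rho>' 18 = base \<and> \<rho>' 22 = block_value (B - w) (base + w) \<omega>"])
    fix w and \<rho>' :: regs and \<mu>' :: memory
    assume w: "w < B" and I: "\<mu>' = \<mu> \<and> \<rho>' 18 = base \<and> \<rho>' 22 = block_value (B - Suc w) (base + Suc w) \<omega>" and r: "\<rho>' 23 = w"
    have Bw: "B - w = Suc (B - Suc w)" using w by simp
    have eq: "block_value (B - w) (base + w) \<omega> = of_bool (\<omega> (base + w)) + 2 * block_value (B - Suc w) (Suc (base + w)) \<omega>"
      unfolding Bw by (rule block_value_shift)
    have "block_value (B - w) (base + w) \<omega> < 2 ^ (B - w)" by (rule block_value_less)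
    also have "(2 :: nat) ^ (B - w) \<le> 2 ^ B" by (rule power_increasing) auto
    finally have less: "of_bool (\<omega> (base + w)) + 2 * block_value (B - Suc w) (Suc (base + w)) \<omega> < W"
      using const_bounds(8) eq by simp
    show "wp body (\<lambda>t (\<rho>'', \<mu>'). t \<le> 4 \<and> \<rho>'' 23 = w \<and> (\<mu>' = \<mu> \<and> \<rho>'' 18 = base \<and> \<rho>'' 22 = block_value (B - w) (base + w) \<omega>)) (\<rho>', \<mu>')"
      unfolding body_def eq using I r less base w const_bounds(1,2) by (simp add: mult.commute add.commute)
  qed (use that base const_bounds(1) in \<open>auto simp: block_value_def\<close>)
  \<comment> \<open>Truncated subtraction as comparison: the difference is nonzero iff the block
    value is below the threshold, and it is then normalised to 1.\<close>
  define tail where "tail = Arith 27 Sub (Reg 19) (Reg 22) ;; If (Reg 27) (Arith 27 Add (Const 1) (Const 0)) Skip"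
  define mid where "mid = Load 18 (Reg 15) ;;
    Arith 19 Mul (Reg 19) (Const 2) ;; Arith 19 Sub (Const (d * (k + 1))) (Reg 19) ;;
    Arith 19 Mul (Const (2 ^ B)) (Reg 19) ;; Arith 19 Div (Reg 19) (Const (2 * d * k)) ;;
    Arith 18 Mul (Reg 18) (Reg 1) ;; Arith 18 Add (Reg 18) (Reg 13) ;; Arith 18 Mul (Reg 18) (Const B) ;;
    Arith 22 Mul (Const 0) (Const 0) ;; Arith 23 Add (Const B) (Const 0) ;; for_loop 23 body ;; tail"
  let ?o = "literal_occurrences \<phi> v True"
  have o: "?o \<le> d"
  proof -
    have "?o \<le> card (occurrences \<phi> v)" unfolding literal_occurrences_def
      by (intro card_mono) (auto simp: occurrences_def clause_vars_iff)
    then show ?thesis using max_occurrences \<rho>(2) by (auto simp: max_occurrences_def intro: order_trans)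
  qed
  have mid: "wp mid (\<lambda>t (\<rho>', \<mu>'). t \<le> 6 * B + 14 \<and> \<mu>' = \<mu> \<and> \<rho>' 27 = of_bool (V v cnt)) (\<rho>, \<mu>)"
    if r: "\<rho> 15 = cell v" "\<rho> 19 = ?o" "\<rho> 1 = n" "\<rho> 13 = v" for \<rho>
  proof -
    let ?t = "threshold k d B \<phi> v"
    have cellS: "cell v < S" using cell_less[OF \<rho>(2,4)] S by simp
    have \<mu>cell: "\<mu> (cell v) = cnt" using \<mu>(1) \<rho>(2,4) by (simp add: represents_def cnt_def)
    have "2 ^ B * (d * (k + 1) - 2 * ?o) \<le> 2 ^ B * (d * (k + 1))" by (intro mult_le_mono2) simp
    then have tl: "2 ^ B * (d * (k + 1) - 2 * ?o) < W" using W_const(1) by linarith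
    have "?t \<le> 2 ^ B * (d * (k + 1) - 2 * ?o)" unfolding threshold_def by (rule div_le_dividend)
    then have tW: "?t < W" using tl by linarith
    have "?o * 2 \<le> d * (k + 1)" using o k mult_le_mono[of ?o d 2 "k + 1"] by simp
    then have oW: "?o * 2 < W" using const_bounds(7) by linarith
    have val: "wp tail (\<lambda>t' (\<rho>', \<mu>'). t' \<le> 3 \<and> \<mu>' = \<mu> \<and> \<rho>' 27 = of_bool (V v cnt)) (\<rho>', \<mu>)"
      if "\<rho>' 19 = ?t" "\<rho>' 22 = block_value B base \<omega>" for \<rho>'
      unfolding tail_def using that tW const_bounds(1) by (simp add: sample_def base_def)
    have "wp (for_loop 23 body) (\<lambda>t. wp tail (\<lambda>t' (\<rho>', \<mu>'). 10 + (t + t') \<le> 6 * B + 14 \<and> \<mu>' = \<mu> \<and> \<rho>' 27 = of_bool (V v cnt)))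
      (\<rho>(19 := ?t, 18 := base, 22 := 0, 23 := B), \<mu>)"
    proof (rule wp_use[OF loop])
      fix t \<rho>' \<mu>'
      assume *: "case (\<rho>', \<mu>') of (\<rho>', \<mu>') \<Rightarrow> t \<le> 1 + B * (4 + 2) \<and> \<rho>' 23 = 0 \<and>
          (\<mu>' = \<mu> \<and> \<rho>' 18 = base \<and> \<rho>' 22 = block_value (B - 0) (base + 0) \<omega>)"
        and fr: "\<And>r. r \<notin> writes (for_loop 23 body) \<Longrightarrow> \<rho>' r = (\<rho>(19 := ?t, 18 := base, 22 := 0, 23 := B)) r"
      have "\<rho>' 19 = ?t" using fr[of 19] by (simp add: body_def)
      then have "wp tail (\<lambda>t' (\<rho>', \<mu>'). t' \<le> 3 \<and> \<mu>' = \<mu> \<and> \<rho>' 27 = of_bool (V v cnt)) (\<rho>', \<mu>)"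
        using * by (intro val) auto
      then show "wp tail (\<lambda>t' (\<rho>', \<mu>'). 10 + (t + t') \<le> 6 * B + 14 \<and> \<mu>' = \<mu> \<and> \<rho>' 27 = of_bool (V v cnt)) (\<rho>', \<mu>')"
        using * by (auto elim: wp_mono)
    qed auto
    moreover have "?t = 2 ^ B * (d * (k + 1) - ?o * 2) div (2 * d * k)" by (simp add: threshold_def mult.commute)
    moreover have "cnt * n < W" using cn by linarith
    moreover have "base < W" using base by linarith
    ultimately show ?thesis
      unfolding mid_def
      using r cellS \<mu>cell tl tW oW cn W_const(2,3) const_bounds(1-3,7,8)
      by (simp add: base_def[symmetric] mult.commute[of _ 2] fun_upd_twist)
  qed
  have cp: "wp count_positive (\<lambda>t. wp (find_cell k) (\<lambda>t'. wp mid (\<lambda>t'' (\<rho>', \<mu>'). t + (t' + t'') \<le> value_time \<and> \<mu>' = \<mu> \<and> \<rho>' 27 = of_bool (V v cnt)))) (\<rho>, \<mu>)"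
  proof (rule wp_use[OF count_positive_correct[OF \<rho>(1-3)]])
    fix t \<rho>1 \<mu>1
    assume 1: "case (\<rho>1, \<mu>1) of (\<rho>', \<mu>') \<Rightarrow> t \<le> 6 + d * (9 * k + 8) \<and> \<mu>' = \<mu> \<and> \<rho>' 19 = ?o"
      and fr: "\<And>r. r \<notin> writes count_positive \<Longrightarrow> \<rho>1 r = \<rho> r"
    have \<rho>1: "\<rho>1 13 = v" "\<rho>1 1 = n" using fr[of 13] fr[of 1] \<rho> by (auto simp: writes_subprograms)
    show "wp (find_cell k) (\<lambda>t'. wp mid (\<lambda>t'' (\<rho>', \<mu>'). t + (t' + t'') \<le> value_time \<and> \<mu>' = \<mu> \<and> \<rho>' 27 = of_bool (V v cnt))) (\<rho>1, \<mu>1)"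
    proof (rule wp_use[OF find_cell_correct[OF \<rho>1(1) \<rho>(2) \<rho>1(2) \<rho>(4)]])
      fix t' \<rho>2 \<mu>2
      assume 2: "case (\<rho>2, \<mu>2) of (\<rho>', \<mu>') \<Rightarrow> t' \<le> 8 + k * 11 \<and> \<mu>' = \<mu>1 \<and> \<rho>' 15 = cell v"
        and fr2: "\<And>r. r \<notin> writes (find_cell k) \<Longrightarrow> \<rho>2 r = \<rho>1 r"
      have "\<rho>2 13 = v" "\<rho>2 1 = n" "\<rho>2 19 = ?o"
        using fr2[of 13] fr2[of 1] fr2[of 19] \<rho>1 1 by (auto simp: writes_subprograms)
      then have "wp mid (\<lambda>t (\<rho>', \<mu>'). t \<le> 6 * B + 14 \<and> \<mu>' = \<mu> \<and> \<rho>' 27 = of_bool (V v cnt)) (\<rho>2, \<mu>)"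
        using 2 by (intro mid) auto
      moreover have "\<mu>2 = \<mu>" "t \<le> 6 + d * (9 * k + 8)" "t' \<le> 8 + k * 11" using 1 2 by auto
      ultimately show "wp mid (\<lambda>t'' (\<rho>', \<mu>'). t + (t' + t'') \<le> value_time \<and> \<mu>' = \<mu> \<and> \<rho>' 27 = of_bool (V v cnt)) (\<rho>2, \<mu>2)"
        by (auto elim!: wp_mono simp: read_value_time_def)
    qed
  qed
  have "read_value k d B = count_positive ;; find_cell k ;; mid"
    unfolding read_value_def mid_def body_def tail_def ..
  then show ?thesis using cp by (simp only: wp_Seq_fun cnt_def)
qed

section \<open>Testing and resampling a clause\<close>

abbreviation visit_time :: nat where "visit_time \<equiv> visit_clause_time k d B"

lemma clause_literal:
  assumes "c < length \<phi>" "i < k"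
  shows "fst (\<phi> ! c ! i) < n" "occs (fst (\<phi> ! c ! i)) \<noteq> []"
    "set (take (Suc i) (\<phi> ! c)) = insert (\<phi> ! c ! i) (set (take i (\<phi> ! c)))"
    "map literal_code (\<phi> ! c) ! i = literal_code (\<phi> ! c ! i)" "literal_code (\<phi> ! c ! i) < W"
    "fst (\<phi> ! c ! i) < W"
proof -
  have i: "i < length (\<phi> ! c)" using assms clause_facts(3) by simp
  show "fst (\<phi> ! c ! i) < n" "occs (fst (\<phi> ! c ! i)) \<noteq> []" using step_variable[OF assms] by auto
  then show "fst (\<phi> ! c ! i) < W" using W_var by linarith
  show "set (take (Suc i) (\<phi> ! c)) = insert (\<phi> ! c ! i) (set (take i (\<phi> ! c)))"
    using i by (simp add: take_Suc_conv_app_nth)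
  show "map literal_code (\<phi> ! c) ! i = literal_code (\<phi> ! c ! i)" using i by simp
  show "literal_code (\<phi> ! c ! i) < W" using literal_code_less[OF assms(1)] i by simp
qed

text \<open>Incrementing the counters is all of a resampling, as the next row is already on the
  tape. The increments wait for a second traversal, because all literals must be tested against the
  old counters.\<close>

lemma visit_clause_correct:
  assumes \<rho>: "\<rho> 9 = c" "c < length \<phi>" "\<rho> 1 = n"
    and \<mu>: "represents \<mu> l" "length l < maxcount"
  shows "wp (visit_clause k d B) (\<lambda>t (\<rho>', \<mu>'). t \<le> visit_time \<and> represents \<mu>' (visit V \<phi> c l)) (\<rho>, \<mu>)"
proof -
  note cf = clause_facts[OF \<rho>(2)]
  let ?C = "\<phi> ! c" and ?vs = "map literal_code (\<phi> ! c)"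
  define ptr where "ptr = inp ! (c + n + 2)"
  have ptr: "ptr < W" "linked_list inp ptr ?vs" using pointer_less[OF cf(1)] cf(1) by (auto simp: ptr_def)
  define test where "test = list_loop 10 11 (
      ReadInput 13 (Reg 10) ;; Arith 14 Mod (Reg 13) (Const 2) ;; Arith 13 Div (Reg 13) (Const 2) ;;
      read_value k d B ;;
      Arith 25 Sub (Reg 27) (Reg 14) ;; Arith 26 Sub (Reg 14) (Reg 27) ;; Arith 25 Add (Reg 25) (Reg 26) ;;
      If (Reg 25) Skip (Arith 12 Mul (Const 0) (Const 0)))"
  define bump where "bump = list_loop 10 11 (
         ReadInput 13 (Reg 10) ;; Arith 13 Div (Reg 13) (Const 2) ;; find_cell k ;;
         Load 18 (Reg 15) ;; Arith 18 Add (Reg 18) (Const 1) ;; Store (Reg 15) (Reg 18))"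
  let ?P = "\<lambda>i. \<forall>(x, b)\<in>set (take i ?C). V x (resamplings \<phi> l x) \<noteq> b"
  have test: "wp test (\<lambda>t (\<rho>', \<mu>'). t \<le> 1 + k * (value_time + 11) \<and> \<mu>' = \<mu> \<and> \<rho>' 1 = n \<and> \<rho>' 31 = ptr \<and> \<rho>' 12 = of_bool (violated V \<phi> (resamplings \<phi> l) c)) (\<rho>, \<mu>)"
    if r: "\<rho> 10 = ptr" "\<rho> 31 = ptr" "\<rho> 12 = 1" "\<rho> 1 = n" for \<rho>
  proof -
    let ?I = "\<lambda>i (\<rho>' :: regs) (\<mu>' :: memory). \<mu>' = \<mu> \<and> \<rho>' 1 = n \<and> \<rho>' 31 = ptr \<and> \<rho>' 12 = of_bool (?P i)"
    have "wp test (\<lambda>t (\<rho>', \<mu>'). t \<le> 1 + length ?vs * ((value_time + 8) + 3) \<and> ?I (length ?vs) \<rho>' \<mu>') (\<rho>, \<mu>)"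
      unfolding test_def
    proof (rule wp_list_loop)
      fix i and \<rho>' :: regs and \<mu>' :: memory
      assume i: "i < length ?vs" and I: "?I i \<rho>' \<mu>'" and p: "\<rho>' 10 + 1 < length inp" "inp ! \<rho>' 10 = ?vs ! i"
      have ik: "i < k" using i cf(3) by simp
      note cl = clause_literal[OF \<rho>(2) ik]
      let ?x = "fst (?C ! i)" and ?s = "snd (?C ! i)"
      let ?\<rho> = "\<rho>'(14 := of_bool ?s, 13 := ?x)"
      have sW: "of_bool ?s mod W = (of_bool ?s :: nat)" using const_bounds(1) by simp
      have "wp (read_value k d B) (\<lambda>t (\<rho>'', \<mu>''). t \<le> value_time \<and> \<mu>'' = \<mu> \<and> \<rho>'' 27 = of_bool (V ?x (resamplings \<phi> l ?x))) (?\<rho>, \<mu>)"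
        using I \<mu> by (intro read_value_correct cl) auto
      then have "wp (read_value k d B) (\<lambda>t. wp (Arith 25 Sub (Reg 27) (Reg 14) ;; Arith 26 Sub (Reg 14) (Reg 27) ;; Arith 25 Add (Reg 25) (Reg 26) ;;
            If (Reg 25) Skip (Arith 12 Mul (Const 0) (Const 0)))
          (\<lambda>t' (\<rho>'', \<mu>''). 3 + (t + t') \<le> value_time + 8 \<and> \<rho>'' 10 = \<rho>' 10 \<and> ?I (Suc i) \<rho>'' \<mu>'')) (?\<rho>, \<mu>)"
      proof (rule wp_use)
        fix t \<rho>2 \<mu>2
        assume 2: "case (\<rho>2, \<mu>2) of (\<rho>'', \<mu>'') \<Rightarrow> t \<le> value_time \<and> \<mu>'' = \<mu> \<and> \<rho>'' 27 = of_bool (V ?x (resamplings \<phi> l ?x))"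
          and fr: "\<And>r. r \<notin> writes (read_value k d B) \<Longrightarrow> \<rho>2 r = ?\<rho> r"
        have r2: "\<rho>2 14 = of_bool ?s" "\<rho>2 10 = \<rho>' 10" "\<rho>2 12 = of_bool (?P i)" "\<rho>2 1 = n" "\<rho>2 31 = ptr"
          using fr[of 14] fr[of 10] fr[of 12] fr[of 1] fr[of 31] I by (auto simp: writes_subprograms)
        have PS: "?P (Suc i) \<longleftrightarrow> V ?x (resamplings \<phi> l ?x) \<noteq> ?s \<and> ?P i"
          unfolding cl(3) by (auto simp: case_prod_unfold)
        show "wp (Arith 25 Sub (Reg 27) (Reg 14) ;; Arith 26 Sub (Reg 14) (Reg 27) ;; Arith 25 Add (Reg 25) (Reg 26) ;;
            If (Reg 25) Skip (Arith 12 Mul (Const 0) (Const 0)))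
          (\<lambda>t' (\<rho>'', \<mu>''). 3 + (t + t') \<le> value_time + 8 \<and> \<rho>'' 10 = \<rho>' 10 \<and> ?I (Suc i) \<rho>'' \<mu>'') (\<rho>2, \<mu>2)"
          unfolding PS using 2 r2 const_bounds(1,3)
          by (cases "V ?x (resamplings \<phi> l ?x)"; cases ?s) simp_all
      qed
      then show "wp (ReadInput 13 (Reg 10) ;; Arith 14 Mod (Reg 13) (Const 2) ;; Arith 13 Div (Reg 13) (Const 2) ;;
          read_value k d B ;;
          Arith 25 Sub (Reg 27) (Reg 14) ;; Arith 26 Sub (Reg 14) (Reg 27) ;; Arith 25 Add (Reg 25) (Reg 26) ;;
          If (Reg 25) Skip (Arith 12 Mul (Const 0) (Const 0)))
        (\<lambda>t (\<rho>'', \<mu>''). t \<le> value_time + 8 \<and> \<rho>'' 10 = \<rho>' 10 \<and> ?I (Suc i) \<rho>'' \<mu>'') (\<rho>', \<mu>')"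
        using I p cl(4-6) const_bounds(1,2) sW
        by (simp add: literal_code_div literal_code_mod fun_upd_twist)
    qed (use r ptr W_inp const_bounds(1) in auto)
    then show ?thesis
      by (rule wp_mono) (auto simp: violated_def cf(3) add.commute)
  qed
  have bump: "wp bump (\<lambda>t (\<rho>', \<mu>'). t \<le> 1 + k * (11 * k + 16) \<and> represents \<mu>' (c # l)) (\<rho>, \<mu>)"
    if r: "\<rho> 10 = ptr" "\<rho> 1 = n" for \<rho>
  proof -
    let ?I = "\<lambda>i (\<rho>' :: regs) (\<mu>' :: memory). \<rho>' 1 = n \<and> (\<forall>x<n. occs x \<noteq> [] \<longrightarrow>
        \<mu>' (cell x) = resamplings \<phi> l x + of_bool (x \<in> fst ` set (take i ?C)))"
    have "wp bump (\<lambda>t (\<rho>', \<mu>'). t \<le> 1 + length ?vs * ((11 * k + 13) + 3) \<and> ?I (length ?vs) \<rho>' \<mu>') (\<rho>, \<mu>)"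
      unfolding bump_def
    proof (rule wp_list_loop)
      fix i and \<rho>' :: regs and \<mu>' :: memory
      assume i: "i < length ?vs" and I: "?I i \<rho>' \<mu>'" and p: "\<rho>' 10 + 1 < length inp" "inp ! \<rho>' 10 = ?vs ! i"
      have ik: "i < k" using i cf(3) by simp
      note cl = clause_literal[OF \<rho>(2) ik]
      let ?x = "fst (?C ! i)"
      let ?\<rho> = "\<rho>'(13 := ?x)"
      have cellS: "cell ?x < S" using cell_less[OF cl(1,2)] S by simp
      \<comment> \<open>Distinct variables ensure that no counter is incremented twice.\<close>
      have new: "?x \<notin> fst ` set (take i ?C)"
      proof
        assume "?x \<in> fst ` set (take i ?C)"
        then obtain j where "j < i" "fst (?C ! j) = ?x" using i by (auto simp: in_set_conv_nth image_iff)
        then have "map fst ?C ! j = map fst ?C ! i" "j < length (map fst ?C)" "i < length (map fst ?C)" "j \<noteq> i"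
          using i by auto
        then show False using nth_eq_iff_index_eq[OF cf(4)] by metis
      qed
      have \<mu>x: "\<mu>' (cell ?x) = resamplings \<phi> l ?x" using I cl(1,2) new by simp
      then have xW: "Suc (\<mu>' (cell ?x)) < W" using resamplings_le[of l ?x] \<mu>(2) W_tape(3) by linarith
      have other: "cell x \<noteq> cell ?x" if "x < n" "occs x \<noteq> []" "x \<noteq> ?x" for x
        using cell_inj[OF that(1,2) cl(1,2)] that(3) by blast
      have "wp (find_cell k) (\<lambda>t (\<rho>'', \<mu>''). t \<le> 8 + k * 11 \<and> \<mu>'' = \<mu>' \<and> \<rho>'' 15 = cell ?x) (?\<rho>, \<mu>')"
        using I by (intro find_cell_correct cl) auto
      then have "wp (find_cell k) (\<lambda>t. wp (Load 18 (Reg 15) ;; Arith 18 Add (Reg 18) (Const 1) ;; Store (Reg 15) (Reg 18))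
          (\<lambda>t' (\<rho>'', \<mu>''). 2 + (t + t') \<le> 11 * k + 13 \<and> \<rho>'' 10 = \<rho>' 10 \<and> ?I (Suc i) \<rho>'' \<mu>'')) (?\<rho>, \<mu>')"
      proof (rule wp_use)
        fix t \<rho>2 \<mu>2
        assume 2: "case (\<rho>2, \<mu>2) of (\<rho>'', \<mu>'') \<Rightarrow> t \<le> 8 + k * 11 \<and> \<mu>'' = \<mu>' \<and> \<rho>'' 15 = cell ?x"
          and fr: "\<And>r. r \<notin> writes (find_cell k) \<Longrightarrow> \<rho>2 r = ?\<rho> r"
        have r2: "\<rho>2 10 = \<rho>' 10" "\<rho>2 1 = n"
          using fr[of 10] fr[of 1] I by (auto simp: writes_subprograms)
        have upd: "\<forall>x<n. occs x \<noteq> [] \<longrightarrow> (\<mu>'(cell ?x := Suc (\<mu>' (cell ?x)))) (cell x) =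
            resamplings \<phi> l x + of_bool (x \<in> fst ` set (take (Suc i) ?C))"
        proof (intro allI impI)
          fix x assume x: "x < n" "occs x \<noteq> []"
          show "(\<mu>'(cell ?x := Suc (\<mu>' (cell ?x)))) (cell x) = resamplings \<phi> l x + of_bool (x \<in> fst ` set (take (Suc i) ?C))"
            using x I other[OF x] \<mu>x unfolding cl(3) by (cases "x = ?x") auto
        qed
        show "wp (Load 18 (Reg 15) ;; Arith 18 Add (Reg 18) (Const 1) ;; Store (Reg 15) (Reg 18))
          (\<lambda>t' (\<rho>'', \<mu>''). 2 + (t + t') \<le> 11 * k + 13 \<and> \<rho>'' 10 = \<rho>' 10 \<and> ?I (Suc i) \<rho>'' \<mu>'') (\<rho>2, \<mu>2)"
          using 2 r2 upd cellS xW const_bounds(1) by simp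
      qed
      then show "wp (ReadInput 13 (Reg 10) ;; Arith 13 Div (Reg 13) (Const 2) ;; find_cell k ;;
         Load 18 (Reg 15) ;; Arith 18 Add (Reg 18) (Const 1) ;; Store (Reg 15) (Reg 18))
        (\<lambda>t (\<rho>'', \<mu>''). t \<le> 11 * k + 13 \<and> \<rho>'' 10 = \<rho>' 10 \<and> ?I (Suc i) \<rho>'' \<mu>'') (\<rho>', \<mu>')"
        using I p cl(4-6) const_bounds(1,2) by (simp add: literal_code_div)
    qed (use r ptr W_inp const_bounds(1) \<mu>(1) in \<open>auto simp: represents_def\<close>)
    then show ?thesis
      by (rule wp_mono) (auto simp: represents_def clause_vars_def cf(3) add.commute)
  qed
  let ?viol = "violated V \<phi> (resamplings \<phi> l) c"
  have "wp test (\<lambda>t. wp (If (Reg 12) (Arith 10 Add (Reg 31) (Const 0) ;; bump) Skip)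
      (\<lambda>t' (\<rho>', \<mu>'). Suc (Suc (Suc (Suc (Suc (t + t'))))) \<le> visit_time \<and> represents \<mu>' (visit V \<phi> c l)))
      (\<rho>(12 := 1, 10 := ptr, 31 := ptr), \<mu>)"
  proof (rule wp_mono[OF test])
    fix t and \<rho>2 :: regs and \<mu>2 :: memory
    assume 2: "case (\<rho>2, \<mu>2) of (\<rho>', \<mu>') \<Rightarrow> t \<le> 1 + k * (value_time + 11) \<and> \<mu>' = \<mu> \<and> \<rho>' 1 = n \<and> \<rho>' 31 = ptr \<and> \<rho>' 12 = of_bool ?viol"
    show "wp (If (Reg 12) (Arith 10 Add (Reg 31) (Const 0) ;; bump) Skip)
      (\<lambda>t' (\<rho>', \<mu>'). Suc (Suc (Suc (Suc (Suc (t + t'))))) \<le> visit_time \<and> represents \<mu>' (visit V \<phi> c l)) (\<rho>2, \<mu>2)"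
    proof (cases ?viol)
      case True
      have "wp bump (\<lambda>t (\<rho>', \<mu>'). t \<le> 1 + k * (11 * k + 16) \<and> represents \<mu>' (c # l)) (\<rho>2(10 := ptr), \<mu>)"
        using 2 by (intro bump) auto
      then have "wp bump (\<lambda>t' (\<rho>', \<mu>'). Suc (Suc (Suc (Suc (Suc (t + (1 + (1 + t'))))))) \<le> visit_time \<and> represents \<mu>' (visit V \<phi> c l)) (\<rho>2(10 := ptr), \<mu>)"
        by (rule wp_mono) (use 2 True in \<open>auto simp: visit_def visit_clause_time_def algebra_simps\<close>)
      then show ?thesis using 2 True ptr(1) const_bounds(1) by simp
    next
      case False
      then show ?thesis using 2 \<mu>(1) by (simp add: visit_def visit_clause_time_def)
    qed
  qed (use \<rho> in auto)
  moreover have ptr_Suc: "inp ! Suc (Suc (c + n)) = ptr" by (simp add: ptr_def)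
  ultimately show ?thesis
    using \<rho> cf(2) W_inp const_bounds(1-3) ptr(1)
    unfolding visit_clause_def test_def[symmetric] bump_def[symmetric]
    by (simp add: ptr_Suc)
qed

end

definition walk_step :: "nat \<Rightarrow> nat \<Rightarrow> nat \<Rightarrow> com" where
  "walk_step k d B =
    Arith 28 Mod (Reg 7) (Const (d * k)) ;; Arith 7 Div (Reg 7) (Const (d * k)) ;;
    Arith 29 Mod (Reg 28) (Const d) ;; Arith 28 Div (Reg 28) (Const d) ;;
    Arith 30 Add (Reg 6) (Const 2) ;; ReadInput 30 (Reg 30) ;;
    for_loop 29 (
      Arith 32 Add (Reg 30) (Const 1) ;; ReadInput 32 (Reg 32) ;;
      If (Reg 32) (Arith 30 Add (Reg 32) (Const 0)) Skip) ;;
    ReadInput 9 (Reg 30) ;; visit_clause k d B ;;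
    Arith 30 Add (Reg 9) (Reg 1) ;; Arith 30 Add (Reg 30) (Const 2) ;; ReadInput 30 (Reg 30) ;;
    for_loop 28 (Arith 32 Add (Reg 30) (Const 1) ;; ReadInput 30 (Reg 32)) ;;
    ReadInput 6 (Reg 30) ;; Arith 6 Div (Reg 6) (Const 2)"

definition passes :: "nat \<Rightarrow> nat \<Rightarrow> nat \<Rightarrow> com" where
  "passes k d B =
    for_loop 4 (
      Arith 5 Add (Reg 3) (Const 0) ;;
      for_loop 5 (
        Arith 6 Add (Reg 0) (Const 0) ;; Arith 7 Add (Reg 5) (Const 0) ;;
        Arith 8 Add (Reg 2) (Const 0) ;; for_loop 8 (walk_step k d B)))"

definition bit_length :: com where
  "bit_length = Arith 11 Add (Reg 1) (Const 0) ;; Arith 12 Mul (Const 0) (Const 0) ;;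
    While (Reg 11) (Arith 11 Div (Reg 11) (Const 2) ;; Arith 12 Add (Reg 12) (Const 1))"

text \<open>\<open>R\<close> and \<open>J\<close> have to be computed from \<open>n\<close> by a
  fixed program: the walk length is the rational multiple \<open>a / b\<close> of the bit length of
  \<open>n\<close>, rounded down, and the number of passes is \<open>M\<close> times the bit length.
  A null list pointer recognises variables without occurrences.\<close>

definition query_program :: "nat \<Rightarrow> nat \<Rightarrow> nat \<Rightarrow> nat \<Rightarrow> nat \<Rightarrow> nat \<Rightarrow> com" where
  "query_program k d B a b M =
    Arith 10 Add (Reg 0) (Const 2) ;; ReadInput 10 (Reg 10) ;; ReadInput 1 (Const 0) ;;
    If (Reg 10)
      (bit_length ;;
       Arith 2 Mul (Reg 12) (Const a) ;; Arith 2 Div (Reg 2) (Const b) ;;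
       Arith 4 Mul (Reg 12) (Const M) ;;
       Arith 3 Add (Const 1) (Const 0) ;; Arith 5 Add (Reg 2) (Const 0) ;;
       for_loop 5 (Arith 3 Mul (Reg 3) (Const (d * k))) ;;
       passes k d B ;;
       Arith 13 Add (Reg 0) (Const 0) ;; read_value k d B ;; Arith 0 Add (Reg 27) (Const 0))
      (Arith 0 Mul (Const 0) (Const 0))"

lemma writes_walk_step: "writes (walk_step k d B) =
  {6, 7, 9, 10, 11, 12, 13, 14, 15, 16, 17, 18, 19, 20, 21, 22, 23, 24, 25, 26, 27, 28, 29, 30, 31, 32}"
  unfolding walk_step_def by (auto simp: writes_subprograms)

definition walk_step_time :: "nat \<Rightarrow> nat \<Rightarrow> nat \<Rightarrow> nat" where
  "walk_step_time k d B = 20 + 6 * d + 4 * k + visit_clause_time k d B"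

definition pass_time :: "nat \<Rightarrow> nat \<Rightarrow> nat \<Rightarrow> nat \<Rightarrow> nat" where
  "pass_time k d B R = 1 + (d * k) ^ R * (6 + R * (walk_step_time k d B + 2))"

definition query_time :: "nat \<Rightarrow> nat \<Rightarrow> nat \<Rightarrow> nat \<Rightarrow> nat \<Rightarrow> nat \<Rightarrow> nat" where
  "query_time k d B n R J =
    20 + 3 * floorlog 2 n + 3 * R + J * (pass_time k d B R + 3) + read_value_time k d B"

context machine
begin

abbreviation step_time :: nat where "step_time \<equiv> walk_step_time k d B"

section \<open>One step of a walk\<close>

lemma linked_list_next:
  assumes "linked_list inp p (drop i vs)" "i < length vs"
  shows "p \<noteq> 0" "Suc p < length inp" "inp ! p = vs ! i"
    "linked_list inp (inp ! Suc p) (drop (Suc i) vs)" "inp ! Suc p < W"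
    "inp ! Suc p = 0 \<longleftrightarrow> Suc i = length vs"
proof -
  have "drop i vs = vs ! i # drop (Suc i) vs" using assms(2) by (simp add: Cons_nth_drop_Suc)
  then show *: "p \<noteq> 0" "Suc p < length inp" "inp ! p = vs ! i" "linked_list inp (inp ! Suc p) (drop (Suc i) vs)"
    using assms(1) by auto
  show "inp ! Suc p < W" using pointer_less[OF *(4)] .
  show "inp ! Suc p = 0 \<longleftrightarrow> Suc i = length vs"
    using *(4) assms(2) by (cases "drop (Suc i) vs") auto
qed

lemma walk_step_correct:
  assumes \<rho>: "\<rho> 6 = y" "y < n" "occs y \<noteq> []" "\<rho> 7 = w" "w < W" "\<rho> 1 = n"
    and \<mu>: "represents \<mu> l" "length l < maxcount"
  defines "c \<equiv> step_clause occs d k w y"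
  shows "wp (walk_step k d B) (\<lambda>t (\<rho>', \<mu>'). t \<le> step_time \<and> represents \<mu>' (visit V \<phi> c l) \<and>
    \<rho>' 6 = fst (\<phi> ! c ! (w mod (d * k) div d)) \<and> \<rho>' 7 = w div (d * k)) (\<rho>, \<mu>)"
proof -
  define i where "i = w mod (d * k) mod d"
  define j where "j = w mod (d * k) div d"
  have i: "i < d" using d by (simp add: i_def)
  have j: "j < k" unfolding j_def by (rule digit_less)
  have c: "c < length \<phi>" unfolding c_def by (rule step_clause_occurrence(1)[OF \<rho>(2,3)])
  note cf = clause_facts[OF c]
  define body1 where "body1 = Arith 32 Add (Reg 30) (Const 1) ;; ReadInput 32 (Reg 32) ;;
      If (Reg 32) (Arith 30 Add (Reg 32) (Const 0)) Skip"
  define body2 where "body2 = Arith 32 Add (Reg 30) (Const 1) ;; ReadInput 30 (Reg 32)"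
  define tail where "tail = ReadInput 6 (Reg 30) ;; Arith 6 Div (Reg 6) (Const 2)"
  define mid where "mid = Arith 30 Add (Reg 9) (Reg 1) ;; Arith 30 Add (Reg 30) (Const 2) ;; ReadInput 30 (Reg 30) ;;
    for_loop 28 body2 ;; tail"
  define rest where "rest = ReadInput 9 (Reg 30) ;; visit_clause k d B ;; mid"
  let ?vs = "occs y"
  have vs: "?vs \<noteq> []" by (rule \<rho>(3))
  let ?I1 = "\<lambda>r (\<rho>' :: regs) (\<mu>' :: memory). \<mu>' = \<mu> \<and> linked_list inp (\<rho>' 30) (drop (min (i - r) (length ?vs - 1)) ?vs)"
  have loop1: "wp (for_loop 29 body1) (\<lambda>t (\<rho>', \<mu>'). t \<le> 1 + i * (4 + 2) \<and> \<rho>' 29 = 0 \<and> ?I1 0 \<rho>' \<mu>') (\<rho>, \<mu>)"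
    if "\<rho> 29 = i" "\<rho> 30 = inp ! (y + 2)" for \<rho>
  proof (rule wp_for_loop[where I = "?I1"])
    fix r and \<rho>' :: regs and \<mu>' :: memory
    assume r: "r < i" and I: "?I1 (Suc r) \<rho>' \<mu>'" and r29: "\<rho>' 29 = r"
    define p where "p = min (i - Suc r) (length ?vs - 1)"
    have p: "p < length ?vs" using vs by (simp add: p_def min_less_iff_disj)
    have I': "\<mu>' = \<mu>" "linked_list inp (\<rho>' 30) (drop p ?vs)" using I by (auto simp: p_def)
    note nx = linked_list_next[OF I'(2) p]
    have ir: "i - r = Suc (i - Suc r)" using r by simp
    \<comment> \<open>At the last node the successor is null and the pointer stays; this realises
      the minimum in \<open>step_clause\<close>.\<close>
    have p': "min (i - r) (length ?vs - 1) = (if Suc p = length ?vs then p else Suc p)"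
    proof -
      obtain L where "length ?vs = Suc L" using vs by (cases ?vs) auto
      then show ?thesis unfolding p_def ir min_def by (auto split: if_splits)
    qed
    show "wp body1 (\<lambda>t (\<rho>'', \<mu>'). t \<le> 4 \<and> \<rho>'' 29 = r \<and> ?I1 r \<rho>'' \<mu>') (\<rho>', \<mu>')"
      unfolding p' body1_def using I' nx r29 W_inp const_bounds(1) by simp
  qed (use that i const_bounds(1,5) var_facts(1)[OF \<rho>(2)] in auto)
  let ?cs = "map literal_code (\<phi> ! c)"
  have loop2: "wp (for_loop 28 body2) (\<lambda>t (\<rho>', \<mu>'). t \<le> 1 + j * (2 + 2) \<and> \<rho>' 28 = 0 \<and>
      (\<mu>' = \<mu> \<and> linked_list inp (\<rho>' 30) (drop (j - 0) ?cs))) (\<rho>, \<mu>)"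
    if "\<rho> 28 = j" "\<rho> 30 = inp ! (c + n + 2)" for \<rho> \<mu>
  proof (rule wp_for_loop[where I = "\<lambda>r (\<rho>' :: regs) (\<mu>' :: memory). \<mu>' = \<mu> \<and> linked_list inp (\<rho>' 30) (drop (j - r) ?cs)"])
    fix r and \<rho>' :: regs and \<mu>' :: memory
    assume r: "r < j" and I: "\<mu>' = \<mu> \<and> linked_list inp (\<rho>' 30) (drop (j - Suc r) ?cs)" and r28: "\<rho>' 28 = r"
    have "j - Suc r < length ?cs" using j cf(3) r by simp
    note nx = linked_list_next[OF conjunct2[OF I] this]
    have jr: "j - r = Suc (j - Suc r)" using r by simp
    show "wp body2 (\<lambda>t (\<rho>'', \<mu>'). t \<le> 2 \<and> \<rho>'' 28 = r \<and> (\<mu>' = \<mu> \<and> linked_list inp (\<rho>'' 30) (drop (j - r) ?cs))) (\<rho>', \<mu>')"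
      unfolding jr body2_def using I nx r28 W_inp const_bounds(1) by simp
  qed (use that j const_bounds(1,6) cf(1) in auto)
  let ?Q = "\<lambda>t (\<rho>', \<mu>'). t \<le> step_time \<and> represents \<mu>' (visit V \<phi> c l) \<and> \<rho>' 6 = fst (\<phi> ! c ! j) \<and> \<rho>' 7 = w div (d * k)"
  have mid: "wp mid (\<lambda>t (\<rho>', \<mu>'). t \<le> 6 + 4 * k \<and> \<mu>' = \<mu> \<and> \<rho>' 6 = fst (\<phi> ! c ! j) \<and> \<rho>' 7 = w div (d * k)) (\<rho>, \<mu>)"
    if r: "\<rho> 9 = c" "\<rho> 1 = n" "\<rho> 28 = j" "\<rho> 7 = w div (d * k)" for \<rho> \<mu>
  proof -
    have "wp (for_loop 28 body2) (\<lambda>t. wp tail (\<lambda>t' (\<rho>', \<mu>'). 3 + (t + t') \<le> 6 + 4 * k \<and> \<mu>' = \<mu> \<and> \<rho>' 6 = fst (\<phi> ! c ! j) \<and> \<rho>' 7 = w div (d * k)))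
      (\<rho>(30 := inp ! (c + n + 2)), \<mu>)"
    proof (rule wp_use[OF loop2])
      fix t \<rho>2 \<mu>2
      assume 2: "case (\<rho>2, \<mu>2) of (\<rho>', \<mu>') \<Rightarrow> t \<le> 1 + j * (2 + 2) \<and> \<rho>' 28 = 0 \<and>
          (\<mu>' = \<mu> \<and> linked_list inp (\<rho>' 30) (drop (j - 0) ?cs))"
        and fr: "\<And>r. r \<notin> writes (for_loop 28 body2) \<Longrightarrow> \<rho>2 r = (\<rho>(30 := inp ! (c + n + 2))) r"
      have r7: "\<rho>2 7 = w div (d * k)" using fr[of 7] r by (simp add: body2_def)
      have "j < length ?cs" using j cf(3) by simp
      then have nx: "Suc (\<rho>2 30) < length inp" "inp ! \<rho>2 30 = literal_code (\<phi> ! c ! j)"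
        using linked_list_next[of "\<rho>2 30" j ?cs] 2 by auto
      have "4 * j \<le> 4 * k" using j by simp
      then show "wp tail (\<lambda>t' (\<rho>', \<mu>'). 3 + (t + t') \<le> 6 + 4 * k \<and> \<mu>' = \<mu> \<and> \<rho>' 6 = fst (\<phi> ! c ! j) \<and> \<rho>' 7 = w div (d * k)) (\<rho>2, \<mu>2)"
        unfolding tail_def using 2 nx clause_literal[OF c j] r7 const_bounds(2) by (simp add: literal_code_div)
    qed (use r in auto)
    then show ?thesis unfolding mid_def using r cf(2) W_inp const_bounds(2) pointer_less[OF cf(1)] by simp
  qed
  have rest: "wp rest (\<lambda>t (\<rho>', \<mu>'). t \<le> 7 + 4 * k + visit_time \<and> represents \<mu>' (visit V \<phi> c l) \<and> \<rho>' 6 = fst (\<phi> ! c ! j) \<and> \<rho>' 7 = w div (d * k)) (\<rho>, \<mu>)"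
    if r: "\<rho> 30 < length inp" "inp ! \<rho> 30 = c" "\<rho> 1 = n" "\<rho> 28 = j" "\<rho> 7 = w div (d * k)" for \<rho>
  proof -
    have "wp (visit_clause k d B) (\<lambda>t. wp mid (\<lambda>t' (\<rho>', \<mu>'). Suc (t + t') \<le> 7 + 4 * k + visit_time \<and> represents \<mu>' (visit V \<phi> c l) \<and> \<rho>' 6 = fst (\<phi> ! c ! j) \<and> \<rho>' 7 = w div (d * k)))
        (\<rho>(9 := c), \<mu>)"
    proof (rule wp_use[OF visit_clause_correct[OF _ c _ \<mu>]])
      fix t \<rho>2 \<mu>2
      assume 2: "case (\<rho>2, \<mu>2) of (\<rho>', \<mu>') \<Rightarrow> t \<le> visit_time \<and> represents \<mu>' (visit V \<phi> c l)"
        and fr: "\<And>r. r \<notin> writes (visit_clause k d B) \<Longrightarrow> \<rho>2 r = (\<rho>(9 := c)) r"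
      have "\<rho>2 9 = c" "\<rho>2 1 = n" "\<rho>2 28 = j" "\<rho>2 7 = w div (d * k)"
        using fr[of 9] fr[of 1] fr[of 28] fr[of 7] r by (auto simp: writes_subprograms)
      from mid[OF this, of \<mu>2] show "wp mid (\<lambda>t' (\<rho>', \<mu>'). Suc (t + t') \<le> 7 + 4 * k + visit_time \<and> represents \<mu>' (visit V \<phi> c l) \<and> \<rho>' 6 = fst (\<phi> ! c ! j) \<and> \<rho>' 7 = w div (d * k)) (\<rho>2, \<mu>2)"
        by (rule wp_mono) (use 2 in auto)
    qed (use r in auto)
    then show ?thesis unfolding rest_def using r cf(2) W_inp by simp
  qed
  have c_vs: "c = ?vs ! min i (length ?vs - 1)" by (simp add: c_def step_clause_def i_def)
  have "wp (for_loop 29 body1) (\<lambda>t. wp rest (\<lambda>t' (\<rho>', \<mu>'). Suc (Suc (Suc (Suc (Suc (Suc (t + t')))))) \<le> step_time \<and> represents \<mu>' (visit V \<phi> c l) \<and> \<rho>' 6 = fst (\<phi> ! c ! j) \<and> \<rho>' 7 = w div (d * k)))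
      (\<rho>(7 := w div (d * k), 29 := i, 28 := j, 30 := inp ! (y + 2)), \<mu>)"
  proof (rule wp_use[OF loop1])
    fix t \<rho>2 \<mu>2
    assume 2: "case (\<rho>2, \<mu>2) of (\<rho>', \<mu>') \<Rightarrow> t \<le> 1 + i * (4 + 2) \<and> \<rho>' 29 = 0 \<and> ?I1 0 \<rho>' \<mu>'"
      and fr: "\<And>r. r \<notin> writes (for_loop 29 body1) \<Longrightarrow>
        \<rho>2 r = (\<rho>(7 := w div (d * k), 29 := i, 28 := j, 30 := inp ! (y + 2))) r"
    have r: "\<rho>2 1 = n" "\<rho>2 28 = j" "\<rho>2 7 = w div (d * k)"
      using fr[of 1] fr[of 28] fr[of 7] \<rho> by (auto simp: body1_def)
    have "min i (length ?vs - 1) < length ?vs" using vs by (simp add: min_less_iff_disj)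
    from linked_list_next(2,3)[OF _ this, of "\<rho>2 30"] 2 have nx: "\<rho>2 30 < length inp" "inp ! \<rho>2 30 = c"
      unfolding c_vs by auto
    have "\<mu>2 = \<mu>" "t \<le> 1 + 6 * d" using 2 i by auto
    moreover note rest[OF nx r]
    ultimately show "wp rest (\<lambda>t' (\<rho>', \<mu>'). Suc (Suc (Suc (Suc (Suc (Suc (t + t')))))) \<le> step_time \<and> represents \<mu>' (visit V \<phi> c l) \<and> \<rho>' 6 = fst (\<phi> ! c ! j) \<and> \<rho>' 7 = w div (d * k)) (\<rho>2, \<mu>2)"
      by (auto elim!: wp_mono simp: walk_step_time_def)
  qed auto
  moreover have "w div (d * k) < W" "w mod (d * k) < W" "i < W" "j < W"
    using \<rho>(5) i j const_bounds(5,6,9) by (auto intro: order_le_less_trans[OF div_le_dividend] order_le_less_trans[OF mod_less_eq_dividend])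
  ultimately show ?thesis
    unfolding walk_step_def rest_def[symmetric] mid_def[symmetric] tail_def[symmetric] body1_def[symmetric] body2_def[symmetric]
    using \<rho> W_var W_inp const_bounds(2,5,9) var_facts[OF \<rho>(2)] pointer_less[OF var_facts(1)[OF \<rho>(2)]]
    by (simp add: rest_def mid_def tail_def i_def[symmetric] j_def[symmetric] fun_upd_twist)
qed

section \<open>Passes and whole queries\<close>

lemma length_visits_le: "length (visits V \<phi> vs l) \<le> length l + length vs"
  using visits_extends[of V \<phi> vs l] by auto

lemma length_walk: "length (walk occs \<phi> d k r w y) = r"
  by (induction r arbitrary: w y) auto

lemma length_explore: "length (explore occs \<phi> d k R x) = (d * k) ^ R * R"
proof -
  have "map (length \<circ> (\<lambda>w. walk occs \<phi> d k R w x)) (rev [0..<N]) = replicate N R" for N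
    by (induction N) (simp_all add: length_walk replicate_append_same o_def)
  then show ?thesis by (simp add: explore_def length_concat sum_list_replicate o_def)
qed

text \<open>The invariants look ahead: the memory represents some log from which the remaining
  visits lead to the fixed final log, with enough room left below \<open>maxcount\<close>. Thus the
  three nested loops need no description of what has been done so far.\<close>

lemma passes_correct:
  assumes \<rho>: "\<rho> 0 = x" "x < n" "occs x \<noteq> []" "\<rho> 1 = n" "\<rho> 2 = R" "\<rho> 3 = (d * k) ^ R" "\<rho> 4 = J"
    and W: "R < W" "(d * k) ^ R < W" "J < W"
    and \<mu>: "represents \<mu> l" "length l + J * ((d * k) ^ R * R) \<le> maxcount"
  shows "wp (passes k d B) (\<lambda>t (\<rho>', \<mu>'). t \<le> 1 + J * (pass_time k d B R + 3) \<and> represents \<mu>' (query V occs \<phi> d k R J x l)) (\<rho>, \<mu>)"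
proof -
  let ?N = "(d * k) ^ R"
  let ?R = "\<lambda>\<rho>' :: regs. \<rho>' 0 = x \<and> \<rho>' 1 = n \<and> \<rho>' 2 = R \<and> \<rho>' 3 = ?N"
  let ?Iw = "\<lambda>L r (\<rho>' :: regs) (\<mu>' :: memory). ?R \<rho>' \<and> \<rho>' 6 < n \<and> occs (\<rho>' 6) \<noteq> [] \<and> \<rho>' 7 < W \<and>
      (\<exists>l. represents \<mu>' l \<and> visits V \<phi> (walk occs \<phi> d k r (\<rho>' 7) (\<rho>' 6)) l = L \<and> length l + r \<le> maxcount)"
  have walk_loop: "wp (for_loop 8 (walk_step k d B)) (\<lambda>t (\<rho>', \<mu>'). t \<le> 1 + R * (step_time + 2) \<and> \<rho>' 8 = 0 \<and> ?Iw L 0 \<rho>' \<mu>') (\<rho>, \<mu>)"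
    if "?Iw L R \<rho> \<mu>" "\<rho> 8 = R" for L \<rho> \<mu>
  proof (rule wp_for_loop[where I = "?Iw L"])
    fix r and \<rho>' :: regs and \<mu>' :: memory
    assume r: "r < R" and I: "?Iw L (Suc r) \<rho>' \<mu>'" and r8: "\<rho>' 8 = r"
    obtain l where l: "represents \<mu>' l" "visits V \<phi> (walk occs \<phi> d k (Suc r) (\<rho>' 7) (\<rho>' 6)) l = L" "length l + Suc r \<le> maxcount"
      using I by blast
    let ?c = "step_clause occs d k (\<rho>' 7) (\<rho>' 6)" and ?j = "\<rho>' 7 mod (d * k) div d"
    have c: "?c < length \<phi>" using I by (intro step_clause_occurrence) auto
    have "wp (walk_step k d B) (\<lambda>t (\<rho>'', \<mu>''). t \<le> step_time \<and> represents \<mu>'' (visit V \<phi> ?c l) \<and>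
      \<rho>'' 6 = fst (\<phi> ! ?c ! ?j) \<and> \<rho>'' 7 = \<rho>' 7 div (d * k)) (\<rho>', \<mu>')"
      using I l by (intro walk_step_correct) auto
    then show "wp (walk_step k d B) (\<lambda>t (\<rho>'', \<mu>'). t \<le> step_time \<and> \<rho>'' 8 = r \<and> ?Iw L r \<rho>'' \<mu>') (\<rho>', \<mu>')"
    proof (rule wp_use)
      fix t \<rho>2 \<mu>2
      assume 2: "case (\<rho>2, \<mu>2) of (\<rho>'', \<mu>'') \<Rightarrow> t \<le> step_time \<and> represents \<mu>'' (visit V \<phi> ?c l) \<and>
          \<rho>'' 6 = fst (\<phi> ! ?c ! ?j) \<and> \<rho>'' 7 = \<rho>' 7 div (d * k)"
        and fr: "\<And>r. r \<notin> writes (walk_step k d B) \<Longrightarrow> \<rho>2 r = \<rho>' r"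
      have regs: "?R \<rho>2" "\<rho>2 8 = r"
        using fr[of 0] fr[of 1] fr[of 2] fr[of 3] fr[of 8] I r8 by (auto simp: writes_walk_step)
      have "length (visit V \<phi> ?c l) + r \<le> maxcount"
        using l(3) visit_extends[of V \<phi> ?c l] by auto
      moreover have "visits V \<phi> (walk occs \<phi> d k r (\<rho>2 7) (\<rho>2 6)) (visit V \<phi> ?c l) = L"
        using l(2) 2 by simp
      moreover have "\<rho>2 7 < W" using 2 I by (auto intro: order_le_less_trans[OF div_le_dividend])
      ultimately show "case (\<rho>2, \<mu>2) of (\<rho>'', \<mu>') \<Rightarrow> t \<le> step_time \<and> \<rho>'' 8 = r \<and> ?Iw L r \<rho>'' \<mu>'"
        using 2 regs step_variable[OF c digit_less] by auto
    qed
  qed (use that W const_bounds(1) in auto)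
  let ?E = "\<lambda>w. concat (map (\<lambda>w. walk occs \<phi> d k R w x) (rev [0..<w]))"
  let ?Ip = "\<lambda>L w (\<rho>' :: regs) (\<mu>' :: memory). ?R \<rho>' \<and>
      (\<exists>l. represents \<mu>' l \<and> visits V \<phi> (?E w) l = L \<and> length l + w * R \<le> maxcount)"
  define pass_body where "pass_body = Arith 6 Add (Reg 0) (Const 0) ;; Arith 7 Add (Reg 5) (Const 0) ;;
        Arith 8 Add (Reg 2) (Const 0) ;; for_loop 8 (walk_step k d B)"
  have pass_loop: "wp (for_loop 5 pass_body) (\<lambda>t (\<rho>', \<mu>'). t \<le> 1 + ?N * (4 + R * (step_time + 2) + 2) \<and> \<rho>' 5 = 0 \<and> ?Ip L 0 \<rho>' \<mu>') (\<rho>, \<mu>)"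
    if "?Ip L ?N \<rho> \<mu>" "\<rho> 5 = ?N" for L \<rho> \<mu>
  proof (rule wp_for_loop[where I = "?Ip L"])
    fix w and \<rho>' :: regs and \<mu>' :: memory
    assume w: "w < ?N" and I: "?Ip L (Suc w) \<rho>' \<mu>'" and r5: "\<rho>' 5 = w"
    obtain l where l: "represents \<mu>' l" "visits V \<phi> (?E (Suc w)) l = L" "length l + Suc w * R \<le> maxcount"
      using I by blast
    let ?\<rho> = "\<rho>'(6 := x, 7 := w, 8 := R)"
    define l' where "l' = visits V \<phi> (walk occs \<phi> d k R w x) l"
    have "wp (for_loop 8 (walk_step k d B)) (\<lambda>t (\<rho>', \<mu>'). t \<le> 1 + R * (step_time + 2) \<and> \<rho>' 8 = 0 \<and> ?Iw l' 0 \<rho>' \<mu>') (?\<rho>, \<mu>')"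
    proof (rule walk_loop)
      show "?Iw l' R ?\<rho> \<mu>'"
        using I \<rho>(2,3) w W(2) l by (auto simp: l'_def intro!: exI[of _ l])
    qed simp
    then have "wp (for_loop 8 (walk_step k d B)) (\<lambda>t (\<rho>'', \<mu>'). Suc (Suc (Suc t)) \<le> 4 + R * (step_time + 2) \<and> \<rho>'' 5 = w \<and> ?Ip L w \<rho>'' \<mu>') (?\<rho>, \<mu>')"
    proof (rule wp_use)
      fix t \<rho>2 \<mu>2
      assume 2: "case (\<rho>2, \<mu>2) of (\<rho>', \<mu>') \<Rightarrow> t \<le> 1 + R * (step_time + 2) \<and> \<rho>' 8 = 0 \<and> ?Iw l' 0 \<rho>' \<mu>'"
        and fr: "\<And>r. r \<notin> writes (for_loop 8 (walk_step k d B)) \<Longrightarrow> \<rho>2 r = ?\<rho> r"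
      have "\<rho>2 5 = w" using fr[of 5] r5 by (simp add: writes_walk_step)
      moreover have "represents \<mu>2 l'" using 2 by auto
      moreover have "visits V \<phi> (?E w) l' = L" using l(2) by (simp add: l'_def)
      moreover have "length l' + w * R \<le> maxcount"
        using l(3) length_visits_le[of "walk occs \<phi> d k R w x" l] by (simp add: l'_def length_walk)
      ultimately show "case (\<rho>2, \<mu>2) of (\<rho>'', \<mu>') \<Rightarrow> Suc (Suc (Suc t)) \<le> 4 + R * (step_time + 2) \<and> \<rho>'' 5 = w \<and> ?Ip L w \<rho>'' \<mu>'"
        using 2 by auto
    qed
    moreover have "x < W" "w < W" using \<rho>(2) W_var w W(2) by linarith+
    ultimately show "wp pass_body (\<lambda>t (\<rho>'', \<mu>'). t \<le> 4 + R * (step_time + 2) \<and> \<rho>'' 5 = w \<and> ?Ip L w \<rho>'' \<mu>') (\<rho>', \<mu>')"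
      unfolding pass_body_def using I r5 W(1) by simp
  qed (use that W const_bounds(1) in auto)
  let ?EE = "\<lambda>j. concat (replicate j (explore occs \<phi> d k R x))"
  let ?L = "query V occs \<phi> d k R J x l"
  let ?Ij = "\<lambda>j (\<rho>' :: regs) (\<mu>' :: memory). ?R \<rho>' \<and>
      (\<exists>l. represents \<mu>' l \<and> visits V \<phi> (?EE j) l = ?L \<and> length l + j * (?N * R) \<le> maxcount)"
  have "wp (passes k d B) (\<lambda>t (\<rho>', \<mu>'). t \<le> 1 + J * ((pass_time k d B R + 1) + 2) \<and> \<rho>' 4 = 0 \<and> ?Ij 0 \<rho>' \<mu>') (\<rho>, \<mu>)"
    unfolding passes_def pass_body_def[symmetric]
  proof (rule wp_for_loop[where I = ?Ij])
    fix j and \<rho>' :: regs and \<mu>' :: memory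
    assume j: "j < J" and I: "?Ij (Suc j) \<rho>' \<mu>'" and r4: "\<rho>' 4 = j"
    obtain l where l: "represents \<mu>' l" "visits V \<phi> (?EE (Suc j)) l = ?L" "length l + Suc j * (?N * R) \<le> maxcount"
      using I by blast
    let ?\<rho> = "\<rho>'(5 := ?N)"
    define l' where "l' = visits V \<phi> (explore occs \<phi> d k R x) l"
    have "wp (for_loop 5 pass_body) (\<lambda>t (\<rho>', \<mu>'). t \<le> 1 + ?N * (4 + R * (step_time + 2) + 2) \<and> \<rho>' 5 = 0 \<and> ?Ip l' 0 \<rho>' \<mu>') (?\<rho>, \<mu>')"
    proof (rule pass_loop)
      show "?Ip l' ?N ?\<rho> \<mu>'" using I l by (auto simp: l'_def explore_def intro!: exI[of _ l])
    qed simp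
    then have "wp (for_loop 5 pass_body) (\<lambda>t (\<rho>'', \<mu>'). Suc t \<le> pass_time k d B R + 1 \<and> \<rho>'' 4 = j \<and> ?Ij j \<rho>'' \<mu>') (?\<rho>, \<mu>')"
    proof (rule wp_use)
      fix t \<rho>2 \<mu>2
      assume 2: "case (\<rho>2, \<mu>2) of (\<rho>', \<mu>') \<Rightarrow> t \<le> 1 + ?N * (4 + R * (step_time + 2) + 2) \<and> \<rho>' 5 = 0 \<and> ?Ip l' 0 \<rho>' \<mu>'"
        and fr: "\<And>r. r \<notin> writes (for_loop 5 pass_body) \<Longrightarrow> \<rho>2 r = ?\<rho> r"
      have "\<rho>2 4 = j" using fr[of 4] r4 by (simp add: pass_body_def writes_walk_step)
      moreover have "represents \<mu>2 l'" using 2 by auto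
      moreover have "visits V \<phi> (?EE j) l' = ?L" using l(2) by (simp add: l'_def)
      moreover have "length l' + j * (?N * R) \<le> maxcount"
        using l(3) length_visits_le[of "explore occs \<phi> d k R x" l] by (simp add: l'_def length_explore)
      moreover have "t \<le> pass_time k d B R" using 2 by (simp add: pass_time_def algebra_simps)
      ultimately show "case (\<rho>2, \<mu>2) of (\<rho>'', \<mu>') \<Rightarrow> Suc t \<le> pass_time k d B R + 1 \<and> \<rho>'' 4 = j \<and> ?Ij j \<rho>'' \<mu>'"
        using 2 by auto
    qed
    then show "wp (Arith 5 Add (Reg 3) (Const 0) ;; for_loop 5 pass_body)
      (\<lambda>t (\<rho>'', \<mu>'). t \<le> pass_time k d B R + 1 \<and> \<rho>'' 4 = j \<and> ?Ij j \<rho>'' \<mu>') (\<rho>', \<mu>')"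
      using I W(2) by simp
  next
    show "?Ij J \<rho> \<mu>" using \<rho> \<mu> by (auto simp: query_def intro!: exI[of _ l])
  qed (use \<rho> W const_bounds(1) in auto)
  then show ?thesis by (rule wp_mono) (auto simp: algebra_simps)
qed

lemma bit_length_correct:
  assumes "\<rho> 1 = n" and fl: "floorlog 2 n < W"
  shows "wp bit_length (\<lambda>t (\<rho>', \<mu>'). t \<le> 3 + 3 * floorlog 2 n \<and> \<mu>' = \<mu> \<and> \<rho>' 12 = floorlog 2 n) (\<rho>, \<mu>)"
proof -
  define body where "body = Arith 11 Div (Reg 11) (Const 2) ;; Arith 12 Add (Reg 12) (Const 1)"
  have loop: "wp (While (Reg 11) body) (\<lambda>t (\<rho>', \<mu>'). t \<le> 1 + 3 * floorlog 2 i \<and> \<mu>' = \<mu> \<and> \<rho>' 12 = e + floorlog 2 i) (\<rho>, \<mu>)"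
    if "\<rho> 11 = i" "\<rho> 12 = e" "e + floorlog 2 i < W" "i < W" for i e \<rho>
    using that
  proof (induction i arbitrary: e \<rho> rule: less_induct)
    case (less i)
    show ?case
    proof (cases "i = 0")
      case True
      then show ?thesis using less.prems by (subst wp_While) (simp add: floorlog_def)
    next
      case False
      then have fli: "floorlog 2 i = Suc (floorlog 2 (i div 2))" using compute_floorlog[of 2 i] by simp
      have i2: "i div 2 < W" using less.prems(4) by (auto intro: order_le_less_trans[OF div_le_dividend])
      let ?\<rho> = "\<rho>(11 := i div 2, 12 := Suc e)"
      have "wp (While (Reg 11) body) (\<lambda>t (\<rho>', \<mu>'). t \<le> 1 + 3 * floorlog 2 (i div 2) \<and> \<mu>' = \<mu> \<and> \<rho>' 12 = Suc e + floorlog 2 (i div 2)) (?\<rho>, \<mu>)"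
        using False less.prems fli i2 by (intro less.IH) auto
      then have "wp (While (Reg 11) body) (\<lambda>t' (\<rho>', \<mu>'). 1 + (1 + 1) + t' \<le> 1 + 3 * floorlog 2 i \<and> \<mu>' = \<mu> \<and> \<rho>' 12 = e + floorlog 2 i) (?\<rho>, \<mu>)"
        by (rule wp_mono) (auto simp: fli)
      then show ?thesis using False less.prems fli i2 const_bounds(1,2)
        by (subst wp_While) (simp add: body_def)
    qed
  qed
  have "wp (While (Reg 11) body) (\<lambda>t (\<rho>', \<mu>'). Suc (Suc t) \<le> 3 + 3 * floorlog 2 n \<and> \<mu>' = \<mu> \<and> \<rho>' 12 = floorlog 2 n) (\<rho>(11 := n, 12 := 0), \<mu>)"
    by (rule wp_mono[OF loop[where i = n and e = 0]]) (use assms W_var in auto)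
  then show ?thesis unfolding bit_length_def body_def[symmetric] using assms W_var by simp
qed

lemma query_program_correct:
  assumes params: "R = floorlog 2 n * a div b" "J = floorlog 2 n * M" "0 < b"
    and W: "floorlog 2 n * a < W" "J < W" "floorlog 2 n < W" "(d * k) ^ R < W" "a < W" "b < W" "M < W"
    and \<rho>: "\<rho> 0 = x" "x < n"
    and \<mu>: "represents \<mu> l" "length l + J * ((d * k) ^ R * R) \<le> maxcount"
  shows "wp (query_program k d B a b M) (\<lambda>t (\<rho>', \<mu>'). t \<le> query_time k d B n R J \<and>
    represents \<mu>' (query V occs \<phi> d k R J x l) \<and>
    (\<rho>' 0 \<noteq> 0 \<longleftrightarrow> occs x \<noteq> [] \<and> V x (resamplings \<phi> (query V occs \<phi> d k R J x l) x))) (\<rho>, \<mu>)"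
proof -
  note vf = var_facts[OF \<rho>(2)]
  let ?p = "inp ! (x + 2)"
  have p: "?p < W" using pointer_less[OF vf(1)] .
  have p0: "?p = 0 \<longleftrightarrow> occs x = []" using vf(1) by (cases "occs x") auto
  have n: "inp ! 0 = n" "0 < length inp" "n < W" "x < W"
    using input vf(2) W_var \<rho>(2) by (auto simp: input_of_def Let_def)
  define tail where "tail = Arith 13 Add (Reg 0) (Const 0) ;; read_value k d B ;; Arith 0 Add (Reg 27) (Const 0)"
  define power where "power = for_loop 5 (Arith 3 Mul (Reg 3) (Const (d * k)))"
  define mid where "mid = Arith 2 Mul (Reg 12) (Const a) ;; Arith 2 Div (Reg 2) (Const b) ;;
       Arith 4 Mul (Reg 12) (Const M) ;;
       Arith 3 Add (Const 1) (Const 0) ;; Arith 5 Add (Reg 2) (Const 0) ;;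
       power ;; passes k d B ;; tail"
  define main where "main = bit_length ;; mid"
  show ?thesis
  proof (cases "occs x = []")
    case True
    then show ?thesis
      unfolding query_program_def main_def[symmetric] mid_def[symmetric] tail_def[symmetric] power_def[symmetric]
      using p0 n \<rho> \<mu>(1) vf(2) W_var const_bounds by (simp add: query_def query_time_def)
  next
    case False
    let ?L = "query V occs \<phi> d k R J x l"
    define ans :: nat where "ans = of_bool (V x (resamplings \<phi> ?L x))"
    have ans: "ans < W" "ans \<noteq> 0 \<longleftrightarrow> V x (resamplings \<phi> ?L x)" using const_bounds(1) by (auto simp: ans_def)
    let ?Q = "\<lambda>(\<rho>', \<mu>'). represents \<mu>' ?L \<and> \<rho>' 0 = ans"
    have L: "length ?L \<le> maxcount"
    proof -
      have "length (concat (replicate J (explore occs \<phi> d k R x))) = J * ((d * k) ^ R * R)"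
        by (simp add: length_concat sum_list_replicate length_explore)
      then show ?thesis using \<mu>(2) False length_visits_le[of "concat (replicate J (explore occs \<phi> d k R x))" l]
        by (simp add: query_def)
    qed
    have tail: "wp tail (\<lambda>t s. t \<le> 2 + value_time \<and> ?Q s) (\<rho>, \<mu>)"
      if "\<rho> 0 = x" "\<rho> 1 = n" "represents \<mu> ?L" for \<rho> \<mu>
    proof -
      have "wp (read_value k d B) (\<lambda>t (\<rho>', \<mu>'). t \<le> value_time \<and> \<mu>' = \<mu> \<and> \<rho>' 27 = ans) (\<rho>(13 := x), \<mu>)"
        unfolding ans_def using that False L \<rho>(2) by (intro read_value_correct) auto
      then have "wp (read_value k d B) (\<lambda>t. wp (Arith 0 Add (Reg 27) (Const 0))
          (\<lambda>t' s. Suc (t + t') \<le> 2 + value_time \<and> ?Q s)) (\<rho>(13 := x), \<mu>)"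
        by (rule wp_mono) (use that ans in auto)
      then show ?thesis unfolding tail_def using that n by simp
    qed
    have passes_tail: "wp (passes k d B) (\<lambda>t. wp tail (\<lambda>t' s. t + t' \<le> 3 + J * (pass_time k d B R + 3) + value_time \<and> ?Q s)) (\<rho>, \<mu>)"
      if "\<rho> 0 = x" "\<rho> 1 = n" "\<rho> 2 = R" "\<rho> 3 = (d * k) ^ R" "\<rho> 4 = J" for \<rho>
    proof (rule wp_use[OF passes_correct[where R = R and J = J and l = l]])
      fix t \<rho>2 \<mu>2
      assume 2: "case (\<rho>2, \<mu>2) of (\<rho>', \<mu>') \<Rightarrow> t \<le> 1 + J * (pass_time k d B R + 3) \<and> represents \<mu>' ?L"
        and fr: "\<And>r. r \<notin> writes (passes k d B) \<Longrightarrow> \<rho>2 r = \<rho> r"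
      have "\<rho>2 0 = x" "\<rho>2 1 = n" using fr[of 0] fr[of 1] that by (auto simp: passes_def writes_walk_step)
      moreover have "represents \<mu>2 ?L" using 2 by simp
      ultimately have "wp tail (\<lambda>t s. t \<le> 2 + value_time \<and> ?Q s) (\<rho>2, \<mu>2)" by (rule tail)
      then show "wp tail (\<lambda>t' s. t + t' \<le> 3 + J * (pass_time k d B R + 3) + value_time \<and> ?Q s) (\<rho>2, \<mu>2)"
        by (rule wp_mono) (use 2 in auto)
    next
      show "R < W" using W(1) params(1) by (auto intro: order_le_less_trans[OF div_le_dividend])
    qed (use that \<rho> \<mu> W False in auto)
    have power: "wp power (\<lambda>t. wp (passes k d B) (\<lambda>t'. wp tail (\<lambda>t'' s. t + (t' + t'') \<le> 4 + R * 3 + J * (pass_time k d B R + 3) + value_time \<and> ?Q s))) (\<rho>, \<mu>)"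
      if r: "\<rho> 0 = x" "\<rho> 1 = n" "\<rho> 2 = R" "\<rho> 3 = 1" "\<rho> 4 = J" "\<rho> 5 = R" for \<rho>
    proof -
      have "wp power (\<lambda>t (\<rho>', \<mu>'). t \<le> 1 + R * (1 + 2) \<and> \<rho>' 5 = 0 \<and> (\<mu>' = \<mu> \<and> \<rho>' 3 = (d * k) ^ (R - 0))) (\<rho>, \<mu>)"
        unfolding power_def
      proof (rule wp_for_loop[where I = "\<lambda>i \<rho>' \<mu>'. \<mu>' = \<mu> \<and> \<rho>' 3 = (d * k) ^ (R - i)"])
        fix i and \<rho>' :: regs and \<mu>' :: memory
        assume i: "i < R" and I: "\<mu>' = \<mu> \<and> \<rho>' 3 = (d * k) ^ (R - Suc i)" and r5: "\<rho>' 5 = i"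
        have eq: "(d * k) ^ (R - i) = (d * k) ^ (R - Suc i) * (d * k)"
          using i by (metis Suc_diff_Suc power_Suc2)
        have "(d * k) ^ (R - i) \<le> (d * k) ^ R" using k d by (intro power_increasing) auto
        then have "(d * k) ^ (R - Suc i) * (d * k) < W" using W(4) eq by simp
        then show "wp (Arith 3 Mul (Reg 3) (Const (d * k))) (\<lambda>t (\<rho>'', \<mu>'). t \<le> 1 \<and> \<rho>'' 5 = i \<and> (\<mu>' = \<mu> \<and> \<rho>'' 3 = (d * k) ^ (R - i))) (\<rho>', \<mu>')"
          unfolding eq using I r5 const_bounds(9) by simp
      next
        show "R < W" using W(1) params(1) by (auto intro: order_le_less_trans[OF div_le_dividend])
      qed (use r const_bounds(1) in auto)
      then show ?thesis
      proof (rule wp_use)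
        fix t \<rho>2 \<mu>2
        assume 2: "case (\<rho>2, \<mu>2) of (\<rho>', \<mu>') \<Rightarrow> t \<le> 1 + R * (1 + 2) \<and> \<rho>' 5 = 0 \<and> (\<mu>' = \<mu> \<and> \<rho>' 3 = (d * k) ^ (R - 0))"
          and fr: "\<And>r. r \<notin> writes power \<Longrightarrow> \<rho>2 r = \<rho> r"
        have "wp (passes k d B) (\<lambda>t'. wp tail (\<lambda>t'' s. t' + t'' \<le> 3 + J * (pass_time k d B R + 3) + value_time \<and> ?Q s)) (\<rho>2, \<mu>)"
          using fr[of 0] fr[of 1] fr[of 2] fr[of 4] r 2 by (intro passes_tail) (auto simp: power_def)
        then show "wp (passes k d B) (\<lambda>t'. wp tail (\<lambda>t'' s. t + (t' + t'') \<le> 4 + R * 3 + J * (pass_time k d B R + 3) + value_time \<and> ?Q s)) (\<rho>2, \<mu>2)"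
          using 2 by (auto elim!: wp_mono)
      qed
    qed
    have mid: "wp mid (\<lambda>t s. t \<le> 9 + R * 3 + J * (pass_time k d B R + 3) + value_time \<and> ?Q s) (\<rho>, \<mu>)"
      if r: "\<rho> 0 = x" "\<rho> 1 = n" "\<rho> 12 = floorlog 2 n" for \<rho>
    proof -
      have "wp power (\<lambda>t. wp (passes k d B) (\<lambda>t'. wp tail (\<lambda>t'' s. t + (t' + t'') \<le> 4 + R * 3 + J * (pass_time k d B R + 3) + value_time \<and> ?Q s)))
        (\<rho>(2 := R, 4 := J, 3 := 1, 5 := R), \<mu>)"
        by (rule power) (use r in auto)
      then have "wp (power ;; passes k d B ;; tail) (\<lambda>t s. t \<le> 4 + R * 3 + J * (pass_time k d B R + 3) + value_time \<and> ?Q s) (\<rho>(2 := R, 4 := J, 3 := 1, 5 := R), \<mu>)"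
        by (simp only: wp_Seq_fun)
      moreover define rest where "rest = power ;; passes k d B ;; tail"
      ultimately have "wp rest (\<lambda>t s. Suc (Suc (Suc (Suc (Suc t)))) \<le> 9 + R * 3 + J * (pass_time k d B R + 3) + value_time \<and> ?Q s) (\<rho>(2 := R, 4 := J, 3 := 1, 5 := R), \<mu>)"
        by (auto elim!: wp_mono)
      moreover have "R < W" using W(1) params(1) by (auto intro: order_le_less_trans[OF div_le_dividend])
      ultimately show ?thesis unfolding mid_def rest_def[symmetric]
        using r W params const_bounds(1) by (simp add: fun_upd_twist)
    qed
    have "wp main (\<lambda>t s. Suc (Suc (Suc (Suc t))) \<le> query_time k d B n R J \<and> ?Q s) (\<rho>(10 := ?p, 1 := n), \<mu>)"
    proof -
      have "wp bit_length (\<lambda>t. wp mid (\<lambda>t' s. Suc (Suc (Suc (Suc (t + t')))) \<le> query_time k d B n R J \<and> ?Q s)) (\<rho>(10 := ?p, 1 := n), \<mu>)"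
      proof (rule wp_use[OF bit_length_correct])
        fix t \<rho>2 \<mu>2
        assume 2: "case (\<rho>2, \<mu>2) of (\<rho>', \<mu>') \<Rightarrow> t \<le> 3 + 3 * floorlog 2 n \<and> \<mu>' = \<mu> \<and> \<rho>' 12 = floorlog 2 n"
          and fr: "\<And>r. r \<notin> writes bit_length \<Longrightarrow> \<rho>2 r = (\<rho>(10 := ?p, 1 := n)) r"
        have "wp mid (\<lambda>t s. t \<le> 9 + R * 3 + J * (pass_time k d B R + 3) + value_time \<and> ?Q s) (\<rho>2, \<mu>)"
          using fr[of 0] fr[of 1] \<rho> 2 by (intro mid) (auto simp: bit_length_def)
        then show "wp mid (\<lambda>t' s. Suc (Suc (Suc (Suc (t + t')))) \<le> query_time k d B n R J \<and> ?Q s) (\<rho>2, \<mu>2)"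
          using 2 by (auto elim!: wp_mono simp: query_time_def)
      qed (use W in auto)
      then show ?thesis unfolding main_def by simp
    qed
    then have "wp main (\<lambda>t (\<rho>', \<mu>'). Suc (Suc (Suc (Suc t))) \<le> query_time k d B n R J \<and>
        represents \<mu>' ?L \<and> (\<rho>' 0 \<noteq> 0 \<longleftrightarrow> occs x \<noteq> [] \<and> V x (resamplings \<phi> ?L x))) (\<rho>(10 := ?p, 1 := n), \<mu>)"
      by (rule wp_mono) (use False ans in auto)
    moreover have "query_program k d B a b M = Arith 10 Add (Reg 0) (Const 2) ;; ReadInput 10 (Reg 10) ;; ReadInput 1 (Const 0) ;;
        If (Reg 10) main (Arith 0 Mul (Const 0) (Const 0))"
      by (simp add: query_program_def main_def mid_def tail_def power_def)
    ultimately show ?thesis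
      using p0 p n \<rho> vf(2) W_inp const_bounds(2) False by simp
  qed
qed

lemma answers_serve:
  assumes params: "R = floorlog 2 n * a div b" "J = floorlog 2 n * M" "0 < b"
    and W: "floorlog 2 n * a < W" "J < W" "floorlog 2 n < W" "(d * k) ^ R < W" "a < W" "b < W" "M < W"
    and t: "real (query_time k d B n R J) \<le> t"
  shows "set xs \<subseteq> {..<n} \<Longrightarrow> represents \<mu> l \<Longrightarrow> length l + length xs * (J * ((d * k) ^ R * R)) \<le> maxcount \<Longrightarrow>
    answers (query_program k d B a b M) W S t inp \<omega> \<mu> xs (serve V occs \<phi> d k R J xs l)"
proof (induction xs arbitrary: \<mu> l)
  case Nil
  show ?case by (simp add: answers.Nil)
next
  case (Cons x xs)
  let ?L = "query V occs \<phi> d k R J x l"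
  have x: "x < n" using Cons.prems by simp
  then have "((\<lambda>_. 0)(0 := x mod W) :: regs) = (\<lambda>_. 0)(0 := x)" using W_var by simp
  moreover have "wp (query_program k d B a b M) (\<lambda>t (\<rho>', \<mu>'). t \<le> query_time k d B n R J \<and>
    represents \<mu>' ?L \<and> (\<rho>' 0 \<noteq> 0 \<longleftrightarrow> occs x \<noteq> [] \<and> V x (resamplings \<phi> ?L x))) ((\<lambda>_. 0)(0 := x), \<mu>)"
    by (rule query_program_correct[OF params W _ x Cons.prems(2)]) (use Cons.prems(3) in auto)
  ultimately have "wp (query_program k d B a b M) (\<lambda>t (\<rho>', \<mu>'). t \<le> query_time k d B n R J \<and>
    represents \<mu>' ?L \<and> (\<rho>' 0 \<noteq> 0 \<longleftrightarrow> occs x \<noteq> [] \<and> V x (resamplings \<phi> ?L x))) ((\<lambda>_. 0)(0 := x mod W), \<mu>)"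
    by (simp only:)
  then obtain t' s' where
    ex': "exec W S inp \<omega> (query_program k d B a b M) ((\<lambda>_. 0)(0 := x mod W), \<mu>) t' s'"
    and s': "case s' of (\<rho>', \<mu>') \<Rightarrow> t' \<le> query_time k d B n R J \<and>
    represents \<mu>' ?L \<and> (\<rho>' 0 \<noteq> 0 \<longleftrightarrow> occs x \<noteq> [] \<and> V x (resamplings \<phi> ?L x))"
    unfolding wp_def by blast
  obtain \<rho>' \<mu>' where s'_eq: "s' = (\<rho>', \<mu>')" by (cases s')
  note ex = ex'[unfolded s'_eq]
  have *: "t' \<le> query_time k d B n R J" "represents \<mu>' ?L"
      "(\<rho>' 0 \<noteq> 0) = (occs x \<noteq> [] \<and> V x (resamplings \<phi> ?L x))"
    using s' unfolding s'_eq by auto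
  have "length ?L \<le> length l + J * ((d * k) ^ R * R)"
    using length_visits_le[of "concat (replicate J (explore occs \<phi> d k R x))" l]
    by (simp add: query_def length_concat sum_list_replicate length_explore)
  then have "answers (query_program k d B a b M) W S t inp \<omega> \<mu>' xs (serve V occs \<phi> d k R J xs ?L)"
    using Cons.prems by (intro Cons.IH *(2)) auto
  moreover have "real t' \<le> t" using *(1) t by (meson of_nat_le_iff order_trans)
  ultimately show ?case using answers.Cons[OF ex] *(3) by simp
qed

end

section \<open>Correctness and failure probability\<close>

lemma val_less: "0 < W \<Longrightarrow> \<forall>r. \<rho> r < W \<Longrightarrow> val W \<rho> a < W"
  by (cases a) auto

text \<open>Registers and cells stay below \<open>W\<close>, so only the first \<open>W\<close> bits
  can be addressed. This makes the success event measurable.\<close>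

lemma exec_tape_cong:
  assumes "exec W S inp \<omega> c s t s'" "0 < W" "\<forall>i<W. \<omega> i = \<omega>' i"
    "(\<forall>r. fst s r < W) \<and> (\<forall>i. snd s i < W)"
  shows "exec W S inp \<omega>' c s t s' \<and> (\<forall>r. fst s' r < W) \<and> (\<forall>i. snd s' i < W)"
  using assms
proof (induction rule: exec.induct)
  case Skip then show ?case using exec.Skip by simp
next
  case Arith then show ?case using exec.Arith by simp
next
  case Load then show ?case using exec.Load by simp
next
  case Store then show ?case using exec.Store val_less by simp
next
  case ReadInput then show ?case using exec.ReadInput by simp
next
  case (ReadRandom r a \<rho> \<mu>)
  then have "\<omega> (val W \<rho> a) = \<omega>' (val W \<rho> a)" using val_less by simp
  then show ?case using ReadRandom exec.ReadRandom[of W S inp \<omega>' r a \<rho> \<mu>] by simp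
next
  case (Seq c s t s' c' t' s'') then show ?case using exec.Seq[of W S inp \<omega>' c s t s' c' t' s''] by blast
next
  case (IfTrue s a c t s' c') then show ?case using exec.IfTrue[of W s a S inp \<omega>' c t s' c'] by blast
next
  case (IfFalse s a c' t s' c) then show ?case using exec.IfFalse[of W s a S inp \<omega>' c' t s' c] by blast
next
  case (WhileTrue s a c t s' t' s'')
  then show ?case using exec.WhileTrue[of W s a S inp \<omega>' c t s' t' s''] by blast
next
  case WhileFalse then show ?case using exec.WhileFalse by simp
qed

lemma answers_tape_cong:
  assumes "answers P W S t inp \<omega> \<mu> xs bs" "0 < W" "\<forall>i<W. \<omega> i = \<omega>' i" "\<forall>i. \<mu> i < W"
  shows "answers P W S t inp \<omega>' \<mu> xs bs"
  using assms
proof (induction rule: answers.induct)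
  case Nil then show ?case using answers.Nil by simp
next
  case (Cons x \<mu> t' \<rho>' \<mu>' xs bs)
  have "exec W S inp \<omega>' P ((\<lambda>_. 0)(0 := x mod W), \<mu>) t' (\<rho>', \<mu>') \<and> (\<forall>i. \<mu>' i < W)"
    using exec_tape_cong[OF Cons.hyps(1) Cons.prems(1,2)] Cons.prems by simp
  then show ?case using Cons answers.Cons by blast
qed

lemma sets_answers:
  assumes "0 < W"
  shows "{\<omega>. \<exists>bs \<sigma>. answers P W S t inp \<omega> (\<lambda>_. 0) xs bs \<and> satisfies \<sigma> \<phi> \<and> bs = map \<sigma> xs} \<in> sets tape_measure"
proof (rule sets_determined)
  have "answers P W S t inp \<omega> (\<lambda>_. 0) xs bs \<longleftrightarrow> answers P W S t inp \<omega>' (\<lambda>_. 0) xs bs"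
    if "\<forall>i\<in>{..<W}. \<omega> i = \<omega>' i" for \<omega> \<omega>' bs
    using that answers_tape_cong[OF _ assms, of P S t inp] assms by (metis lessThan_iff)
  then show "determined {..<W} {\<omega>. \<exists>bs \<sigma>. answers P W S t inp \<omega> (\<lambda>_. 0) xs bs \<and> satisfies \<sigma> \<phi> \<and> bs = map \<sigma> xs}"
    unfolding determined_def mem_Collect_eq by (intro allI impI) (simp only:)
qed simp

lemma deep_nonempty: "deep \<phi> h l \<Longrightarrow> l \<noteq> []"
  by (cases h) auto

lemma length_cnf_le:
  assumes "kcnf k n \<phi>" "max_occurrences d n \<phi>"
  shows "length \<phi> * k \<le> n * d"
proof -
  have "(\<Sum>C\<leftarrow>\<phi>. length C) = (\<Sum>C\<leftarrow>\<phi>. k)"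
    using assms(1) by (intro arg_cong[where f = sum_list] map_cong) (auto simp: kcnf_def)
  then have "length \<phi> * k = (\<Sum>x<n. card (occurrences \<phi> x))"
    using sum_occurrences[OF assms(1)] by (simp add: sum_list_triv)
  also have "\<dots> \<le> (\<Sum>x<n. d)"
    using assms(2) by (intro sum_mono) (auto simp: max_occurrences_def)
  finally show ?thesis by simp
qed

context sparse_cnf
begin

text \<open>Surviving all passes must be excluded for every clause of the formula, a later change
  only for the at most \<open>d\<close> clauses at each queried variable. So only \<open>J\<close>
  has to beat the size of the formula, and the expensive \<open>R\<close> just the number of
  queries.\<close>

lemma bad_tapes:
  assumes \<rho>: "\<rho> \<le> 1" and xs: "set xs \<subseteq> {..<n}"
  obtains A where "A \<in> sets tape_measure"
    "tape.prob A \<le> length \<phi> * (\<rho> ^ Suc J * \<mu>) + length xs * (d * (\<rho> ^ Suc R * \<mu>))"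
    "\<And>\<omega>. \<omega> \<notin> A \<Longrightarrow> (\<forall>l. valid_log (U \<omega>) \<phi> l \<longrightarrow> \<not> deep \<phi> J l) \<and>
      (\<forall>x\<in>set xs. \<forall>c l. x \<in> clause_vars (\<phi> ! c) \<longrightarrow> valid_log (U \<omega>) \<phi> (c # l) \<longrightarrow> \<not> deep \<phi> R (c # l))"
proof -
  let ?good = "\<lambda>c h A. A \<in> sets tape_measure \<and> tape.prob A \<le> \<rho> ^ Suc h * \<mu> \<and>
    {\<omega>. \<exists>l. valid_log (U \<omega>) \<phi> (c # l) \<and> deep \<phi> h (c # l)} \<subseteq> A"
  define A where "A = (\<lambda>c h. SOME A. ?good c h A)"
  have "?good c h (A c h)" if "c < length \<phi>" for c h
  proof -
    have "\<exists>A. ?good c h A" by (rule deep_log_bound[OF that \<rho>, of h]) blast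
    then show ?thesis unfolding A_def by (rule someI_ex)
  qed
  then have A: "\<And>c h. c < length \<phi> \<Longrightarrow> A c h \<in> sets tape_measure"
    "\<And>c h. c < length \<phi> \<Longrightarrow> tape.prob (A c h) \<le> \<rho> ^ Suc h * \<mu>"
    "\<And>c h. c < length \<phi> \<Longrightarrow> {\<omega>. \<exists>l. valid_log (U \<omega>) \<phi> (c # l) \<and> deep \<phi> h (c # l)} \<subseteq> A c h"
    by blast+
  let ?O = "\<lambda>x. occurrences \<phi> x"
  have fin: "finite (?O x)" and sub: "c \<in> ?O x \<Longrightarrow> c < length \<phi>" for x c by (auto simp: occurrences_def)
  have \<mu>: "0 \<le> \<rho> ^ Suc h * \<mu>" for h using \<rho>_pos z_bounds by (simp add: \<mu>_def)
  define A1 where "A1 = (\<Union>c<length \<phi>. A c J)"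
  define A2 where "A2 = (\<Union>x\<in>set xs. \<Union>c\<in>?O x. A c R)"
  have meas2: "(\<Union>c\<in>?O x. A c R) \<in> sets tape_measure" for x
    using fin sub A(1) by (intro sets.finite_UN) auto
  have meas: "A1 \<in> sets tape_measure" "A2 \<in> sets tape_measure"
    unfolding A1_def A2_def using A(1) meas2 by (auto intro!: sets.finite_UN)
  have "tape.prob A1 \<le> (\<Sum>c<length \<phi>. tape.prob (A c J))"
    unfolding A1_def using A(1) by (intro tape.finite_measure_subadditive_finite) auto
  also have "\<dots> \<le> (\<Sum>c<length \<phi>. \<rho> ^ Suc J * \<mu>)" using A(2) by (intro sum_mono) auto
  finally have 1: "tape.prob A1 \<le> length \<phi> * (\<rho> ^ Suc J * \<mu>)" by simp
  have "tape.prob (\<Union>c\<in>?O x. A c R) \<le> d * (\<rho> ^ Suc R * \<mu>)" if "x \<in> set xs" for x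
  proof -
    have "tape.prob (\<Union>c\<in>?O x. A c R) \<le> (\<Sum>c\<in>?O x. tape.prob (A c R))"
      using fin sub A(1) by (intro tape.finite_measure_subadditive_finite) auto
    also have "\<dots> \<le> (\<Sum>c\<in>?O x. \<rho> ^ Suc R * \<mu>)" using A(2) sub by (intro sum_mono) auto
    also have "\<dots> = real (card (?O x)) * (\<rho> ^ Suc R * \<mu>)" by simp
    also have "\<dots> \<le> d * (\<rho> ^ Suc R * \<mu>)"
      using occ that xs \<mu> by (intro mult_right_mono) (auto simp: max_occurrences_def)
    finally show ?thesis .
  qed
  then have "(\<Sum>x\<in>set xs. tape.prob (\<Union>c\<in>?O x. A c R)) \<le> (\<Sum>x\<in>set xs. d * (\<rho> ^ Suc R * \<mu>))"
    by (rule sum_mono)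
  moreover have "tape.prob A2 \<le> (\<Sum>x\<in>set xs. tape.prob (\<Union>c\<in>?O x. A c R))"
    unfolding A2_def using meas2 by (intro tape.finite_measure_subadditive_finite image_subsetI) simp_all
  ultimately have "tape.prob A2 \<le> (\<Sum>x\<in>set xs. d * (\<rho> ^ Suc R * \<mu>))" by linarith
  also have "\<dots> = real (card (set xs)) * (d * (\<rho> ^ Suc R * \<mu>))" by simp
  also have "\<dots> \<le> length xs * (d * (\<rho> ^ Suc R * \<mu>))"
    using card_length[of xs] \<mu>[of R] by (intro mult_right_mono mult_nonneg_nonneg[OF of_nat_0_le_iff \<mu>]) auto
  finally have 2: "tape.prob A2 \<le> length xs * (d * (\<rho> ^ Suc R * \<mu>))" .
  show ?thesis
  proof (rule that[of "A1 \<union> A2"])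
    show "A1 \<union> A2 \<in> sets tape_measure" using meas by blast
    show "tape.prob (A1 \<union> A2) \<le> length \<phi> * (\<rho> ^ Suc J * \<mu>) + length xs * (d * (\<rho> ^ Suc R * \<mu>))"
      using measure_Un_le[OF meas] 1 2 by linarith
    fix \<omega> assume \<omega>: "\<omega> \<notin> A1 \<union> A2"
    show "(\<forall>l. valid_log (U \<omega>) \<phi> l \<longrightarrow> \<not> deep \<phi> J l) \<and>
      (\<forall>x\<in>set xs. \<forall>c l. x \<in> clause_vars (\<phi> ! c) \<longrightarrow> valid_log (U \<omega>) \<phi> (c # l) \<longrightarrow> \<not> deep \<phi> R (c # l))"
    proof (intro conjI allI ballI impI notI)
      fix l assume l: "valid_log (U \<omega>) \<phi> l" "deep \<phi> J l"
      then obtain c l' where "l = c # l'" using deep_nonempty by (cases l) auto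
      then have "c < length \<phi>" "\<omega> \<in> A c J" using l A(3)[of c J] by auto
      then show False using \<omega> by (auto simp: A1_def)
    next
      fix x c l assume x: "x \<in> set xs" "x \<in> clause_vars (\<phi> ! c)" and l: "valid_log (U \<omega>) \<phi> (c # l)" "deep \<phi> R (c # l)"
      then have "c < length \<phi>" by simp
      moreover then have "\<omega> \<in> A c R" using l A(3)[of c R] by blast
      ultimately show False using \<omega> x by (auto simp: A2_def occurrences_def)
    qed
  qed
qed

text \<open>A query makes at most \<open>n\<close> visits by \<open>work\<close>, and there are at
  most \<open>n\<close> queries, so \<open>n ^ 2\<close> serves as \<open>maxcount\<close>. The
  memory has one cell per literal position of the formula.\<close>

lemma lca_correct:
  fixes a b M L R J :: nat and t \<delta> q :: real
  defines "W \<equiv> word_bound L n" and "R \<equiv> floorlog 2 n * a div b" and "J \<equiv> floorlog 2 n * M"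
  assumes \<rho>: "\<rho> \<le> 1" and b: "0 < b"
    and W_input: "2 + n + 5 * (n * d) < W" "2 * n + 4 < W" "n * d + k < W"
    and W_const: "2 ^ B * (d * (k + 1)) < W" "2 * d * k < W" "B < W" "d + k + 1 < W"
      "(n ^ 2 * n + n) * B + B < W" "(n ^ 2 + 1) * n < W" "n ^ 2 + 1 < W"
    and W: "floorlog 2 n * a < W" "J < W" "floorlog 2 n < W" "(d * k) ^ R < W" "a < W" "b < W" "M < W"
    and q: "q \<le> n" and work: "J * ((d * k) ^ R * R) \<le> n"
    and t: "real (query_time k d B n R J) \<le> t"
    and \<delta>: "n * d * (\<rho> ^ Suc J * \<mu>) + q * (d * (\<rho> ^ Suc R * \<mu>)) \<le> \<delta>"
  shows "local_computation_algorithm (query_program k d B a b M) L t (k * length \<phi>) \<delta> q n \<phi>"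
  unfolding local_computation_algorithm_def W_def[symmetric]
proof (intro allI impI)
  fix inp xs
  assume inp: "input_of inp n \<phi>" and xs: "set xs \<subseteq> {..<n}" and len: "real (length xs) \<le> q"
  let ?P = "query_program k d B a b M" and ?S = "k * length \<phi>"
  have "\<forall>x<n. \<exists>cs. distinct cs \<and> set cs = occurrences \<phi> x \<and> linked_list inp (inp ! (2 + x)) cs"
    using inp by (simp add: input_of_def Let_def)
  then obtain occs where occs: "\<And>x. x < n \<Longrightarrow> distinct (occs x) \<and> set (occs x) = occurrences \<phi> x \<and>
      linked_list inp (inp ! (2 + x)) (occs x)" by metis
  have len_occs: "length (occs x) \<le> d" if "x < n" for x
    using occs[OF that] occ that distinct_card[of "occs x"] by (auto simp: max_occurrences_def)
  have mk: "length \<phi> * k \<le> n * d" by (rule length_cnf_le[OF kcnf occ])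
  have m: "length \<phi> \<le> n * d"
  proof -
    have "length \<phi> * 1 \<le> length \<phi> * k" using k by (intro mult_le_mono) auto
    then show ?thesis using mk by linarith
  qed
  have inp_len: "length inp < W"
  proof -
    have "sum_list (map length \<phi>) = (\<Sum>C\<leftarrow>\<phi>. k)"
      using kcnf by (intro arg_cong[where f = sum_list] map_cong) (auto simp: kcnf_def)
    then have "length inp = 2 + n + length \<phi> + 4 * (length \<phi> * k)"
      using inp by (simp add: input_of_def Let_def sum_list_triv)
    then show ?thesis using mk m W_input(1) by linarith
  qed
  interpret occurrence_lists k d n \<phi> occs
    by unfold_locales (use kcnf k d occs len_occs in simp_all)
  have mach: "machine W ?S inp k d n \<phi> occs B (n ^ 2)"
  proof unfold_locales
    show "length \<phi> * k \<le> ?S" by simp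
    show "length \<phi> * k + k < W" using mk W_input(3) by linarith
  qed (use inp occ occs W_input W_const inp_len in simp_all)
  have ans: "answers ?P W ?S t inp \<omega> (\<lambda>_. 0) xs (serve (U \<omega>) occs \<phi> d k R J xs [])" for \<omega>
  proof -
    interpret machine W ?S inp \<omega> k d n \<phi> occs B "n ^ 2" by (rule mach)
    show ?thesis
    proof (rule answers_serve[OF _ _ b W t xs])
      show "represents (\<lambda>_. 0) []" by (simp add: represents_def)
      have "real (length xs) \<le> real n" using len q by linarith
      then have "length xs \<le> n" by simp
      then have "length xs * (J * ((d * k) ^ R * R)) \<le> n * n" using work by (rule mult_le_mono)
      then show "length ([] :: nat list) + length xs * (J * ((d * k) ^ R * R)) \<le> n ^ 2"
        by (simp add: power2_eq_square)
    qed (simp_all add: R_def J_def)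
  qed
  let ?G = "{\<omega>. \<exists>bs \<sigma>. answers ?P W ?S t inp \<omega> (\<lambda>_. 0) xs bs \<and> satisfies \<sigma> \<phi> \<and> bs = map \<sigma> xs}"
  obtain A where A: "A \<in> sets tape_measure"
    "tape.prob A \<le> length \<phi> * (\<rho> ^ Suc J * \<mu>) + length xs * (d * (\<rho> ^ Suc R * \<mu>))"
    "\<And>\<omega>. \<omega> \<notin> A \<Longrightarrow> (\<forall>l. valid_log (U \<omega>) \<phi> l \<longrightarrow> \<not> deep \<phi> J l) \<and>
      (\<forall>x\<in>set xs. \<forall>c l. x \<in> clause_vars (\<phi> ! c) \<longrightarrow> valid_log (U \<omega>) \<phi> (c # l) \<longrightarrow> \<not> deep \<phi> R (c # l))"
    by (rule bad_tapes[OF \<rho> xs, where J = J and R = R]) (rule that)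
  have "\<omega> \<in> ?G" if \<omega>: "\<omega> \<notin> A" for \<omega>
  proof -
    obtain \<sigma> where "satisfies \<sigma> \<phi>" "serve (U \<omega>) occs \<phi> d k R J xs [] = map \<sigma> xs"
      using serve_satisfying[OF _ _ xs] A(3)[OF \<omega>] by blast
    then show ?thesis using ans[of \<omega>] by auto
  qed
  then have sub: "space tape_measure - A \<subseteq> ?G" by auto
  have \<mu>: "0 \<le> \<rho> ^ Suc h * \<mu>" for h using \<rho>_pos z_bounds by (simp add: \<mu>_def)
  have "tape.prob A \<le> n * d * (\<rho> ^ Suc J * \<mu>) + q * (d * (\<rho> ^ Suc R * \<mu>))"
  proof (rule order_trans[OF A(2)] , rule add_mono)
    show "length \<phi> * (\<rho> ^ Suc J * \<mu>) \<le> n * d * (\<rho> ^ Suc J * \<mu>)"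
      using m \<mu>[of J] by (intro mult_right_mono) (simp_all add: of_nat_mult[symmetric] del: of_nat_mult)
    show "length xs * (d * (\<rho> ^ Suc R * \<mu>)) \<le> q * (d * (\<rho> ^ Suc R * \<mu>))"
      using len \<mu>[of R] by (intro mult_right_mono mult_nonneg_nonneg[OF of_nat_0_le_iff \<mu>]) auto
  qed
  then have "tape.prob A \<le> \<delta>" using \<delta> by linarith
  moreover have "1 - tape.prob A \<le> tape.prob ?G"
    using tape.finite_measure_mono[OF sub sets_answers] tape.prob_compl[OF A(1)] W_input(2) by simp
  ultimately have "1 - \<delta> \<le> tape.prob ?G" by linarith
  then show "(\<forall>\<omega>. \<exists>bs. answers ?P W ?S t inp \<omega> (\<lambda>_. 0) xs bs) \<and> 1 - \<delta> \<le> tape.prob ?G"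
    using ans by blast
qed

end

section \<open>Asymptotics\<close>

text \<open>Beyond the number of walks there is one factor of the bit length for the passes and one
  for the length of the walks; all the rest depends only on the constants of the program.\<close>

lemma query_time_le:
  assumes "R \<le> a * l" "l = floorlog 2 n" "0 < d * k"
  shows "query_time k d B n R (l * M) \<le>
    (23 + 3 * a + read_value_time k d B + M * (10 + a * (walk_step_time k d B + 2))) * ((l + 1) ^ 2 * (d * k) ^ R)"
proof -
  define N where "N = (d * k) ^ R"
  define X where "X = l + 1"
  define Y where "Y = X ^ 2 * N"
  let ?w = "walk_step_time k d B + 2"
  have N: "1 \<le> N" using assms(3) by (simp add: N_def)
  have X: "1 \<le> X" "l \<le> X" by (auto simp: X_def)
  have "X * 1 \<le> X * (X * N)" using X N by (intro mult_le_mono2) simp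
  then have XY: "X \<le> Y" by (simp add: Y_def power2_eq_square)
  then have Y: "1 \<le> Y" "l \<le> Y" using X by auto
  have R: "R \<le> a * X" using assms(1) X by (meson mult_le_mono2 order_trans)
  have "R \<le> a * Y" using R XY by (meson mult_le_mono2 order_trans)
  then have 1: "20 + 3 * l + 3 * R + read_value_time k d B \<le> (23 + 3 * a + read_value_time k d B) * Y"
    using Y mult_le_mono2[OF Y(1), of "read_value_time k d B"]
    unfolding add_mult_distrib mult.assoc mult_1_right by linarith
  have "pass_time k d B R + 3 = 4 + N * (6 + R * ?w)" by (simp add: pass_time_def N_def)
  also have "\<dots> \<le> N * (X * (10 + a * ?w))"
  proof -
    have "R * ?w \<le> X * (a * ?w)" using mult_le_mono1[OF R, of ?w] by (simp only: mult_ac)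
    then have "10 + R * ?w \<le> X * 10 + X * (a * ?w)" using X by linarith
    then have "N * (10 + R * ?w) \<le> N * (X * (10 + a * ?w))" by (intro mult_le_mono2) (simp only: distrib_left)
    moreover have "4 + N * (6 + R * ?w) \<le> N * (10 + R * ?w)" using N by (simp add: distrib_left)
    ultimately show ?thesis by linarith
  qed
  finally have "l * M * (pass_time k d B R + 3) \<le> X * M * (N * (X * (10 + a * ?w)))"
    using X by (intro mult_le_mono) auto
  also have "\<dots> = M * (10 + a * ?w) * Y" by (simp add: Y_def power2_eq_square mult_ac)
  finally have "query_time k d B n R (l * M) \<le> (23 + 3 * a + read_value_time k d B) * Y + M * (10 + a * ?w) * Y"
    using 1 unfolding query_time_def assms(2)[symmetric] by linarith
  then show ?thesis by (simp add: Y_def N_def X_def distrib_right)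
qed

lemma floorlog_2_bounds:
  assumes "1 \<le> n"
  shows "log 2 (real n) \<le> floorlog 2 n" "real (floorlog 2 n) \<le> log 2 (real n) + 1" "n < 2 ^ floorlog 2 n" "floorlog 2 n \<le> n"
proof -
  have l: "0 \<le> log 2 (real n)" using assms by simp
  have fl: "floorlog 2 n = nat \<lfloor>log 2 (real n)\<rfloor> + 1" using assms by (simp add: floorlog_def)
  then show *: "log 2 (real n) \<le> floorlog 2 n" "real (floorlog 2 n) \<le> log 2 (real n) + 1" using l by linarith+
  show "n < 2 ^ floorlog 2 n" using floorlog_bounds[of n 2] assms by simp
  have "2 ^ (floorlog 2 n - 1) \<le> n" using floorlog_bounds[of n 2] assms by simp
  moreover have "floorlog 2 n - 1 < 2 ^ (floorlog 2 n - 1)" by (rule less_exp)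
  ultimately show "floorlog 2 n \<le> n" by linarith
qed

text \<open>The number of walks is at most a constant times \<open>n powr g\<close> with g <
  \<beta>, and the remaining power of \<beta> - g absorbs the polylogarithmic factor.\<close>

lemma eventually_time:
  fixes a b d k :: nat and \<beta> C :: real
  assumes "0 < b" "1 \<le> d * k" and growth: "real a / b * log 2 (d * k) < \<beta>"
  shows "\<forall>\<^sub>F n in sequentially. C * ((real (floorlog 2 n) + 1) ^ 2 * real ((d * k) ^ (floorlog 2 n * a div b))) \<le> real n powr \<beta>"
proof -
  define g where "g = real a / b * log 2 (d * k)"
  have dk: "1 \<le> real (d * k)" using of_nat_mono[OF assms(2), where ?'a = real] by (simp only: of_nat_1)
  then have g0: "0 \<le> g" unfolding g_def by (intro mult_nonneg_nonneg) (simp_all del: of_nat_mult)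
  have g: "g < \<beta>" using growth by (simp add: g_def)
  \<comment> \<open>\<open>ln n / ln 2 + 2\<close> bounds the bit length plus one, and
    \<open>2 powr g\<close> pays for the bit length exceeding the logarithm by up to one.\<close>
  have "\<forall>\<^sub>F n in sequentially. \<bar>C\<bar> * ((ln (real n) / ln 2 + 2) ^ 2 * (2 powr g * real n powr g)) \<le> real n powr \<beta>"
    using g by real_asymp
  then show ?thesis using eventually_ge_at_top[of 1]
  proof eventually_elim
    case (elim n)
    let ?l = "floorlog 2 n"
    note fl = floorlog_2_bounds[OF elim(2)]
    have "real ((d * k) ^ (?l * a div b)) = real (d * k) powr real (?l * a div b)"
    proof -
      have "0 < real (d * k)" using dk by linarith
      then show ?thesis by (simp only: of_nat_power powr_realpow)
    qed
    also have "\<dots> \<le> real (d * k) powr (real a / b * ?l)"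
      using dk of_nat_div_le_of_nat[of "?l * a" b, where ?'a = real] by (intro powr_mono) (simp_all add: mult.commute)
    also have "\<dots> = 2 powr (g * ?l)"
      using dk by (simp add: g_def powr_def log_def del: of_nat_mult)
    also have "\<dots> \<le> 2 powr (g * (log 2 n + 1))"
      using fl g0 by (intro powr_mono mult_left_mono) auto
    also have "\<dots> = 2 powr g * real n powr g"
      using elim(2) by (simp add: powr_def log_def exp_add[symmetric] algebra_simps)
    finally have N: "real ((d * k) ^ (?l * a div b)) \<le> 2 powr g * real n powr g" .
    have l: "(real ?l + 1) ^ 2 \<le> (ln (real n) / ln 2 + 2) ^ 2"
      using fl by (intro power_mono) (auto simp: log_def)
    have "C * ((real ?l + 1) ^ 2 * real ((d * k) ^ (?l * a div b))) \<le> \<bar>C\<bar> * ((real ?l + 1) ^ 2 * real ((d * k) ^ (?l * a div b)))"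
      by (intro mult_right_mono) auto
    also have "\<dots> \<le> \<bar>C\<bar> * ((ln (real n) / ln 2 + 2) ^ 2 * (2 powr g * real n powr g))"
      using N l by (intro mult_left_mono mult_mono) auto
    also note elim(1)
    finally show ?case .
  qed
qed

lemma eventually_failure_a:
  fixes \<gamma> e1 e2 C :: real
  assumes "e1 < - \<gamma>" "e2 < - \<gamma>" "0 < C"
  shows "\<forall>\<^sub>F n in sequentially. C * real n powr e1 + C * real n powr e2 \<le> real n powr - \<gamma>"
proof -
  have "\<forall>\<^sub>F n in sequentially. C * real n powr e \<le> real n powr - \<gamma> / 2" if "e < - \<gamma>" for e
    using that assms(3) by real_asymp
  from this[OF assms(1)] this[OF assms(2)] show ?thesis by eventually_elim linarith
qed

lemma eventually_failure_b:
  fixes c e1 e2 C :: real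
  assumes "e1 < 0" "e2 < 0" "0 < c" "0 < C"
  shows "\<forall>\<^sub>F n in sequentially. C * real n powr e1 + ln (real n) powr c * (C * real n powr e2) \<le> ln (real n) powr - c"
proof -
  have "\<forall>\<^sub>F n in sequentially. C * real n powr e1 \<le> ln (real n) powr - c / 2"
    using assms by real_asymp
  moreover have "\<forall>\<^sub>F n in sequentially. ln (real n) powr c * (C * real n powr e2) \<le> ln (real n) powr - c / 2"
    using assms by real_asymp
  ultimately show ?thesis by eventually_elim linarith
qed

lemma eventually_ln_powr_le: 
  fixes c :: real shows "0 < c \<Longrightarrow> \<forall>\<^sub>F n in sequentially. ln (real n) powr c \<le> real n"
  by real_asymp

text \<open>The quadratic Taylor term makes the slack positive. It depends on \<open>k\<close>
  alone, so \<open>B\<close> is a constant of the program and does not grow with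
  \<open>n\<close>.\<close>

lemma exists_precision:
  fixes k :: nat
  assumes "2 \<le> k"
  shows "\<exists>B. 1 / 2 ^ B \<le> (exp (1 / k) - 1 - 1 / k) / 2 * (1 - 2 / (k + 1))"
proof -
  have "1 + 1 / real k + (1 / real k)\<^sup>2 / 2 \<le> exp (1 / real k)" by (rule exp_lower_Taylor_quadratic) simp
  moreover have "0 < (1 / real k)\<^sup>2 / 2" using assms by simp
  ultimately have "0 < exp (1 / real k) - 1 - 1 / real k" by linarith
  moreover have "0 < 1 - 2 / real (k + 1)" using assms by simp
  ultimately have "0 < (exp (1 / k) - 1 - 1 / k) / 2 * (1 - 2 / (k + 1))" by simp
  moreover have one_half_less_one: "(1 / 2 :: real) < 1" by simp
  ultimately obtain B where "(1 / 2 :: real) ^ B < (exp (1 / k) - 1 - 1 / k) / 2 * (1 - 2 / (k + 1))"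
    using real_arch_pow_inv[OF _ one_half_less_one] by blast
  then show ?thesis by (intro exI[of _ B]) (simp add: power_one_over)
qed

section \<open>Choice of the parameters\<close>

lemma powr_log_swap: "0 < x \<Longrightarrow> 0 < y \<Longrightarrow> x powr (c * log 2 y) = y powr (c * log 2 x)" for x y c :: real
  by (simp add: powr_def log_def)

lemma power_floorlog_le:
  fixes \<rho> c :: real
  assumes "0 < \<rho>" "\<rho> \<le> 1" "1 \<le> n" "0 \<le> c" "c * floorlog 2 n \<le> real h"
  shows "\<rho> ^ h \<le> real n powr (c * log 2 \<rho>)"
proof -
  have "\<rho> ^ h = \<rho> powr real h" using assms(1) by (simp add: powr_realpow)
  also have "\<dots> \<le> \<rho> powr (c * log 2 n)"
  proof (rule powr_mono')
    have "c * log 2 n \<le> c * floorlog 2 n" using floorlog_2_bounds[OF assms(3)] assms(4) by (intro mult_left_mono)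
    then show "c * log 2 n \<le> real h" using assms(5) by linarith
  qed (use assms in auto)
  also have "\<dots> = real n powr (c * log 2 \<rho>)" using assms by (intro powr_log_swap) auto
  finally show ?thesis .
qed

lemma word_bound_less:
  assumes "1 \<le> n" shows "n ^ L \<le> word_bound L n"
proof -
  have "n ^ L \<le> (2 ^ floorlog 2 n) ^ L" using floorlog_2_bounds(3)[OF assms] by (intro power_mono) auto
  then show ?thesis by (simp add: word_bound_def power_mult[symmetric] mult.commute)
qed

lemma (in sparse_cnf) local_algorithm:
  fixes a b M :: nat and t \<delta> q :: real
  defines "R \<equiv> floorlog 2 n * a div b" and "J \<equiv> floorlog 2 n * M"
  assumes \<rho>: "\<rho> \<le> 1" and b: "0 < b" and M: "0 < M"
    and n: "2 ^ B * (d * (k + 1)) + 2 * d * k + B + d + k + a + b + M + 20 \<le> n"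
    and q: "0 \<le> q" "q \<le> n"
    and t: "real (query_time k d B n R J) \<le> t" "t \<le> n"
    and \<delta>: "d * \<mu> * real n powr (1 + M * log 2 \<rho>) + q * (d * \<mu> * real n powr (real a / b * log 2 \<rho>)) \<le> \<delta>"
  shows "local_computation_algorithm (query_program k d B a b M) 5 t (k * length \<phi>) \<delta> q n \<phi>"
proof -
  define W where "W = word_bound 5 n"
  \<comment> \<open>The largest numbers are tape addresses: up to about \<open>n ^ 2\<close> rows of
    \<open>n\<close> columns with blocks of \<open>B \<le> n\<close> bits, so roughly
    \<open>n ^ 4\<close>. Five bit lengths per word leave enough room. With the powers as atoms all
    bounds below become linear.\<close>
  define n2 where "n2 = n * n"
  define n3 where "n3 = n2 * n"
  define n4 where "n4 = n3 * n"
  have n20: "20 \<le> n" using n by linarith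
  have pow: "20 * n \<le> n2" "20 * n2 \<le> n3" "20 * n3 \<le> n4" "20 * n4 \<le> n4 * n"
    unfolding n2_def n3_def n4_def using n20 by (auto simp: mult.commute)
  have "n4 * n = n ^ 5" by (simp add: n4_def n3_def n2_def power_numeral_reduce)
  then have W: "20 * n4 \<le> W" using pow(4) word_bound_less[of n 5] n20 by (simp add: W_def)
  have small: "d \<le> n" "k \<le> n" "a \<le> n" "b \<le> n" "M \<le> n" "B \<le> n" using n by linarith+
  have nd: "n * d \<le> n2" unfolding n2_def using small by (intro mult_le_mono) auto
  have fl: "floorlog 2 n \<le> n" "1 \<le> floorlog 2 n" using floorlog_2_bounds[of n] n20 by (auto simp: floorlog_def)
  have fa: "floorlog 2 n * a \<le> n2" "J \<le> n2"
    unfolding n2_def J_def using small fl by (auto intro: mult_le_mono)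
  have "real (query_time k d B n R J) \<le> real n" using t by linarith
  then have qt: "query_time k d B n R J \<le> n" by simp
  have J1: "1 \<le> J" using fl M by (simp add: J_def)
  \<comment> \<open>Visits take time, so the time bound already limits their number. With
    \<open>R + 1\<close> in place of \<open>R\<close> the same inequality bounds
    \<open>(d * k) ^ R\<close> even if \<open>R\<close> is 0.\<close>
  have work: "J * ((d * k) ^ R * (R + 1)) \<le> n"
  proof -
    have "R + 1 \<le> 6 + R * (walk_step_time k d B + 2)" by simp
    then have "(d * k) ^ R * (R + 1) \<le> pass_time k d B R + 3"
      unfolding pass_time_def using mult_le_mono2[of "R + 1" "6 + R * (walk_step_time k d B + 2)" "(d * k) ^ R"] by linarith
    then have "J * ((d * k) ^ R * (R + 1)) \<le> J * (pass_time k d B R + 3)" by (rule mult_le_mono2)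
    also have "\<dots> \<le> query_time k d B n R J" by (simp add: query_time_def)
    finally show ?thesis using qt by linarith
  qed
  have "1 * ((d * k) ^ R * 1) \<le> J * ((d * k) ^ R * (R + 1))" using J1 by (intro mult_le_mono) auto
  then have dkR: "(d * k) ^ R \<le> n" using work by linarith
  have work': "J * ((d * k) ^ R * R) \<le> n"
    by (rule order_trans[OF _ work]) (intro mult_le_mono2, simp)
  have tape: "(n ^ 2 * n + n) * B + B < W" "(n ^ 2 + 1) * n < W" "n ^ 2 + 1 < W"
  proof -
    have "(n3 + n) * B + B \<le> (n3 + n) * n + n" using small by (intro add_mono mult_le_mono2) auto
    moreover have "(n3 + n) * n + n = n4 + n2 + n" "(n2 + 1) * n = n3 + n"
      by (simp_all add: n3_def n2_def n4_def distrib_right)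
    moreover have sq: "n ^ 2 = n2" by (simp add: n2_def power2_eq_square)
    ultimately show "(n ^ 2 * n + n) * B + B < W" "(n ^ 2 + 1) * n < W" "n ^ 2 + 1 < W"
      unfolding sq n3_def[symmetric] using W pow n20 by linarith+
  qed
  have input: "2 + n + 5 * (n * d) < W" "2 * n + 4 < W" "n * d + k < W"
    using W pow nd small n20 by linarith+
  have const: "2 ^ B * (d * (k + 1)) < W" "2 * d * k < W" "B < W" "d + k + 1 < W"
    using W pow n n20 by linarith+
  have param: "floorlog 2 n * a < W" "J < W" "floorlog 2 n < W" "(d * k) ^ R < W" "a < W" "b < W" "M < W"
    using W pow fa fl dkR small n20 by linarith+
  have pos: "0 < n" using n20 by linarith
  have \<mu>: "0 \<le> \<mu>" using z_bounds by (simp add: \<mu>_def)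
  have fail: "n * d * (\<rho> ^ Suc J * \<mu>) + q * (d * (\<rho> ^ Suc R * \<mu>)) \<le> \<delta>"
  proof -
    have "\<rho> ^ Suc J \<le> real n powr (M * log 2 \<rho>)"
      using \<rho>_pos \<rho> pos by (intro power_floorlog_le) (auto simp: J_def)
    then have "n * d * (\<rho> ^ Suc J * \<mu>) \<le> n * d * (real n powr (M * log 2 \<rho>) * \<mu>)"
      using \<mu> by (intro mult_left_mono mult_right_mono) auto
    also have "\<dots> = d * \<mu> * real n powr (1 + M * log 2 \<rho>)" using pos by (simp add: powr_add)
    finally have 1: "n * d * (\<rho> ^ Suc J * \<mu>) \<le> d * \<mu> * real n powr (1 + M * log 2 \<rho>)" .
    \<comment> \<open>The extra factor \<rho> of a witness with \<open>Suc R\<close> events makes up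
      for rounding down in \<open>R\<close>.\<close>
    have "real a / b * floorlog 2 n \<le> real (Suc R)"
    proof -
      have "real (floorlog 2 n * a) / real b - real (floorlog 2 n * a div b) < 1"
        by (rule divide_nat_diff_div_nat_less_one)
      then show ?thesis by (simp add: R_def mult.commute)
    qed
    then have "\<rho> ^ Suc R \<le> real n powr (real a / b * log 2 \<rho>)"
      using \<rho>_pos \<rho> pos by (intro power_floorlog_le) auto
    then have "q * (d * (\<rho> ^ Suc R * \<mu>)) \<le> q * (d * (real n powr (real a / b * log 2 \<rho>) * \<mu>))"
      using \<mu> q by (intro mult_left_mono mult_right_mono) auto
    then show ?thesis using 1 \<delta> by (simp add: mult_ac)
  qed
  show ?thesis
    using lca_correct[where L = 5 and a = a and b = b and M = M and q = q and \<delta> = \<delta> and t = t,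
      folded W_def R_def J_def, OF \<rho> b input const tape param q(2) work' t(1) fail] .
qed

lemma local_algorithm_exists:
  fixes k d a b M :: nat and \<beta> :: real and \<delta> q :: "nat \<Rightarrow> real"
  defines "\<rho> \<equiv> exp 1 * (real d * (real k + 1)) / 2 ^ (k + 1)"
    and "z \<equiv> 2 / (real d * (real k + 1))"
  assumes k: "2 \<le> k" and d: "1 \<le> d" and \<rho>: "\<rho> \<le> 1" and b: "0 < b" and M: "0 < M" and \<beta>: "\<beta> \<le> 1"
    and growth: "real a / b * log 2 (d * k) < \<beta>"
    and q: "\<forall>\<^sub>F n in sequentially. 0 \<le> q n \<and> q n \<le> n"
    and fail: "\<forall>\<^sub>F n in sequentially. d * (z / (1 - z)) * real n powr (1 + M * log 2 \<rho>) +
        q n * (d * (z / (1 - z)) * real n powr (real a / b * log 2 \<rho>)) \<le> \<delta> n"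
  shows "exists_lca k d (\<lambda>n. real n powr \<beta>) \<delta> q"
proof -
  obtain B where B: "1 / 2 ^ B \<le> (exp (1 / k) - 1 - 1 / k) / 2 * (1 - 2 / (k + 1))"
    using exists_precision[OF k] by blast
  define C where "C = 23 + 3 * a + read_value_time k d B + M * (10 + a * (walk_step_time k d B + 2))"
  have dk: "0 < d * k" "1 \<le> d * k" using k d by auto
  have "\<forall>\<^sub>F n in sequentially. C * ((real (floorlog 2 n) + 1) ^ 2 * real ((d * k) ^ (floorlog 2 n * a div b))) \<le> real n powr \<beta>"
    by (rule eventually_time[OF b dk(2) growth])
  moreover have "\<forall>\<^sub>F n in sequentially. 2 ^ B * (d * (k + 1)) + 2 * d * k + B + d + k + a + b + M + 20 \<le> n"
    by (rule eventually_ge_at_top)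
  ultimately have "\<forall>\<^sub>F n in sequentially. \<forall>\<phi>. kcnf k n \<phi> \<longrightarrow> max_occurrences d n \<phi> \<longrightarrow>
      local_computation_algorithm (query_program k d B a b M) 5 (real n powr \<beta>) (k * length \<phi>) (\<delta> n) (q n) n \<phi>"
    using q fail
  proof eventually_elim
    case (elim n)
    show ?case
    proof (intro allI impI)
      fix \<phi> assume \<phi>: "kcnf k n \<phi>" "max_occurrences d n \<phi>"
      interpret sparse_cnf k d n B \<phi> by unfold_locales (use \<phi> k d B in simp_all)
      let ?l = "floorlog 2 n"
      have eqs: "sparse_cnf.\<rho> k d = \<rho>" "sparse_cnf.\<mu> k d = z / (1 - z)"
        by (simp_all add: \<rho>_def \<mu>_def z_def assms(1,2))
      have "?l * a div b \<le> a * ?l" by (metis div_le_dividend mult.commute)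
      from query_time_le[OF this refl dk(1), of B M]
      have "real (query_time k d B n (?l * a div b) (?l * M)) \<le> real (C * ((?l + 1) ^ 2 * (d * k) ^ (?l * a div b)))"
        unfolding C_def by (rule of_nat_mono)
      also have "\<dots> = C * ((real ?l + 1) ^ 2 * real ((d * k) ^ (?l * a div b)))" by simp
      also have "\<dots> \<le> real n powr \<beta>" by (rule elim(1))
      finally have t: "real (query_time k d B n (?l * a div b) (?l * M)) \<le> real n powr \<beta>" .
      have "real n powr \<beta> \<le> real n powr 1" using elim(2) \<beta> by (intro powr_mono) auto
      then have n: "real n powr \<beta> \<le> n" using elim(2) by simp
      show "local_computation_algorithm (query_program k d B a b M) 5 (real n powr \<beta>) (k * length \<phi>) (\<delta> n) (q n) n \<phi>"
        by (rule local_algorithm[OF _ b M elim(2) _ _ t n]) (use elim \<rho> eqs in simp_all)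
    qed
  qed
  then show ?thesis unfolding exists_lca_def eventually_sequentially by blast
qed

text \<open>Without occurrences there are no clauses, so any answers that depend only on the queried
  variable will do; \<open>Skip\<close> answers whether the query word is nonzero.\<close>

lemma exists_lca_no_occurrences:
  assumes "1 \<le> k" "0 \<le> \<beta>" "\<And>n. 0 \<le> \<delta> n"
  shows "exists_lca k 0 (\<lambda>n. real n powr \<beta>) \<delta> q"
proof -
  have "local_computation_algorithm Skip 1 (real n powr \<beta>) (0 * length \<phi>) (\<delta> n) (q n) n \<phi>"
    if n: "1 \<le> n" and \<phi>: "kcnf k n \<phi>" "max_occurrences 0 n \<phi>" for n \<phi>
  proof -
    have "length \<phi> * k \<le> n * 0" by (rule length_cnf_le[OF \<phi>])
    then have "\<phi> = []" using assms(1) by simp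
    then have sat: "satisfies \<sigma> \<phi>" for \<sigma> by (simp add: satisfies_def)
    have t: "real 1 \<le> real n powr \<beta>" using n assms(2) by (simp add: ge_one_powr_ge_zero)
    have ans: "answers Skip W S (real n powr \<beta>) inp \<omega> \<mu> xs (map (\<lambda>x. x mod W \<noteq> 0) xs)" for W S inp \<omega> \<mu> xs
    proof (induction xs)
      case (Cons x xs)
      from answers.Cons[OF exec.Skip t this] show ?case by simp
    qed (simp add: answers.Nil)
    have "{\<omega>. \<exists>bs \<sigma>. answers Skip W S (real n powr \<beta>) inp \<omega> (\<lambda>_. 0) xs bs \<and> satisfies \<sigma> \<phi> \<and> bs = map \<sigma> xs} = UNIV" for W S inp xs
      using ans sat by blast
    moreover have "\<exists>bs. answers Skip W S (real n powr \<beta>) inp \<omega> \<mu> xs bs" for W S inp \<omega> \<mu> xs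
      using ans by blast
    ultimately show ?thesis unfolding local_computation_algorithm_def
      using assms(3)[of n] tape.prob_space by simp
  qed
  then show ?thesis unfolding exists_lca_def by blast
qed

lemma rational_between:
  fixes x y :: real
  assumes "0 \<le> x" "x < y"
  obtains a b :: nat where "0 < b" "x < real a / b" "real a / b < y"
proof -
  obtain r where r: "r \<in> \<rat>" "x < r" "r < y" using Rats_dense_in_real[OF assms(2)] by blast
  then obtain a b :: nat where "b \<noteq> 0" "\<bar>r\<bar> = real a / real b" using Rats_abs_nat_div_natE by metis
  then show ?thesis using that[of b a] r assms(1) by simp
qed

text \<open>For k = 1 the quantity is \<open>exp 1 * d / 2\<close>, which is at least 1.\<close>

lemma k_ge_2:
  fixes k d :: nat
  assumes "1 \<le> k" "1 \<le> d" "exp 1 * (real d * (real k + 1)) / 2 ^ (k + 1) < 1"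
  shows "2 \<le> k"
proof (rule ccontr)
  assume "\<not> 2 \<le> k"
  then have "k = 1" using assms(1) by simp
  moreover have "2 \<le> exp (1 :: real)" using exp_ge_add_one_self[of 1] by simp
  moreover have "2 * 1 \<le> exp 1 * real d" using calculation(2) assms(2) by (intro mult_mono) auto
  ultimately show False using assms(3) by (simp add: mult.commute)
qed

theorem theorem2:
  fixes k d :: nat
  assumes "k \<ge> 1"
  shows
    "(\<forall>\<eta>>0. (real d * (real k + 1)) powr (1 + \<eta>) \<le> 2 ^ (k + 1) / exp 1 \<longrightarrow>
        (\<forall>\<alpha>\<in>{0<..1}. \<forall>\<beta>\<in>{0<..1}. \<forall>\<gamma>\<in>{0<..1}. (\<alpha> + \<gamma>) / \<beta> < \<eta> \<longrightarrow>
          exists_lca k d (\<lambda>n. real n powr \<beta>) (\<lambda>n. real n powr - \<gamma>) (\<lambda>n. real n powr \<alpha>)))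
   \<and> (\<forall>\<epsilon>>0. real d * (real k + 1) \<le> (1 - \<epsilon>) * 2 ^ (k + 1) / exp 1 \<longrightarrow>
        (\<forall>\<beta>\<in>{0<..1}. \<forall>c>0.
          exists_lca k d (\<lambda>n. real n powr \<beta>)
            (\<lambda>n. ln (real n) powr - c) (\<lambda>n. ln (real n) powr c)))"
proof (cases "d = 0")
  case True
  then show ?thesis using exists_lca_no_occurrences[OF assms] by auto
next
  case False
  then have d: "1 \<le> d" by simp
  define \<Lambda> where "\<Lambda> = real d * (real k + 1)"
  define \<rho> where "\<rho> = exp 1 * (real d * (real k + 1)) / 2 ^ (k + 1)"
  define z where "z = 2 / (real d * (real k + 1))"
  define C where "C = d * (z / (1 - z))"
  have \<Lambda>2: "2 \<le> \<Lambda>" unfolding \<Lambda>_def using d assms mult_mono[of 1 "real d" 2 "real k + 1"] by simp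
  have \<rho>_pos: "0 < \<rho>" using d by (simp add: \<rho>_def add_nonneg_pos)
  have facts: "2 \<le> k" "0 < C" "log 2 \<rho> < 0" "log 2 (d * k) \<le> log 2 \<Lambda>" if "\<rho> < 1"
  proof -
    show k: "2 \<le> k" using k_ge_2[OF assms d] that by (simp add: \<rho>_def)
    have "1 * 3 \<le> real d * (real k + 1)" using k d by (intro mult_mono) auto
    then have "0 < z" "z < 1" by (auto simp: z_def)
    then show "0 < C" using d by (simp add: C_def)
    show "log 2 \<rho> < 0" using that \<rho>_pos by simp
    have "real (d * k) \<le> \<Lambda>" by (simp add: \<Lambda>_def distrib_left)
    moreover have "0 < real (d * k)" using d k by simp
    ultimately show "log 2 (d * k) \<le> log 2 \<Lambda>" by (intro log_mono) auto
  qed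
  have log\<Lambda>: "1 \<le> log 2 \<Lambda>" using \<Lambda>2 by simp
  have growth: "real a / b * log 2 (d * k) < \<beta>" if "\<rho> < 1" "real a / b < \<beta> / log 2 \<Lambda>" for a b :: nat and \<beta>
  proof -
    have "real a / b * log 2 (d * k) \<le> real a / b * log 2 \<Lambda>"
      using facts(4)[OF that(1)] by (intro mult_left_mono) auto
    also have "\<dots> < \<beta>" using that(2) log\<Lambda> by (simp add: pos_less_divide_eq)
    finally show ?thesis .
  qed
  note algorithm = local_algorithm_exists[where k = k, OF _ d, folded \<rho>_def z_def, folded C_def]
  show ?thesis
  proof (intro conjI allI ballI impI)
    fix \<eta> \<alpha> \<beta> \<gamma> :: real
    assume \<eta>: "0 < \<eta>" and h: "(real d * (real k + 1)) powr (1 + \<eta>) \<le> 2 ^ (k + 1) / exp 1"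
      and \<alpha>: "\<alpha> \<in> {0<..1}" and \<beta>: "\<beta> \<in> {0<..1}" and \<gamma>: "\<gamma> \<in> {0<..1}" and hyp: "(\<alpha> + \<gamma>) / \<beta> < \<eta>"
    have \<rho>_le: "\<rho> \<le> \<Lambda> powr - \<eta>"
    proof -
      have "\<Lambda> * \<Lambda> powr \<eta> \<le> 2 ^ (k + 1) / exp 1"
        using h \<Lambda>2 by (simp add: \<Lambda>_def[symmetric] powr_add)
      then have "exp 1 * \<Lambda> * \<Lambda> powr \<eta> \<le> 2 ^ (k + 1)" by (simp add: pos_le_divide_eq mult_ac)
      then have "\<rho> * \<Lambda> powr \<eta> \<le> 1" by (simp add: \<rho>_def \<Lambda>_def[symmetric] pos_divide_le_eq)
      moreover have "0 < \<Lambda> powr \<eta>" using \<Lambda>2 by simp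
      ultimately show ?thesis by (simp add: powr_minus pos_le_divide_eq inverse_eq_divide)
    qed
    have "\<Lambda> powr - \<eta> < \<Lambda> powr 0" using \<Lambda>2 \<eta> by (intro powr_less_mono) auto
    then have \<rho>1: "\<rho> < 1" using \<rho>_le \<Lambda>2 by simp
    note f = facts[OF \<rho>1]
    have "log 2 \<rho> \<le> log 2 (\<Lambda> powr - \<eta>)" using \<rho>_le \<rho>_pos \<Lambda>2 by (intro log_mono) auto
    also have "\<dots> = - \<eta> * log 2 \<Lambda>" using \<Lambda>2 by (simp add: log_powr)
    finally have log\<rho>: "log 2 \<rho> \<le> - \<eta> * log 2 \<Lambda>" .
    \<comment> \<open>\<open>a / b\<close> faces two demands:
      \<open>a / b * log 2 \<Lambda> < \<beta>\<close> for the time and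
      \<open>a / b * \<eta> * log 2 \<Lambda> > \<alpha> + \<gamma>\<close> for the failure
      probability. The hypothesis says precisely that the interval between them is nonempty.\<close>
    have "(\<alpha> + \<gamma>) / \<eta> < \<beta>" using hyp \<beta> \<eta> by (simp add: pos_divide_less_eq mult.commute)
    then have "(\<alpha> + \<gamma>) / \<eta> / log 2 \<Lambda> < \<beta> / log 2 \<Lambda>"
      using log\<Lambda> by (intro divide_strict_right_mono) auto
    moreover have "0 \<le> (\<alpha> + \<gamma>) / \<eta> / log 2 \<Lambda>" using \<alpha> \<gamma> \<eta> log\<Lambda> by auto
    ultimately obtain a b :: nat where ab: "0 < b" "(\<alpha> + \<gamma>) / \<eta> / log 2 \<Lambda> < real a / b" "real a / b < \<beta> / log 2 \<Lambda>"
      using rational_between by blast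
    have e2: "\<alpha> + real a / b * log 2 \<rho> < - \<gamma>"
    proof -
      have "\<alpha> + \<gamma> < real a / b * (\<eta> * log 2 \<Lambda>)"
        using ab(2) \<eta> log\<Lambda> by (simp add: pos_divide_less_eq mult_ac)
      also have "\<dots> \<le> real a / b * (- log 2 \<rho>)" using log\<rho> by (intro mult_left_mono) auto
      finally show ?thesis by simp
    qed
    \<comment> \<open>The passes must beat the factor \<open>n\<close> from the union over all
      clauses in addition to the permitted \<open>n powr - \<gamma>\<close>.\<close>
    obtain M where M: "(2 + \<gamma>) / - log 2 \<rho> < real M" using reals_Archimedean2 by blast
    have M0: "0 < M" using M f(3) \<gamma> by (cases M) (auto simp: field_simps)
    have "2 + \<gamma> < real M * - log 2 \<rho>" using M f(3) by (simp only: pos_divide_less_eq neg_0_less_iff_less)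
    then have e1: "1 + M * log 2 \<rho> < - \<gamma>" by simp
    show "exists_lca k d (\<lambda>n. real n powr \<beta>) (\<lambda>n. real n powr - \<gamma>) (\<lambda>n. real n powr \<alpha>)"
    proof (rule algorithm[OF f(1) less_imp_le[OF \<rho>1] ab(1) M0 _ growth[OF \<rho>1 ab(3)]])
      show "\<beta> \<le> 1" using \<beta> by simp
      show "\<forall>\<^sub>F n in sequentially. 0 \<le> real n powr \<alpha> \<and> real n powr \<alpha> \<le> real n"
        using eventually_ge_at_top[of 1]
      proof eventually_elim
        case (elim n)
        then have "real n powr \<alpha> \<le> real n powr 1" using \<alpha> by (intro powr_mono) auto
        then show ?case by simp
      qed
      have "\<forall>\<^sub>F n in sequentially. C * real n powr (1 + M * log 2 \<rho>) + C * real n powr (\<alpha> + real a / b * log 2 \<rho>) \<le> real n powr - \<gamma>"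
        by (rule eventually_failure_a[OF e1 e2 f(2)])
      then show "\<forall>\<^sub>F n in sequentially. C * real n powr (1 + M * log 2 \<rho>) +
          real n powr \<alpha> * (C * real n powr (real a / b * log 2 \<rho>)) \<le> real n powr - \<gamma>"
        by eventually_elim (simp add: powr_add mult_ac)
    qed
  next
    fix \<epsilon> \<beta> c :: real
    assume \<epsilon>: "0 < \<epsilon>" and h: "real d * (real k + 1) \<le> (1 - \<epsilon>) * 2 ^ (k + 1) / exp 1"
      and \<beta>: "\<beta> \<in> {0<..1}" and c: "0 < c"
    have "\<rho> \<le> 1 - \<epsilon>" using h by (simp add: \<rho>_def pos_le_divide_eq pos_divide_le_eq mult_ac)
    then have \<rho>1: "\<rho> < 1" using \<epsilon> by linarith
    note f = facts[OF \<rho>1]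
    \<comment> \<open>Here only the time limits \<open>a / b\<close> from above: any positive value
      gives a failure probability that is a negative power of \<open>n\<close>.\<close>
    have "0 < \<beta> / log 2 \<Lambda>" using \<beta> log\<Lambda> by simp
    then obtain a b :: nat where ab: "0 < b" "0 < real a / b" "real a / b < \<beta> / log 2 \<Lambda>"
      using rational_between[of 0] by blast
    have e2: "real a / b * log 2 \<rho> < 0" using ab f(3) by (intro mult_pos_neg)
    obtain M where M: "1 / - log 2 \<rho> < real M" using reals_Archimedean2 by blast
    have M0: "0 < M" using M f(3) by (cases M) (auto simp: field_simps)
    have "1 < real M * - log 2 \<rho>" using M f(3) by (simp only: pos_divide_less_eq neg_0_less_iff_less)
    then have e1: "1 + M * log 2 \<rho> < 0" by simp
    show "exists_lca k d (\<lambda>n. real n powr \<beta>) (\<lambda>n. ln (real n) powr - c) (\<lambda>n. ln (real n) powr c)"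
    proof (rule algorithm[OF f(1) less_imp_le[OF \<rho>1] ab(1) M0 _ growth[OF \<rho>1 ab(3)]])
      show "\<beta> \<le> 1" using \<beta> by simp
      show "\<forall>\<^sub>F n in sequentially. 0 \<le> ln (real n) powr c \<and> ln (real n) powr c \<le> real n"
        using eventually_ln_powr_le[OF c] by eventually_elim simp
      show "\<forall>\<^sub>F n in sequentially. C * real n powr (1 + M * log 2 \<rho>) +
          ln (real n) powr c * (C * real n powr (real a / b * log 2 \<rho>)) \<le> ln (real n) powr - c"
        by (rule eventually_failure_b[OF e1 e2 c f(2)])
    qed
  qed
qed

end
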